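(* Let $\ell>0$, let $(u,\mu)\in\mathcal{D}_{\mathrm{per}}$ and let $a\in\mathbb{R}$. Let $\sigma_+$ and $\sigma_-$ be the periodic and the antiperiodic spectrum of the differential equation $-f''+\frac14 f=z\,\omega f+z^2\upsilon f$ associated with $(u,\mu)$. Then for either choice of sign (upper signs for the periodic case, lower signs for the antiperiodic case) and for every $\lambda\in\sigma_\pm$ one has $$\frac{1}{\lambda^2}\le\frac{\pm1}{\cosh(\ell/2)\mp1}\biggl(\int_a^{a+\ell}u(x)\,dx\biggr)^2+\frac{2\sinh(\ell/2)}{\cosh(\ell/2)\mp1}\int_{[a,a+\ell)}d\mu.$$
   Context: Borel measures on $\mathbb{R}$ are assumed finite on compact sets. Fix $\ell>0$. $H^1_{\mathrm{loc}}(\mathbb{R})$ is the space of locally absolutely continuous functions with locally square integrable derivative, and $H^1_{\mathrm{c}}(\mathbb{R})$ the subspace of those with compact support. $\mathcal{D}_{\mathrm{per}}$ is the set of all pairs $(u,\mu)$ such that $u$ is an $\ell$-periodic real-valued function in $H^1_{\mathrm{loc}}(\mathbb{R})$ and $\mu$ is an $\ell$-periodic non-negative Borel measure on $\mathbb{R}$ with $\mu(B)\ge\int_B u(x)^2+u'(x)^2\,dx$ for every Borel set $B\subseteq\mathbb{R}$. With $(u,\mu)$ one associates the distribution $\omega(h)=\int_{\mathbb{R}}u h\,dx+\int_{\mathbb{R}}u'h'\,dx$, $h\in H^1_{\mathrm{c}}(\mathbb{R})$ (i.e. $\omega=u-u''$), and the $\ell$-periodic non-negative Borel measure $\upsilon$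 given by $\mu(B)=\int_B u(x)^2+u'(x)^2\,dx+\upsilon(B)$ for all Borel sets $B$. For $z\in\mathbb{C}$, a solution of $$-f''+\tfrac14 f=z\,\omega f+z^2\upsilon f\qquad(\mathrm{E})$$ is a (complex-valued) function $f\in H^1_{\mathrm{loc}}(\mathbb{R})$ with $\int_{\mathbb{R}}f'h'\,dx+\frac14\int_{\mathbb{R}}fh\,dx=z\,\omega(fh)+z^2\int_{\mathbb{R}}fh\,d\upsilon$ for all $h\in H^1_{\mathrm{c}}(\mathbb{R})$. For each solution $f$ there is a unique left-continuous function $f^{[1]}$ (the quasi-derivative) with $f^{[1]}=f'-zu'f$ almost everywhere. The periodic spectrum $\sigma_+$ (resp. antiperiodic spectrum $\sigma_-$) is the set of $z\in\mathbb{C}$ for which (E) has a nontrivial solution $f$ with $(f(a),f^{[1]}(a))=\pm(f(a+\ell),f^{[1]}(a+\ell))$, with sign $+$ (resp. $-$). These spectra do not depend on the base point $a$, and they consist of non-zero real numbers. *)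

theory Defs
  imports "HOL-Analysis.Analysis"
begin

section \<open>Sobolev spaces on the real line\<close>

definition absolutely_continuous_fun_on :: "real set \<Rightarrow> (real \<Rightarrow> 'a::real_normed_vector) \<Rightarrow> bool" where
  "absolutely_continuous_fun_on S f \<longleftrightarrow>
     (\<forall>\<epsilon>>0. \<exists>\<delta>>0. \<forall>D T. D division_of T \<and> T \<subseteq> S \<and> (\<Sum>K\<in>D. measure lborel K) < \<delta> \<longrightarrow>
        (\<Sum>K\<in>D. norm (f (Sup K) - f (Inf K))) < \<epsilon>)"

definition locally_square_integrable :: "(real \<Rightarrow> 'a::real_normed_vector) \<Rightarrow> bool" where
  "locally_square_integrable f \<longleftrightarrow>
     f \<in> borel_measurable lebesgue \<and> (\<forall>a b. set_integrable lebesgue {a..b} (\<lambda>x. (norm (f x))\<^sup>2))"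

text \<open>
  Differentiability almost everywhere is automatic for locally absolutely continuous real or
  complex functions; it is listed only so that the derivative in the last clause is seen to be
  the actual derivative almost everywhere, since \<^const>\<open>vector_derivative\<close> is a total function.
\<close>

definition H1_loc :: "(real \<Rightarrow> 'a::real_normed_vector) set" where
  "H1_loc = {f. (\<forall>a b. absolutely_continuous_fun_on {a..b} f) \<and>
                (AE x in lebesgue. f differentiable (at x)) \<and>
                locally_square_integrable (\<lambda>x. vector_derivative f (at x))}"

definition H1_c :: "(real \<Rightarrow> 'a::real_normed_vector) set" where
  "H1_c = {h \<in> H1_loc. compact (closure {x. h x \<noteq> 0})}"

section \<open>Periodic pairs and the associated coefficients\<close>

definition periodic_fun_with :: "real \<Rightarrow> (real \<Rightarrow> 'a) \<Rightarrow> bool" where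
  "periodic_fun_with l f \<longleftrightarrow> (\<forall>x. f (x + l) = f x)"

definition periodic_borel_measure :: "real \<Rightarrow> real measure \<Rightarrow> bool" where
  "periodic_borel_measure l M \<longleftrightarrow>
     sets M = sets borel \<and>
     (\<forall>K. compact K \<longrightarrow> emeasure M K < \<infinity>) \<and>
     (\<forall>B\<in>sets borel. emeasure M ((\<lambda>x. x + l) ` B) = emeasure M B)"

definition D_per :: "real \<Rightarrow> ((real \<Rightarrow> real) \<times> real measure) set" where
  "D_per l = {(u, \<mu>). u \<in> H1_loc \<and> periodic_fun_with l u \<and> periodic_borel_measure l \<mu> \<and>
     (\<forall>B\<in>sets borel.
        emeasure \<mu> B \<ge> (\<integral>\<^sup>+x\<in>B. ennreal ((u x)\<^sup>2 + (vector_derivative u (at x))\<^sup>2) \<partial>lebesgue))}"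

text \<open>
  As \<open>\<mu>\<close> is finite on compact sets, at most one measure \<open>\<upsilon>\<close> satisfies the following relation,
  and for \<open>(u, \<mu>) \<in> D_per l\<close> there is one.
\<close>

definition is_upsilon :: "real \<Rightarrow> (real \<Rightarrow> real) \<Rightarrow> real measure \<Rightarrow> real measure \<Rightarrow> bool" where
  "is_upsilon l u \<mu> \<upsilon> \<longleftrightarrow> periodic_borel_measure l \<upsilon> \<and>
     (\<forall>B\<in>sets borel.
        emeasure \<mu> B =
          (\<integral>\<^sup>+x\<in>B. ennreal ((u x)\<^sup>2 + (vector_derivative u (at x))\<^sup>2) \<partial>lebesgue) + emeasure \<upsilon> B)"

definition omega :: "(real \<Rightarrow> real) \<Rightarrow> (real \<Rightarrow> complex) \<Rightarrow> complex" where
  "omega u h =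
     (\<integral>x. complex_of_real (u x) * h x \<partial>lebesgue) +
     (\<integral>x. complex_of_real (vector_derivative u (at x)) * vector_derivative h (at x) \<partial>lebesgue)"

section \<open>The differential equation and its spectra\<close>

definition is_solution ::
    "(real \<Rightarrow> real) \<Rightarrow> real measure \<Rightarrow> complex \<Rightarrow> (real \<Rightarrow> complex) \<Rightarrow> bool" where
  "is_solution u \<upsilon> z f \<longleftrightarrow> f \<in> H1_loc \<and>
     (\<forall>h\<in>H1_c.
        (\<integral>x. vector_derivative f (at x) * vector_derivative h (at x) \<partial>lebesgue)
          + 1/4 * (\<integral>x. f x * h x \<partial>lebesgue)
        = z * omega u (\<lambda>x. f x * h x) + z\<^sup>2 * (\<integral>x. f x * h x \<partial>\<upsilon>))"

definition is_quasi_derivative ::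
    "(real \<Rightarrow> real) \<Rightarrow> complex \<Rightarrow> (real \<Rightarrow> complex) \<Rightarrow> (real \<Rightarrow> complex) \<Rightarrow> bool" where
  "is_quasi_derivative u z f f1 \<longleftrightarrow>
     (\<forall>x. continuous (at_left x) f1) \<and>
     (AE x in lebesgue.
        f1 x = vector_derivative f (at x) - z * complex_of_real (vector_derivative u (at x)) * f x)"

text \<open>The argument \<open>b\<close> of the spectra is the base point of the boundary condition.\<close>

definition periodic_spectrum ::
    "real \<Rightarrow> (real \<Rightarrow> real) \<Rightarrow> real measure \<Rightarrow> real \<Rightarrow> complex set" where
  "periodic_spectrum l u \<upsilon> b =
     {z. \<exists>f f1. is_solution u \<upsilon> z f \<and> is_quasi_derivative u z f f1 \<and> (\<exists>x. f x \<noteq> 0) \<and>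
           f b = f (b + l) \<and> f1 b = f1 (b + l)}"

definition antiperiodic_spectrum ::
    "real \<Rightarrow> (real \<Rightarrow> real) \<Rightarrow> real measure \<Rightarrow> real \<Rightarrow> complex set" where
  "antiperiodic_spectrum l u \<upsilon> b =
     {z. \<exists>f f1. is_solution u \<upsilon> z f \<and> is_quasi_derivative u z f f1 \<and> (\<exists>x. f x \<noteq> 0) \<and>
           f b = - f (b + l) \<and> f1 b = - f1 (b + l)}"

end

(* On the period I = [b, b + l] put A = -d^2/dx^2 + 1/4 with the periodic or antiperiodic boundary
   condition. For an eigenfunction f at z, testing the equation with the conjugate of f gives
   X = z w + z^2 W with X = <A f, f> > 0, w = omega(|f|^2) real and W the integral of |f|^2 with
   respect to upsilon; hence z is real and non-zero. If w^2 <= P X^2 and W <= G U X, where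
   U = upsilon(I), then (X - z^2 W)^2 <= z^2 P X^2 yields 1/z^2 <= P + 2 G U, which is the bound.

   Both estimates come from the factorisation A = D^* D, D = d/dx + 1/2: with phi = D f one has
   X = ||phi||^2 and f = E phi for an explicit exponential kernel E. As the rows of E have constant
   L^2-norm squared G, |f|^2 <= G X. With v = u + u', integration by parts turns w into
   2 Re <v f, phi>, i.e. into the quadratic form in phi with kernel
   M(x,y) = v(x) E(x,y) + v(y) E(y,x). Cauchy-Schwarz gives P = ||M||^2, and this is explicit because
   E(x,y) E(y,x) is constant off the diagonal. In operator terms P + 2 G U is the squared
   Hilbert-Schmidt norm of the operator whose eigenvalues are the 1/z. *)

theory Submission
  imports Defs
begin

section \<open>Absolutely continuous functions\<close>

text \<open>The equation may only be tested with compactly supported functions, while the argument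
  needs it on one period. Hence Green's formula on [c, d) is derived from piecewise linear cutoffs.
  They rise to the left of each end point: \<open>f1\<close> is only left-continuous and \<upsilon>
  may have atoms, and this choice produces the values of \<open>f1\<close> at the ends together with
  the half-open interval. Strict positivity of X is a second obstacle, since a nontrivial
  \<open>f\<close> might vanish on the chosen period; a uniqueness theorem for the initial value
  problem excludes this. It is run in L^2, because u' is merely square integrable. The constants
  come from s = \<epsilon> exp(-l/2), with \<epsilon> = 1 or -1: the kernel gives G = (1 - s^2)/(1 -
  s)^2 and E(x,y) E(y,x) = s/(1 - s)^2 off the diagonal. Periodicity of u removes the integrals of
  u' and u u', so P is 2G times the integral of u^2 + u'^2 plus 2s/(1 - s)^2 times the square of the
  integral of u. The first term and 2GU share the factor 2G, which is why they merge into
  \<mu>.\<close>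

lemma borel_measurable_lebesgue_cong_AE:
  assumes f: "f \<in> borel_measurable lebesgue" and eq: "AE x in lebesgue. f x = g x"
  shows "g \<in> borel_measurable lebesgue"
proof (rule measurableI)
  obtain N where N: "N \<in> null_sets lebesgue" "{x. f x \<noteq> g x} \<subseteq> N"
    using eq by (force elim!: AE_E simp: null_sets_def)
  fix B :: "'b set" assume "B \<in> sets borel"
  then have "f -` B \<in> sets lebesgue" using measurable_sets[OF f] by auto
  \<comment> \<open>Completeness of Lebesgue measure: every subset of the null set \<open>N\<close>
    is measurable.\<close>
  moreover have "g -` B \<inter> N \<in> sets lebesgue"
    by (meson N(1) inf_le2 null_sets_completion_iff2 null_setsD2 null_sets_completion_subset)
  moreover have "g -` B = (f -` B - N) \<union> (g -` B \<inter> N)"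
    using N(2) by (auto simp: subset_iff) metis+
  ultimately show "g -` B \<inter> space lebesgue \<in> sets lebesgue"
    using N(1) by (metis Int_UNIV_right null_setsD2 sets.Diff sets.Un space_completion space_lborel space_borel)
qed auto

text \<open>A gauge argument. Intervals tagged at points of differentiability obey the straddle
  estimate. Intervals tagged in the exceptional null set \<open>N\<close> are forced into a small
  open set, where absolute continuity controls the total increment of \<open>f\<close>; redefining
  the derivative as 0 on \<open>N\<close> removes their Riemann terms.\<close>

lemma fundamental_theorem_of_calculus_absolutely_continuous:
  fixes f :: "real \<Rightarrow> 'a::euclidean_space"
  assumes "a \<le> b" and ac: "absolutely_continuous_fun_on {a..b} f"
    and diff: "AE x in lebesgue. f differentiable (at x)"
  shows "((\<lambda>x. vector_derivative f (at x)) has_integral (f b - f a)) {a..b}"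
proof -
  obtain N where N: "N \<in> null_sets lebesgue" "{x. \<not> f differentiable (at x)} \<subseteq> N"
    using diff by (force elim!: AE_E simp: null_sets_def)
  define g where "g x = (if x \<in> N then 0 else vector_derivative f (at x))" for x
  have "(g has_integral (f b - f a)) {a..b}"
    unfolding box_real[symmetric] has_integral
  proof (intro allI impI)
    fix e :: real assume "e > 0"
    \<comment> \<open>The good intervals contribute at most \<open>e2 * (b - a)\<close>, hence at
      most e/4, and the bad ones less than e/2; the summand 1 covers \<open>a = b\<close>.\<close>
    define e2 where "e2 = e / (4 * (b - a + 1))"
    have "e2 > 0" using \<open>e > 0\<close> \<open>a \<le> b\<close> by (auto simp: e2_def)
    have "\<forall>x. \<exists>d>0. x \<notin> N \<longrightarrow>
         (\<forall>y. norm (y-x) < d \<longrightarrow> norm (f y - f x - (y-x) *\<^sub>R g x) \<le> e2 * norm (y-x))"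
    proof
      fix x
      have "(f has_vector_derivative g x) (at x)" if "x \<notin> N"
        using N(2) that by (auto simp: g_def vector_derivative_works[symmetric])
      then show "\<exists>d>0. x \<notin> N \<longrightarrow>
         (\<forall>y. norm (y-x) < d \<longrightarrow> norm (f y - f x - (y-x) *\<^sub>R g x) \<le> e2 * norm (y-x))"
        using \<open>e2 > 0\<close> unfolding has_vector_derivative_def has_derivative_within_alt
        by (metis UNIV_I zero_less_one)
    qed
    then obtain d where d: "\<And>x. 0 < d x"
       "\<And>x y. \<lbrakk>x \<notin> N; norm (y-x) < d x\<rbrakk> \<Longrightarrow> norm (f y - f x - (y-x) *\<^sub>R g x) \<le> e2 * norm (y-x)"
      by metis
    obtain \<delta> where "\<delta> > 0" and \<delta>: "\<And>D T. D division_of T \<Longrightarrow> T \<subseteq> {a..b} \<Longrightarrow>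
        (\<Sum>K\<in>D. measure lborel K) < \<delta> \<Longrightarrow> (\<Sum>K\<in>D. norm (f (Sup K) - f (Inf K))) < e / 2"
      using ac \<open>e > 0\<close> unfolding absolutely_continuous_fun_on_def by (meson half_gt_zero)
    obtain G where G: "open G" "N \<subseteq> G" "G - N \<in> lmeasurable" "emeasure lebesgue (G - N) < ennreal \<delta>"
      using sets_lebesgue_outer_open[of N \<delta>] N(1) \<open>\<delta> > 0\<close> by blast
    have "emeasure lebesgue G = emeasure lebesgue (G - N)"
      using N(1) G(1) by (simp add: emeasure_Diff_null_set)
    then have mG: "emeasure lebesgue G < ennreal \<delta>" using G by simp
    define \<gamma> where "\<gamma> x = (if x \<in> N then G else ball x (d x))" for x
    show "\<exists>\<gamma>. gauge \<gamma> \<and> (\<forall>\<D>. \<D> tagged_division_of cbox a b \<and> \<gamma> fine \<D> \<longrightarrow>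
          norm ((\<Sum>(x, k)\<in>\<D>. measure lborel k *\<^sub>R g x) - (f b - f a)) < e)"
    proof (intro exI[of _ \<gamma>] conjI allI impI; (elim conjE)?)
      show "gauge \<gamma>" using G d(1) by (auto simp: gauge_def \<gamma>_def)
      fix p assume ptag: "p tagged_division_of cbox a b" and fine: "\<gamma> fine p"
      have fin: "finite p" using ptag by auto
      define p1 where "p1 = {xk \<in> p. fst xk \<notin> N}"
      define p2 where "p2 = {xk \<in> p. fst xk \<in> N}"
      define F where "F = (\<lambda>(x::real,K). measure lborel K *\<^sub>R g x - (f (Sup K) - f (Inf K)))"
      have sub: "p1 \<subseteq> p" "p2 \<subseteq> p" "p = p1 \<union> p2" "p1 \<inter> p2 = {}" "finite p1" "finite p2"
        using fin by (auto simp: p1_def p2_def)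
      have ba: "b - a = (\<Sum>(x,K)\<in>p. Sup K - Inf K)" "f b - f a = (\<Sum>(x,K)\<in>p. f(Sup K) - f(Inf K))"
        using additive_tagged_division_1[where f= "\<lambda>x. x"] additive_tagged_division_1[where f= f]
            \<open>a \<le> b\<close> ptag by auto
      have pt: "norm (F xk) \<le> e2 * (Sup (snd xk) - Inf (snd xk))" if "xk \<in> p1" for xk
      proof -
        obtain x K where xk: "xk = (x, K)" by (cases xk)
        have xK: "(x, K) \<in> p" "x \<notin> N" using that xk by (auto simp: p1_def)
        then have "x \<in> K" using ptag by blast
        then obtain u v where k: "K = cbox u v" using ptag xK by auto
        have uv: "u \<le> v" "u \<le> x" "x \<le> v" using \<open>x \<in> K\<close> unfolding k by auto
        have "K \<subseteq> ball x (d x)" using fine xK by (force simp: fine_def \<gamma>_def)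
        moreover have "u \<in> K" "v \<in> K" using uv by (auto simp: k)
        ultimately have "norm (u - x) < d x" "norm (v - x) < d x"
          by (auto simp: dist_real_def)
        note du = d(2)[OF xK(2) this(1)] and dv = d(2)[OF xK(2) this(2)]
        have "norm ((v - u) *\<^sub>R g x - (f v - f u)) =
            norm (f u - f x - (u - x) *\<^sub>R g x - (f v - f x - (v - x) *\<^sub>R g x))"
          by (auto simp: algebra_simps)
        also have "\<dots> \<le> norm (f u - f x - (u - x) *\<^sub>R g x) + norm (f v - f x - (v - x) *\<^sub>R g x)"
          by (rule norm_triangle_ineq4)
        also have "\<dots> \<le> e2 * norm (u - x) + e2 * norm (v - x)"
          using du dv by (rule add_mono)
        also have "\<dots> = e2 * (v - u)" using uv by (simp add: algebra_simps)
        finally show ?thesis using uv by (simp add: F_def xk k)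
      qed
      have le: "0 \<le> Sup (snd xk) - Inf (snd xk)" if "xk \<in> p" for xk
      proof -
        obtain x K where xk: "xk = (x, K)" by (cases xk)
        have xK: "(x, K) \<in> p" using that xk by simp
        have "x \<in> K" using tagged_division_ofD(2)[OF ptag xK] .
        moreover obtain u v where k: "K = cbox u v" using tagged_division_ofD(4)[OF ptag xK] by blast
        ultimately have "u \<le> v" by auto
        then show ?thesis by (simp add: xk k)
      qed
      have "norm (sum F p1) \<le> (\<Sum>xk\<in>p1. e2 * (Sup (snd xk) - Inf (snd xk)))"
        using pt by (rule sum_norm_le)
      also have "\<dots> \<le> (\<Sum>xk\<in>p. e2 * (Sup (snd xk) - Inf (snd xk)))"
        using le \<open>e2 > 0\<close> fin by (intro sum_mono2) (auto simp: p1_def)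
      also have "\<dots> = e2 * (b - a)" by (simp add: ba sum_distrib_left split_def)
      finally have 1: "norm (sum F p1) \<le> e2 * (b - a)" .
      have part: "p2 tagged_partial_division_of cbox a b"
        using ptag sub(2) by (meson tagged_division_of_def tagged_partial_division_subset)
      \<comment> \<open>Forgetting the tags loses nothing: two pairs with the same interval must
        have it degenerate, and then its increment is 0.\<close>
      define D where "D = snd ` p2"
      have div: "D division_of \<Union>D"
        using partial_division_of_tagged_division[OF part] by (simp add: D_def)
      have "K \<in> sets lborel" if "K \<in> D" for K using div that by auto
      then have "(\<Sum>K\<in>D. measure lborel K) = (\<Sum>K\<in>D. measure lebesgue K)"
        by (intro sum.cong) (auto simp: measure_completion)
      also have "\<dots> = measure lebesgue (\<Union>D)" using content_division[OF div] .
      also have "\<dots> < \<delta>"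
      proof -
        have "\<Union>D \<subseteq> G"
          using fine by (auto simp: D_def p2_def fine_def \<gamma>_def split: if_splits) fastforce
        moreover have "G \<in> sets lebesgue" using G(1) by simp
        ultimately have "emeasure lebesgue (\<Union>D) < ennreal \<delta>"
          using mG by (meson emeasure_mono le_less_trans)
        then show ?thesis using lmeasurable_division[OF div] \<open>\<delta> > 0\<close>
          by (simp add: emeasure_eq_measure2 ennreal_less_iff)
      qed
      finally have small: "(\<Sum>K\<in>D. norm (f (Sup K) - f (Inf K))) < e / 2"
        using div tagged_partial_division_ofD(3)[OF part] by (intro \<delta>[of D "\<Union>D"]) (fastforce simp: D_def)+
      \<comment> \<open>\<open>Sup\<close> and \<open>Inf\<close> of the empty set carry no
        information, and the passage from tagged pairs to intervals requires the value 0 on every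
        interval with empty interior, the empty one included.\<close>
      define q where "q K = (if K = {} then 0 else norm (f (Sup K) - f (Inf K)))" for K
      have ne: "K \<noteq> {}" if "(x, K) \<in> p2" for x K
        using tagged_partial_division_ofD(2)[OF part that] by auto
      have "norm (sum F p2) \<le> (\<Sum>xk\<in>p2. (\<lambda>(_,K). q K) xk)"
        using ne by (intro sum_norm_le) (auto simp: F_def p2_def g_def q_def norm_minus_commute)
      also have "\<dots> = (\<Sum>K\<in>D. q K)"
        unfolding D_def
      proof (rule sum.over_tagged_division_lemma[OF tagged_partial_division_of_Union_self[OF part]])
        fix u v :: real assume "box u v = {}"
        then show "q (cbox u v) = 0"
          by (cases "u = v") (auto simp: q_def)
      qed
      also have "\<dots> = (\<Sum>K\<in>D. norm (f (Sup K) - f (Inf K)))"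
        using ne by (intro sum.cong) (auto simp: q_def D_def)
      finally have 2: "norm (sum F p2) < e / 2" using small by simp
      have "(\<Sum>(x, k)\<in>p. measure lborel k *\<^sub>R g x) - (f b - f a) = sum F p"
        by (simp add: ba F_def split_def sum_subtractf)
      also have "\<dots> = sum F p1 + sum F p2"
        using sub by (metis sum.union_disjoint)
      finally have "norm ((\<Sum>(x, k)\<in>p. measure lborel k *\<^sub>R g x) - (f b - f a)) \<le> norm (sum F p1) + norm (sum F p2)"
        using norm_triangle_ineq by metis
      also have "\<dots> < e"
      proof -
        have "e2 * (b - a) \<le> e / 4" using \<open>a \<le> b\<close> \<open>e > 0\<close> by (simp add: e2_def field_simps)
        then show ?thesis using 1 2 \<open>e > 0\<close> by linarith
      qed
      finally show "norm ((\<Sum>(x, k)\<in>p. measure lborel k *\<^sub>R g x) - (f b - f a)) < e" .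
    qed
  qed
  moreover have "negligible N" using N(1) negligible_iff_null_sets by blast
  ultimately show ?thesis
    by (rule has_integral_spike[rotated 2]) (auto simp: g_def)
qed

abbreviation Dv :: "(real \<Rightarrow> 'a::real_normed_vector) \<Rightarrow> real \<Rightarrow> 'a" where
  "Dv f x \<equiv> vector_derivative f (at x)"

section \<open>Locally square integrable functions\<close>

lemma borel_measurable_bilinear:
  fixes f :: "'c \<Rightarrow> 'a::euclidean_space" and g :: "'c \<Rightarrow> 'b::euclidean_space"
    and prod :: "'a \<Rightarrow> 'b \<Rightarrow> 'd::euclidean_space"
  assumes "bounded_bilinear prod" "f \<in> borel_measurable M" "g \<in> borel_measurable M"
  shows "(\<lambda>x. prod (f x) (g x)) \<in> borel_measurable M"
  using assms(2,3)
  by (rule borel_measurable_continuous_Pair)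
     (intro bounded_bilinear.continuous_on[OF assms(1)] continuous_intros)

lemma set_borel_measurable_lebesgue_interval:
  fixes f :: "real \<Rightarrow> 'a::euclidean_space"
  shows "f \<in> borel_measurable lebesgue \<Longrightarrow> set_borel_measurable lebesgue {a..b} f"
  unfolding set_borel_measurable_def by (intro borel_measurable_scaleR borel_measurable_indicator) auto

lemma locally_square_integrable_prod_integrable:
  fixes f :: "real \<Rightarrow> 'a::euclidean_space" and g :: "real \<Rightarrow> 'b::euclidean_space"
    and prod :: "'a \<Rightarrow> 'b \<Rightarrow> 'c::euclidean_space"
  assumes bil: "bounded_bilinear prod"
    and f: "locally_square_integrable f" and g: "locally_square_integrable g"
  shows "set_integrable lebesgue {a..b} (\<lambda>x. prod (f x) (g x))"
proof -
  obtain K where K: "K \<ge> 0" "\<And>x y. norm (prod x y) \<le> norm x * norm y * K"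
    using bounded_bilinear.nonneg_bounded[OF bil] by blast
  have [measurable]: "f \<in> borel_measurable lebesgue" "g \<in> borel_measurable lebesgue"
    using f g by (auto simp: locally_square_integrable_def)
  have [measurable]: "(\<lambda>x. prod (f x) (g x)) \<in> borel_measurable lebesgue"
    by (rule borel_measurable_bilinear[OF bil]) measurable
  have "set_integrable lebesgue {a..b} (\<lambda>x. ((norm (f x))\<^sup>2 + (norm (g x))\<^sup>2) * K)"
    using f g by (intro set_integrable_mult_left set_integral_add) (auto simp: locally_square_integrable_def)
  then show ?thesis
  proof (rule set_integrable_bound)
    show "set_borel_measurable lebesgue {a..b} (\<lambda>x. prod (f x) (g x))"
      by (rule set_borel_measurable_lebesgue_interval) measurable
    show "AE x in lebesgue. x \<in> {a..b} \<longrightarrow>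
        norm (prod (f x) (g x)) \<le> norm (((norm (f x))\<^sup>2 + (norm (g x))\<^sup>2) * K)"
    proof (intro AE_I2 impI)
      fix x
      have "norm (f x) * norm (g x) \<le> (norm (f x))\<^sup>2 + (norm (g x))\<^sup>2"
        using sum_squares_bound[of "norm (f x)" "norm (g x)"] mult_nonneg_nonneg[OF norm_ge_zero norm_ge_zero, of "f x" "g x"]
        by linarith
      then have "norm (f x) * norm (g x) * K \<le> ((norm (f x))\<^sup>2 + (norm (g x))\<^sup>2) * K"
        using K(1) by (rule mult_right_mono)
      then show "norm (prod (f x) (g x)) \<le> norm (((norm (f x))\<^sup>2 + (norm (g x))\<^sup>2) * K)"
        using K(2)[of "f x" "g x"] K(1) by simp
    qed
  qed
qed

lemma locally_square_integrable_bound: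
  fixes f :: "real \<Rightarrow> 'a::euclidean_space" and g :: "real \<Rightarrow> 'b::euclidean_space"
  assumes f: "locally_square_integrable f" and [measurable]: "g \<in> borel_measurable lebesgue"
    and bd: "\<And>a b. \<exists>C. \<forall>x\<in>{a..b}. norm (g x) \<le> C * norm (f x)"
  shows "locally_square_integrable g"
  unfolding locally_square_integrable_def
proof (intro conjI allI assms)
  fix a b :: real
  obtain C where C: "\<And>x. x \<in> {a..b} \<Longrightarrow> norm (g x) \<le> C * norm (f x)" using bd by meson
  have "set_integrable lebesgue {a..b} (\<lambda>x. C\<^sup>2 * (norm (f x))\<^sup>2)"
    using f by (auto simp: locally_square_integrable_def)
  then show "set_integrable lebesgue {a..b} (\<lambda>x. (norm (g x))\<^sup>2)"
  proof (rule set_integrable_bound)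
    show "set_borel_measurable lebesgue {a..b} (\<lambda>x. (norm (g x))\<^sup>2)"
      by (rule set_borel_measurable_lebesgue_interval) measurable
    show "AE x in lebesgue. x \<in> {a..b} \<longrightarrow> norm ((norm (g x))\<^sup>2) \<le> norm (C\<^sup>2 * (norm (f x))\<^sup>2)"
      using C by (auto intro!: AE_I2 simp: power_mult_distrib[symmetric] abs_mult power_mono)
  qed
qed

lemma locally_square_integrable_locally_bounded:
  fixes g :: "real \<Rightarrow> 'b::euclidean_space"
  assumes "g \<in> borel_measurable lebesgue" "\<And>a b. \<exists>C. \<forall>x\<in>{a..b}. norm (g x) \<le> C"
  shows "locally_square_integrable g"
proof (rule locally_square_integrable_bound)
  show "locally_square_integrable (\<lambda>x::real. 1::real)"
    by (auto simp: locally_square_integrable_def set_integrable_def intro!: integrable_real_indicator simp: emeasure_lborel_Icc_eq)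
qed (use assms in auto)

lemma locally_square_integrable_continuous:
  fixes g :: "real \<Rightarrow> 'b::euclidean_space"
  assumes "continuous_on UNIV g"
  shows "locally_square_integrable g"
proof (rule locally_square_integrable_locally_bounded)
  show "g \<in> borel_measurable lebesgue"
    using borel_measurable_continuous_onI[OF assms] by (simp add: measurable_completion)
  fix a b :: real
  have "compact (g ` {a..b})"
    using assms by (intro compact_continuous_image) (auto intro: continuous_on_subset)
  then show "\<exists>C. \<forall>x\<in>{a..b}. norm (g x) \<le> C"
    using compact_imp_bounded bounded_iff by (metis imageI)
qed

lemma locally_square_integrable_prod:
  fixes f :: "real \<Rightarrow> 'a::euclidean_space" and g :: "real \<Rightarrow> 'b::euclidean_space"
    and prod :: "'a \<Rightarrow> 'b \<Rightarrow> 'c::euclidean_space"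
  assumes bil: "bounded_bilinear prod"
    and f: "continuous_on UNIV f" and g: "locally_square_integrable g"
  shows "locally_square_integrable (\<lambda>x. prod (f x) (g x))"
  using g
proof (rule locally_square_integrable_bound)
  show "(\<lambda>x. prod (f x) (g x)) \<in> borel_measurable lebesgue"
    using g locally_square_integrable_continuous[OF f]
    by (intro borel_measurable_bilinear[OF bil]) (auto simp: locally_square_integrable_def)
  fix a b :: real
  obtain K where K: "K \<ge> 0" "\<And>x y. norm (prod x y) \<le> norm x * norm y * K"
    using bounded_bilinear.nonneg_bounded[OF bil] by blast
  have "compact (f ` {a..b})"
    using f by (intro compact_continuous_image) (auto intro: continuous_on_subset)
  then obtain C where C: "\<And>x. x \<in> {a..b} \<Longrightarrow> norm (f x) \<le> C"
    using compact_imp_bounded bounded_iff by (metis imageI)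
  have "norm (prod (f x) (g x)) \<le> (C * K) * norm (g x)" if "x \<in> {a..b}" for x
  proof -
    have "norm (f x) * (norm (g x) * K) \<le> C * (norm (g x) * K)"
      using C[OF that] K(1) by (intro mult_right_mono) auto
    then show ?thesis using K(2)[of "f x" "g x"] by (simp add: algebra_simps)
  qed
  then show "\<exists>C. \<forall>x\<in>{a..b}. norm (prod (f x) (g x)) \<le> C * norm (g x)" by blast
qed

lemma locally_square_integrable_add:
  fixes f g :: "real \<Rightarrow> 'a::euclidean_space"
  assumes f: "locally_square_integrable f" and g: "locally_square_integrable g"
  shows "locally_square_integrable (\<lambda>x. f x + g x)"
  unfolding locally_square_integrable_def
proof (intro conjI allI)
  have [measurable]: "f \<in> borel_measurable lebesgue" "g \<in> borel_measurable lebesgue"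
    using f g by (auto simp: locally_square_integrable_def)
  show "(\<lambda>x. f x + g x) \<in> borel_measurable lebesgue" by measurable
  fix a b :: real
  have "set_integrable lebesgue {a..b} (\<lambda>x. 2 * ((norm (f x))\<^sup>2 + (norm (g x))\<^sup>2))"
    using f g by (intro set_integrable_mult_right set_integral_add) (auto simp: locally_square_integrable_def)
  then show "set_integrable lebesgue {a..b} (\<lambda>x. (norm (f x + g x))\<^sup>2)"
  proof (rule set_integrable_bound)
    show "set_borel_measurable lebesgue {a..b} (\<lambda>x. (norm (f x + g x))\<^sup>2)"
      by (rule set_borel_measurable_lebesgue_interval) measurable
    have "(norm (f x + g x))\<^sup>2 \<le> 2 * ((norm (f x))\<^sup>2 + (norm (g x))\<^sup>2)" for x
    proof -
      have "(norm (f x + g x))\<^sup>2 \<le> (norm (f x) + norm (g x))\<^sup>2"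
        by (intro power_mono norm_triangle_ineq) auto
      also have "\<dots> \<le> 2 * ((norm (f x))\<^sup>2 + (norm (g x))\<^sup>2)"
        using sum_squares_bound[of "norm (f x)" "norm (g x)"] by (simp add: power2_sum)
      finally show ?thesis .
    qed
    then show "AE x in lebesgue. x \<in> {a..b} \<longrightarrow>
        norm ((norm (f x + g x))\<^sup>2) \<le> norm (2 * ((norm (f x))\<^sup>2 + (norm (g x))\<^sup>2))"
      by auto
  qed
qed

lemma locally_square_integrable_cong_AE:
  fixes f g :: "real \<Rightarrow> 'a::euclidean_space"
  assumes f: "locally_square_integrable f" and eq: "AE x in lebesgue. f x = g x"
  shows "locally_square_integrable g"
  unfolding locally_square_integrable_def
proof (intro conjI allI)
  have [measurable]: "f \<in> borel_measurable lebesgue"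
    using f by (auto simp: locally_square_integrable_def)
  show [measurable]: "g \<in> borel_measurable lebesgue"
    using borel_measurable_lebesgue_cong_AE[OF _ eq] by simp
  fix a b :: real
  have "set_integrable lebesgue {a..b} (\<lambda>x. (norm (f x))\<^sup>2)"
    using f by (auto simp: locally_square_integrable_def)
  then show "set_integrable lebesgue {a..b} (\<lambda>x. (norm (g x))\<^sup>2)"
    by (rule set_integrable_bound) (use eq in \<open>auto intro!: set_borel_measurable_lebesgue_interval\<close>)
qed

section \<open>Absolute continuity on compact intervals\<close>

lemma absolutely_continuous_fun_on_uniform:
  assumes "absolutely_continuous_fun_on {a..b} f" "\<epsilon> > 0"
  obtains \<delta> where "\<delta> > 0"
    "\<And>x y. a \<le> x \<Longrightarrow> x \<le> y \<Longrightarrow> y \<le> b \<Longrightarrow> y - x < \<delta> \<Longrightarrow> norm (f y - f x) < \<epsilon>"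
proof -
  obtain \<delta> where "\<delta> > 0" and \<delta>: "\<And>D T. D division_of T \<Longrightarrow> T \<subseteq> {a..b} \<Longrightarrow>
      (\<Sum>K\<in>D. measure lborel K) < \<delta> \<Longrightarrow> (\<Sum>K\<in>D. norm (f (Sup K) - f (Inf K))) < \<epsilon>"
    using assms unfolding absolutely_continuous_fun_on_def by meson
  have "norm (f y - f x) < \<epsilon>" if "a \<le> x" "x \<le> y" "y \<le> b" "y - x < \<delta>" for x y
  proof -
    have "{cbox x y} division_of cbox x y" using that by (intro division_of_self) auto
    from \<delta>[OF this] that show ?thesis by simp
  qed
  with \<open>\<delta> > 0\<close> show ?thesis using that by blast
qed

lemma absolutely_continuous_fun_on_continuous:
  assumes "absolutely_continuous_fun_on {a..b} f"
  shows "continuous_on {a..b} f"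
  unfolding continuous_on_iff
proof (intro ballI allI impI)
  fix x \<epsilon> :: real assume "x \<in> {a..b}" "\<epsilon> > 0"
  obtain \<delta> where \<delta>: "\<delta> > 0"
      "\<And>x y. a \<le> x \<Longrightarrow> x \<le> y \<Longrightarrow> y \<le> b \<Longrightarrow> y - x < \<delta> \<Longrightarrow> norm (f y - f x) < \<epsilon>"
    using absolutely_continuous_fun_on_uniform[OF assms \<open>\<epsilon> > 0\<close>] by blast
  have "dist (f x') (f x) < \<epsilon>" if "x' \<in> {a..b}" "dist x' x < \<delta>" for x'
    using \<delta>(2)[of x x'] \<delta>(2)[of x' x] that \<open>x \<in> {a..b}\<close>
    by (cases "x \<le> x'") (auto simp: dist_norm norm_minus_commute)
  then show "\<exists>d>0. \<forall>x'\<in>{a..b}. dist x' x < d \<longrightarrow> dist (f x') (f x) < \<epsilon>"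
    using \<delta>(1) by blast
qed

text \<open>One criterion for two uses: with constant \<open>f\<close> and \<open>g\<close> it
  covers Lipschitz functions through the term \<open>y - x\<close>, and with \<open>f\<close> and
  \<open>g\<close> as factors it covers bounded bilinear products.\<close>

lemma absolutely_continuous_fun_on_dominated:
  assumes f: "absolutely_continuous_fun_on {a..b} f" and g: "absolutely_continuous_fun_on {a..b} g"
    and le: "\<And>x y. a \<le> x \<Longrightarrow> x \<le> y \<Longrightarrow> y \<le> b \<Longrightarrow>
      norm (h y - h x) \<le> C * (norm (f y - f x) + norm (g y - g x) + (y - x))"
  shows "absolutely_continuous_fun_on {a..b} h"
  unfolding absolutely_continuous_fun_on_def
proof (intro allI impI)
  fix \<epsilon> :: real assume "\<epsilon> > 0"
  define \<eta> where "\<eta> = \<epsilon> / (3 * (\<bar>C\<bar> + 1))"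
  have \<eta>: "\<eta> > 0" using \<open>\<epsilon> > 0\<close> by (auto simp: \<eta>_def intro!: divide_pos_pos)
  obtain \<delta>1 where "\<delta>1 > 0" and \<delta>1: "\<And>D T. D division_of T \<Longrightarrow> T \<subseteq> {a..b} \<Longrightarrow>
      (\<Sum>K\<in>D. measure lborel K) < \<delta>1 \<Longrightarrow> (\<Sum>K\<in>D. norm (f (Sup K) - f (Inf K))) < \<eta>"
    using f \<eta> unfolding absolutely_continuous_fun_on_def by meson
  obtain \<delta>2 where "\<delta>2 > 0" and \<delta>2: "\<And>D T. D division_of T \<Longrightarrow> T \<subseteq> {a..b} \<Longrightarrow>
      (\<Sum>K\<in>D. measure lborel K) < \<delta>2 \<Longrightarrow> (\<Sum>K\<in>D. norm (g (Sup K) - g (Inf K))) < \<eta>"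
    using g \<eta> unfolding absolutely_continuous_fun_on_def by meson
  have "(\<Sum>K\<in>D. norm (h (Sup K) - h (Inf K))) < \<epsilon>"
    if D: "D division_of T" "T \<subseteq> {a..b}" "(\<Sum>K\<in>D. measure lborel K) < min \<eta> (min \<delta>1 \<delta>2)" for D T
  proof -
    have "norm (h (Sup K) - h (Inf K)) \<le> (\<bar>C\<bar> + 1) * (norm (f (Sup K) - f (Inf K))
        + norm (g (Sup K) - g (Inf K)) + measure lborel K)" if KD: "K \<in> D" for K
    proof -
      obtain u v where K: "K = cbox u v" "K \<noteq> {}" "K \<subseteq> {a..b}"
        using division_ofD(2,3,4)[OF D(1) KD] D(2) by blast
      then have uv: "a \<le> u" "u \<le> v" "v \<le> b" by auto
      have "norm (h v - h u) \<le> C * (norm (f v - f u) + norm (g v - g u) + (v - u))"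
        using uv by (rule le)
      also have "\<dots> \<le> (\<bar>C\<bar> + 1) * (norm (f v - f u) + norm (g v - g u) + (v - u))"
        using uv by (intro mult_right_mono) auto
      finally show ?thesis using uv by (simp add: K)
    qed
    then have "(\<Sum>K\<in>D. norm (h (Sup K) - h (Inf K))) \<le> (\<Sum>K\<in>D. (\<bar>C\<bar> + 1) *
        (norm (f (Sup K) - f (Inf K)) + norm (g (Sup K) - g (Inf K)) + measure lborel K))"
      by (rule sum_mono)
    also have "\<dots> = (\<bar>C\<bar> + 1) * ((\<Sum>K\<in>D. norm (f (Sup K) - f (Inf K)))
        + (\<Sum>K\<in>D. norm (g (Sup K) - g (Inf K))) + (\<Sum>K\<in>D. measure lborel K))"
      by (simp only: sum_distrib_left[symmetric] sum.distrib)
    also have "\<dots> < (\<bar>C\<bar> + 1) * (\<eta> + \<eta> + \<eta>)"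
      using \<delta>1[OF D(1,2)] \<delta>2[OF D(1,2)] D(3) by (intro mult_strict_left_mono add_strict_mono) auto
    also have "\<dots> = \<epsilon>"
    proof -
      have "3 * (\<bar>C\<bar> + 1) > 0" using abs_ge_zero[of C] by (simp add: add_nonneg_pos)
      then have "\<eta> * (3 * (\<bar>C\<bar> + 1)) = \<epsilon>" unfolding \<eta>_def by simp
      then show ?thesis by (simp add: algebra_simps)
    qed
    finally show ?thesis .
  qed
  then show "\<exists>\<delta>>0. \<forall>D T. D division_of T \<and> T \<subseteq> {a..b} \<and> (\<Sum>K\<in>D. measure lborel K) < \<delta> \<longrightarrow>
        (\<Sum>K\<in>D. norm (h (Sup K) - h (Inf K))) < \<epsilon>"
    using \<open>\<delta>1 > 0\<close> \<open>\<delta>2 > 0\<close> \<eta> by (intro exI[of _ "min \<eta> (min \<delta>1 \<delta>2)"]) auto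
qed

lemma absolutely_continuous_fun_on_const: "absolutely_continuous_fun_on S (\<lambda>x. c)"
  unfolding absolutely_continuous_fun_on_def by (auto intro: exI[of _ 1])

section \<open>Calculus in \<open>H1_loc\<close>\<close>

lemma H1_loc_I:
  fixes f :: "real \<Rightarrow> 'a::euclidean_space"
  assumes lip: "\<And>a b. \<exists>L. L-lipschitz_on {a..b} f"
    and der: "AE x in lebesgue. (f has_vector_derivative g x) (at x)"
    and g: "g \<in> borel_measurable lebesgue" "\<And>a b. \<exists>C. \<forall>x\<in>{a..b}. norm (g x) \<le> C"
  shows "f \<in> H1_loc"
  unfolding H1_loc_def
proof (intro CollectI conjI allI)
  fix a b :: real
  obtain L where L: "L-lipschitz_on {a..b} f" using lip by blast
  have "norm (f y - f x) \<le> L * (y - x)" if "a \<le> x" "x \<le> y" "y \<le> b" for x y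
    using lipschitz_onD[OF L, of y x] that by (simp add: dist_norm)
  then show "absolutely_continuous_fun_on {a..b} f"
    by (intro absolutely_continuous_fun_on_dominated[where C=L, OF absolutely_continuous_fun_on_const[of _ "0::real"]
          absolutely_continuous_fun_on_const[of _ "0::real"]]) simp
next
  show "AE x in lebesgue. f differentiable (at x)"
    using der by eventually_elim (rule differentiableI_vector)
next
  have "AE x in lebesgue. g x = Dv f x"
    using der by eventually_elim (simp add: vector_derivative_at)
  then show "locally_square_integrable (Dv f)"
    using locally_square_integrable_locally_bounded[OF g] by (rule locally_square_integrable_cong_AE[rotated])
qed

context
  fixes f :: "real \<Rightarrow> 'a::euclidean_space"
  assumes f: "f \<in> H1_loc"
begin

lemma H1_loc_continuous: "continuous_on UNIV f"
proof (rule continuous_at_imp_continuous_on, rule ballI)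
  fix x :: real
  have "continuous_on {x-1..x+1} f"
    using f by (intro absolutely_continuous_fun_on_continuous) (auto simp: H1_loc_def)
  then have "continuous_on {x-1<..<x+1} f"
    by (rule continuous_on_subset) auto
  then show "isCont f x"
    by (rule continuous_on_interior) auto
qed

lemma H1_loc_has_vector_derivative: "AE x in lebesgue. (f has_vector_derivative Dv f x) (at x)"
  using f by (auto simp: H1_loc_def vector_derivative_works[symmetric])

lemma H1_loc_square_integrable: "locally_square_integrable f"
  by (rule locally_square_integrable_continuous[OF H1_loc_continuous])

lemma H1_loc_derivative_square_integrable: "locally_square_integrable (Dv f)"
  using f by (simp add: H1_loc_def)

lemma H1_loc_derivative_integrable: "set_integrable lebesgue {a..b} (Dv f)"
  using locally_square_integrable_prod_integrable[OF bounded_bilinear_scaleR,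
      of "\<lambda>_. 1" "Dv f"] H1_loc_derivative_square_integrable
    locally_square_integrable_continuous[of "\<lambda>_. 1::real"]
  by simp

lemma H1_loc_integral_derivative:
  "a \<le> b \<Longrightarrow> (LINT x:{a..b}|lebesgue. Dv f x) = f b - f a"
  using fundamental_theorem_of_calculus_absolutely_continuous[of a b f] f
    set_lebesgue_integral_eq_integral(2)[OF H1_loc_derivative_integrable]
  by (auto simp: H1_loc_def dest: integral_unique)

end

text \<open>Absolute continuity follows from splitting the increment of the product and bounding
  both factors on the compact interval. The general bilinear form serves complex products, cutoffs
  by \<open>scaleR\<close> and the real inner product on the complex plane alike.\<close>

lemma H1_loc_bilinear:
  fixes f :: "real \<Rightarrow> 'a::euclidean_space" and g :: "real \<Rightarrow> 'b::euclidean_space"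
    and prod :: "'a \<Rightarrow> 'b \<Rightarrow> 'c::euclidean_space"
  assumes bil: "bounded_bilinear prod" and f: "f \<in> H1_loc" and g: "g \<in> H1_loc"
  shows "(\<lambda>x. prod (f x) (g x)) \<in> H1_loc"
    and "AE x in lebesgue. Dv (\<lambda>x. prod (f x) (g x)) x = prod (f x) (Dv g x) + prod (Dv f x) (g x)"
proof -
  interpret bounded_bilinear prod by (rule bil)
  have der: "AE x in lebesgue. ((\<lambda>x. prod (f x) (g x)) has_vector_derivative
      prod (f x) (Dv g x) + prod (Dv f x) (g x)) (at x)"
    using H1_loc_has_vector_derivative[OF f] H1_loc_has_vector_derivative[OF g]
    by eventually_elim (rule has_vector_derivative)
  then show eq: "AE x in lebesgue. Dv (\<lambda>x. prod (f x) (g x)) x = prod (f x) (Dv g x) + prod (Dv f x) (g x)"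
    by eventually_elim (rule vector_derivative_at)
  show "(\<lambda>x. prod (f x) (g x)) \<in> H1_loc"
    unfolding H1_loc_def
  proof (intro CollectI conjI allI)
    show "AE x in lebesgue. (\<lambda>x. prod (f x) (g x)) differentiable (at x)"
      using der by eventually_elim (rule differentiableI_vector)
    have "locally_square_integrable (\<lambda>x. prod (f x) (Dv g x) + prod (Dv f x) (g x))"
    proof (rule locally_square_integrable_add)
      show "locally_square_integrable (\<lambda>x. prod (f x) (Dv g x))"
        using locally_square_integrable_prod[OF bil] H1_loc_continuous[OF f] H1_loc_derivative_square_integrable[OF g]
        by blast
      show "locally_square_integrable (\<lambda>x. prod (Dv f x) (g x))"
        using locally_square_integrable_prod[OF flip] H1_loc_continuous[OF g] H1_loc_derivative_square_integrable[OF f]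
        by blast
    qed
    then show "locally_square_integrable (Dv (\<lambda>x. prod (f x) (g x)))"
      by (rule locally_square_integrable_cong_AE) (use eq in \<open>auto elim: eventually_mono\<close>)
    fix a b :: real
    have "compact (f ` {a..b})" "compact (g ` {a..b})"
      using H1_loc_continuous[OF f] H1_loc_continuous[OF g]
      by (auto intro!: compact_continuous_image intro: continuous_on_subset)
    then obtain A B where A: "\<And>x. x \<in> {a..b} \<Longrightarrow> norm (f x) \<le> A" and B: "\<And>x. x \<in> {a..b} \<Longrightarrow> norm (g x) \<le> B"
      using compact_imp_bounded bounded_iff by (metis imageI)
    obtain K where K: "K \<ge> 0" "\<And>x y. norm (prod x y) \<le> norm x * norm y * K"
      using nonneg_bounded by blast
    show "absolutely_continuous_fun_on {a..b} (\<lambda>x. prod (f x) (g x))"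
    proof (rule absolutely_continuous_fun_on_dominated[of a b f g _ "(\<bar>A\<bar> + \<bar>B\<bar>) * K"])
      fix x y assume xy: "a \<le> x" "x \<le> y" "y \<le> b"
      let ?F = "norm (f y - f x)" and ?G = "norm (g y - g x)"
      have "norm (prod (f y) (g y) - prod (f x) (g x)) = norm (prod (f y - f x) (g y) + prod (f x) (g y - g x))"
        by (simp add: diff_left diff_right)
      also have "\<dots> \<le> ?F * norm (g y) * K + norm (f x) * ?G * K"
        by (intro norm_triangle_le add_mono K)
      also have "\<dots> \<le> ?F * \<bar>B\<bar> * K + \<bar>A\<bar> * ?G * K"
        using A[of x] B[of y] xy K(1) by (intro add_mono mult_mono) auto
      also have "\<dots> \<le> (\<bar>A\<bar> + \<bar>B\<bar>) * K * (?F + ?G + (y - x))"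
      proof -
        have "0 \<le> ?F * \<bar>A\<bar> * K + \<bar>B\<bar> * ?G * K + (\<bar>A\<bar> + \<bar>B\<bar>) * K * (y - x)"
          using xy K(1) by (intro add_nonneg_nonneg mult_nonneg_nonneg) auto
        then show ?thesis by (simp add: algebra_simps)
      qed
      finally show "norm (prod (f y) (g y) - prod (f x) (g x)) \<le> (\<bar>A\<bar> + \<bar>B\<bar>) * K * (?F + ?G + (y - x))" .
    qed (use f g in \<open>auto simp: H1_loc_def\<close>)
  qed
qed

lemma H1_loc_C1:
  fixes f :: "real \<Rightarrow> 'a::euclidean_space"
  assumes der: "\<And>x. (f has_vector_derivative g x) (at x)" and g: "continuous_on UNIV g"
  shows "f \<in> H1_loc"
proof (rule H1_loc_I)
  have bd: "\<exists>C. \<forall>x\<in>{a..b}. norm (g x) \<le> C" for a b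
  proof -
    have "compact (g ` {a..b})"
      using g by (intro compact_continuous_image) (auto intro: continuous_on_subset)
    then show ?thesis using compact_imp_bounded bounded_iff by (metis imageI)
  qed
  then show "\<exists>C. \<forall>x\<in>{a..b}. norm (g x) \<le> C" for a b .
  show "g \<in> borel_measurable lebesgue"
    using borel_measurable_continuous_onI[OF g] by (simp add: measurable_completion)
  fix a b :: real
  obtain C where C: "\<forall>x\<in>{a..b}. norm (g x) \<le> C" using bd by blast
  have "\<bar>C\<bar>-lipschitz_on {a..b} f"
  proof (rule bounded_derivative_imp_lipschitz)
    show "(f has_derivative (\<lambda>h. h *\<^sub>R g x)) (at x within {a..b})" for x
      using der[of x] by (simp add: has_vector_derivative_def has_derivative_at_withinI)
    show "onorm (\<lambda>h. h *\<^sub>R g x) \<le> \<bar>C\<bar>" if "x \<in> {a..b}" for x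
      using C that by (auto simp: onorm_scaleR_left onorm_id intro: order_trans[OF _ abs_ge_self])
  qed auto
  then show "\<exists>L. L-lipschitz_on {a..b} f" by blast
qed (use der in auto)

lemma H1_loc_const: "(\<lambda>x. c :: 'a::euclidean_space) \<in> H1_loc"
  by (rule H1_loc_C1[where g = "\<lambda>_. 0"]) auto

text \<open>Reduced to the bilinear case by pairing \<open>f\<close> with the constant 1 under (r,
  x) -> r T x. It is applied to complex conjugation and to the embedding of the reals.\<close>

lemma H1_loc_bounded_linear:
  fixes f :: "real \<Rightarrow> 'a::euclidean_space" and T :: "'a \<Rightarrow> 'b::euclidean_space"
  assumes T: "bounded_linear T" and f: "f \<in> H1_loc"
  shows "(\<lambda>x. T (f x)) \<in> H1_loc" and "AE x in lebesgue. Dv (\<lambda>x. T (f x)) x = T (Dv f x)"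
proof -
  have bil: "bounded_bilinear (\<lambda>(r::real) x. r *\<^sub>R T x)"
    using bounded_bilinear.comp[OF bounded_bilinear_scaleR bounded_linear_ident T] by simp
  show "(\<lambda>x. T (f x)) \<in> H1_loc"
    using H1_loc_bilinear(1)[OF bil H1_loc_const[of "1::real"] f] by simp
  show "AE x in lebesgue. Dv (\<lambda>x. T (f x)) x = T (Dv f x)"
    using H1_loc_bilinear(2)[OF bil H1_loc_const[of "1::real"] f] by simp
qed

section \<open>The weak formulation on an interval\<close>

text \<open>The climb from 0 to 1 takes place on [c - 1/n, c], so the limit for large
  \<open>n\<close> is the indicator of a ray closed at \<open>c\<close>, and the slope averages over
  points to the left of \<open>c\<close>. Both fit the left-continuity of the
  quasi-derivative.\<close>

definition ramp :: "real \<Rightarrow> real \<Rightarrow> real \<Rightarrow> real" where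
  "ramp n c x = max 0 (min 1 (n * (x - c) + 1))"

definition trapezoid :: "real \<Rightarrow> real \<Rightarrow> real \<Rightarrow> real \<Rightarrow> real" where
  "trapezoid n c d x = ramp n c x - ramp n d x"

definition trapezoid_deriv :: "real \<Rightarrow> real \<Rightarrow> real \<Rightarrow> real \<Rightarrow> real" where
  "trapezoid_deriv n c d x = n * indicator {c - 1 / n..c} x - n * indicator {d - 1 / n..d} x"

lemma ramp_has_vector_derivative:
  assumes n: "n > 0" and x: "x \<noteq> c - 1 / n" "x \<noteq> c"
  shows "(ramp n c has_vector_derivative n * indicator {c - 1 / n..c} x) (at x)"
proof -
  consider "x < c - 1 / n" | "c - 1 / n < x" "x < c" | "x > c" using x by linarith
  then show ?thesis
  proof cases
    case 1
    have "((\<lambda>x. 0) has_vector_derivative n * indicator {c - 1 / n..c} x) (at x)" using 1 by simp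
    then show ?thesis
      by (rule has_vector_derivative_transform_within_open[of _ _ _ "{..<c - 1 / n}"])
         (use 1 n in \<open>auto simp: ramp_def field_simps\<close>)
  next
    case 2
    have "((\<lambda>x. n * (x - c) + 1) has_vector_derivative n * indicator {c - 1 / n..c} x) (at x)"
      using 2 by (auto intro!: derivative_eq_intros simp: has_real_derivative_iff_has_vector_derivative[symmetric])
    then show ?thesis
      by (rule has_vector_derivative_transform_within_open[of _ _ _ "{c - 1 / n<..<c}"])
         (use 2 n in \<open>auto simp: ramp_def field_simps mult_nonneg_nonpos\<close>)
  next
    case 3
    have "((\<lambda>x. 1) has_vector_derivative n * indicator {c - 1 / n..c} x) (at x)" using 3 by simp
    then show ?thesis
      by (rule has_vector_derivative_transform_within_open[of _ _ _ "{c<..}"])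
         (use 3 n in \<open>auto simp: ramp_def\<close>)
  qed
qed

lemma ramp_lipschitz: "n > 0 \<Longrightarrow> \<bar>ramp n c x - ramp n c y\<bar> \<le> n * \<bar>x - y\<bar>"
proof -
  assume n: "n > 0"
  have "\<bar>ramp n c x - ramp n c y\<bar> \<le> \<bar>(n * (x - c) + 1) - (n * (y - c) + 1)\<bar>"
    unfolding ramp_def by (auto simp: max_def min_def)
  also have "\<dots> = n * \<bar>x - y\<bar>" 
  proof -
    have "(n * (x - c) + 1) - (n * (y - c) + 1) = n * (x - y)" by (simp add: algebra_simps)
    then show ?thesis using n by (simp add: abs_mult)
  qed
  finally show ?thesis .
qed

lemma trapezoid_has_vector_derivative:
  assumes "n > 0"
  shows "AE x in lebesgue. (trapezoid n c d has_vector_derivative trapezoid_deriv n c d x) (at x)"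
proof -
  have "AE x in lebesgue. x \<notin> {c - 1 / n, c, d - 1 / n, d}"
    by (rule AE_completion[OF AE_not_in]) (auto intro: finite_imp_null_set_lborel)
  then show ?thesis
  proof eventually_elim
    case (elim x)
    then show ?case
      unfolding trapezoid_def trapezoid_deriv_def
      by (intro has_vector_derivative_diff ramp_has_vector_derivative) (use assms in auto)
  qed
qed

lemma trapezoid_deriv_measurable: "trapezoid_deriv n c d \<in> borel_measurable lebesgue"
  unfolding trapezoid_deriv_def
  by (intro borel_measurable_diff borel_measurable_times borel_measurable_indicator) auto

lemma trapezoid_H1_loc:
  assumes n: "n > 0"
  shows "trapezoid n c d \<in> H1_loc"
proof (rule H1_loc_I)
  show "AE x in lebesgue. (trapezoid n c d has_vector_derivative trapezoid_deriv n c d x) (at x)"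
    by (rule trapezoid_has_vector_derivative[OF n])
  show "trapezoid_deriv n c d \<in> borel_measurable lebesgue" by (rule trapezoid_deriv_measurable)
  show "\<exists>C. \<forall>x\<in>{a..b}. norm (trapezoid_deriv n c d x) \<le> C" for a b
    using n by (intro exI[of _ n]) (auto simp: trapezoid_deriv_def indicator_def)
  have "(2 * n)-lipschitz_on {a..b} (trapezoid n c d)" for a b
  proof (rule lipschitz_onI)
    fix x y
    show "dist (trapezoid n c d x) (trapezoid n c d y) \<le> 2 * n * dist x y"
      using ramp_lipschitz[OF n, of c x y] ramp_lipschitz[OF n, of d x y]
      unfolding trapezoid_def dist_real_def by linarith
  qed (use n in auto)
  then show "\<exists>L. L-lipschitz_on {a..b} (trapezoid n c d)" for a b by blast
qed

lemma trapezoid_bounds: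
  assumes "n > 0" "c \<le> d"
  shows "0 \<le> trapezoid n c d x" "trapezoid n c d x \<le> 1"
proof -
  have "n * (x - d) \<le> n * (x - c)" using assms by (intro mult_left_mono) auto
  then show "0 \<le> trapezoid n c d x" "trapezoid n c d x \<le> 1"
    by (auto simp: trapezoid_def ramp_def)
qed

lemma trapezoid_support:
  assumes "n \<ge> 1" "c \<le> d" "x \<notin> {c - 1..d}"
  shows "trapezoid n c d x = 0" "trapezoid_deriv n c d x = 0"
proof -
  have n: "1 / n \<le> 1" using assms by simp
  show "trapezoid_deriv n c d x = 0"
  proof -
    have "x < c - 1 / n \<or> x > d" using assms(3) n by force
    then have "x \<notin> {c - 1 / n..c}" "x \<notin> {d - 1 / n..d}" using assms(2) by auto
    then show ?thesis by (simp add: trapezoid_deriv_def)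
  qed
  consider "x < c - 1" | "x > d" using assms by fastforce
  then show "trapezoid n c d x = 0"
  proof cases
    case 1
    then have "n * (x - c) \<le> n * (-1)" "n * (x - d) \<le> n * (-1)"
      using assms by (intro mult_left_mono; simp)+
    then show ?thesis using assms(1) by (simp add: trapezoid_def ramp_def)
  next
    case 2
    then show ?thesis using assms by (simp add: trapezoid_def ramp_def)
  qed
qed

lemma ramp_tendsto: "(\<lambda>k. ramp (real (Suc k)) c x) \<longlonglongrightarrow> indicator {c..} x"
proof (cases "x \<ge> c")
  case True
  then show ?thesis by (simp add: ramp_def min_def max_def)
next
  case False
  obtain N :: nat where N: "real N * (c - x) \<ge> 1"
    using False reals_Archimedean3[of "c - x"] by (metis diff_gt_0_iff_gt less_imp_le not_le)
  have "ramp (real (Suc k)) c x = 0" if "k \<ge> N" for k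
  proof -
    have "real N * (c - x) \<le> real (Suc k) * (c - x)" using that False by (intro mult_right_mono) auto
    then have "1 \<le> real (Suc k) * (c - x)" using N by linarith
    moreover have "real (Suc k) * (x - c) = - (real (Suc k) * (c - x))" by (simp add: algebra_simps)
    ultimately show ?thesis unfolding ramp_def by linarith
  qed
  then have "\<forall>\<^sub>F k in sequentially. ramp (real (Suc k)) c x = indicator {c..} x"
    using False by (auto simp: eventually_sequentially)
  then show ?thesis by (rule tendsto_eventually)
qed

text \<open>Convergence at every point, not just almost everywhere, is what permits its use with
  \<upsilon>, where an atom at \<open>c\<close> or \<open>d\<close> must be assigned to the correct
  side.\<close>

lemma trapezoid_tendsto:
  "c \<le> d \<Longrightarrow> (\<lambda>k. trapezoid (real (Suc k)) c d x) \<longlonglongrightarrow> indicator {c..<d} x"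
proof -
  assume "c \<le> d"
  then have "indicator {c..<d} x = (indicator {c..} x - indicator {d..} x :: real)"
    by (auto simp: indicator_def)
  then show ?thesis unfolding trapezoid_def by (simp only:) (intro tendsto_diff ramp_tendsto)
qed

section \<open>Limits of integrals against the cutoffs\<close>

lemma integrable_cutoff:
  fixes \<Phi> :: "real \<Rightarrow> 'a::euclidean_space" and w :: "real \<Rightarrow> real"
  assumes \<Phi>: "set_integrable M {p..q} \<Phi>" and w: "w \<in> borel_measurable M"
    and bd: "\<And>x. \<bar>w x\<bar> \<le> B" and supp: "\<And>x. x \<notin> {p..q} \<Longrightarrow> w x = 0"
  shows "integrable M (\<lambda>x. w x *\<^sub>R \<Phi> x)"
proof -
  have int: "integrable M (\<lambda>x. indicator {p..q} x *\<^sub>R \<Phi> x)"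
    using \<Phi> by (simp add: set_integrable_def)
  have eq: "w x *\<^sub>R \<Phi> x = w x *\<^sub>R (indicator {p..q} x *\<^sub>R \<Phi> x)" for x
    using supp[of x] by (cases "x \<in> {p..q}") auto
  have "integrable M (\<lambda>x. w x *\<^sub>R (indicator {p..q} x *\<^sub>R \<Phi> x))"
  proof (rule Bochner_Integration.integrable_bound[OF integrable_scaleR_right[of B, OF int]])
    show "(\<lambda>x. w x *\<^sub>R (indicator {p..q} x *\<^sub>R \<Phi> x)) \<in> borel_measurable M"
      using w borel_measurable_integrable[OF int] by (rule borel_measurable_scaleR)
    show "AE x in M. norm (w x *\<^sub>R (indicator {p..q} x *\<^sub>R \<Phi> x)) \<le> norm (B *\<^sub>R (indicator {p..q} x *\<^sub>R \<Phi> x))"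
    proof (rule AE_I2)
      fix x
      have "\<bar>w x\<bar> * norm (indicator {p..q} x *\<^sub>R \<Phi> x) \<le> \<bar>B\<bar> * norm (indicator {p..q} x *\<^sub>R \<Phi> x)"
        using bd[of x] by (intro mult_right_mono) auto
      then show "norm (w x *\<^sub>R (indicator {p..q} x *\<^sub>R \<Phi> x)) \<le> norm (B *\<^sub>R (indicator {p..q} x *\<^sub>R \<Phi> x))"
        by (simp only: norm_scaleR)
    qed
  qed
  then show ?thesis unfolding eq[symmetric] .
qed

text \<open>Dominated convergence with the norm of \<open>\<Phi>\<close> on {c - 1..d} as majorant:
  since n is at least 1, all cutoffs live there. The measure is left open because both Lebesgue
  measure and \<upsilon> are needed.\<close>

lemma integral_trapezoid_tendsto:
  fixes \<Phi> :: "real \<Rightarrow> 'a::euclidean_space"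
  assumes \<Phi>: "set_integrable M {c - 1..d} \<Phi>" and cd: "c \<le> d"
    and M: "{c..<d} \<in> sets M" "\<And>k. trapezoid (real (Suc k)) c d \<in> borel_measurable M"
  shows "(\<lambda>k. \<integral>x. trapezoid (real (Suc k)) c d x *\<^sub>R \<Phi> x \<partial>M) \<longlonglongrightarrow> (LINT x:{c..<d}|M. \<Phi> x)"
  unfolding set_lebesgue_integral_def
proof (rule integral_dominated_convergence)
  have int: "integrable M (\<lambda>x. indicator {c - 1..d} x *\<^sub>R \<Phi> x)"
    using \<Phi> by (simp add: set_integrable_def)
  then show "integrable M (\<lambda>x. norm (indicator {c - 1..d} x *\<^sub>R \<Phi> x))" by (rule integrable_norm)
  have "(\<lambda>x. indicator {c..<d} x *\<^sub>R (indicator {c - 1..d} x *\<^sub>R \<Phi> x)) \<in> borel_measurable M"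
    by (rule borel_measurable_scaleR[OF borel_measurable_indicator[OF M(1)] borel_measurable_integrable[OF int]])
  then show "(\<lambda>x. indicator {c..<d} x *\<^sub>R \<Phi> x) \<in> borel_measurable M"
    by (rule measurable_cong[THEN iffD1, rotated]) (auto simp: indicator_def)
  show "(\<lambda>x. trapezoid (real (Suc k)) c d x *\<^sub>R \<Phi> x) \<in> borel_measurable M" for k
    by (rule borel_measurable_integrable, rule integrable_cutoff[OF \<Phi> M(2), where B=1])
       (use trapezoid_bounds[OF _ cd, of "real (Suc k)"] trapezoid_support[OF _ cd, of "real (Suc k)"] in auto)
  show "AE x in M. (\<lambda>k. trapezoid (real (Suc k)) c d x *\<^sub>R \<Phi> x) \<longlonglongrightarrow> indicator {c..<d} x *\<^sub>R \<Phi> x"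
    using cd by (intro AE_I2 tendsto_scaleR trapezoid_tendsto tendsto_const)
  fix k
  have "\<bar>trapezoid (real (Suc k)) c d x\<bar> \<le> indicator {c - 1..d} x" for x
    using trapezoid_bounds[OF _ cd, of "real (Suc k)" x] trapezoid_support[OF _ cd, of "real (Suc k)" x]
    by (cases "x \<in> {c - 1..d}") auto
  then show "AE x in M. norm (trapezoid (real (Suc k)) c d x *\<^sub>R \<Phi> x) \<le> norm (indicator {c - 1..d} x *\<^sub>R \<Phi> x)"
    by (auto intro!: AE_I2 mult_right_mono)
qed

text \<open>This recovers a point value from data known only almost everywhere: the average sees
  \<open>F\<close> just to the left of \<open>c\<close>, where one-sided continuity keeps it close
  to \<open>F c\<close>.\<close>

lemma left_average_tendsto:
  fixes F \<Psi> :: "real \<Rightarrow> 'a::euclidean_space"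
  assumes \<Psi>: "\<And>a b. set_integrable lebesgue {a..b} \<Psi>" and eq: "AE x in lebesgue. F x = \<Psi> x"
    and cont: "continuous (at_left c) F"
  shows "(\<lambda>k. real (Suc k) *\<^sub>R (LINT x:{c - 1 / real (Suc k)..c}|lebesgue. \<Psi> x)) \<longlonglongrightarrow> F c"
proof (rule LIMSEQ_I)
  fix e :: real assume "e > 0"
  have "(F \<longlongrightarrow> F c) (at_left c)" using cont by (simp add: continuous_within)
  then have "\<forall>\<^sub>F x in at_left c. dist (F x) (F c) < e / 2" using \<open>e > 0\<close> by (intro tendstoD) auto
  then obtain b where b: "b < c" "\<And>x. b < x \<Longrightarrow> x < c \<Longrightarrow> dist (F x) (F c) < e / 2"
    unfolding eventually_at_left_field by blast
  obtain N :: nat where N: "1 / real (Suc N) < c - b"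
    using b(1) nat_approx_posE[of "c - b"] by auto
  have "norm (real (Suc k) *\<^sub>R (LINT x:{c - 1 / real (Suc k)..c}|lebesgue. \<Psi> x) - F c) < e" if "k \<ge> N" for k
  proof -
    define I where "I = {c - 1 / real (Suc k)..c}"
    have "1 / real (Suc k) \<le> 1 / real (Suc N)" using that by (simp add: frac_le)
    then have sub: "x \<in> I \<Longrightarrow> b < x" for x using N by (auto simp: I_def)
    have mI: "measure lebesgue I = 1 / real (Suc k)" by (simp add: I_def)
    have fin: "emeasure lebesgue I < \<infinity>" by (simp add: I_def emeasure_lborel_Icc_eq)
    have intc: "set_integrable lebesgue I (\<lambda>x. y)" for y :: 'a
      unfolding set_integrable_def using fin by (intro integrable_indicator) (auto simp: I_def)
    have intr: "set_integrable lebesgue I (\<lambda>x. w)" for w :: real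
      unfolding set_integrable_def using fin by (intro integrable_indicator) (auto simp: I_def)
    have intd: "set_integrable lebesgue I (\<lambda>x. \<Psi> x - F c)"
      using \<Psi> intc unfolding I_def by (intro set_integral_diff)
    have "norm (LINT x:I|lebesgue. \<Psi> x - F c) \<le> (LINT x:I|lebesgue. norm (\<Psi> x - F c))"
      using intd by (rule set_integral_norm_bound)
    also have "\<dots> \<le> (LINT x:I|lebesgue. e / 2)"
    proof (rule set_integral_mono_AE[OF set_integrable_norm[OF intd] intr])
      have "AE x in lebesgue. x \<notin> {c}"
        by (rule AE_completion[OF AE_not_in]) auto
      with eq show "AE x\<in>I in lebesgue. norm (\<Psi> x - F c) \<le> e / 2"
      proof eventually_elim
        case (elim x)
        then show ?case using b(2)[of x] sub[of x] by (auto simp: I_def dist_norm)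
      qed
    qed
    also have "\<dots> = e / 2 * (1 / real (Suc k))"
      using fin mI by (subst set_lebesgue_integral_def) (simp add: I_def)
    finally have 1: "norm (LINT x:I|lebesgue. \<Psi> x - F c) \<le> e / 2 * (1 / real (Suc k))" .
    have "(LINT x:I|lebesgue. \<Psi> x - F c) = (LINT x:I|lebesgue. \<Psi> x) - (LINT x:I|lebesgue. F c)"
      using \<Psi> intc unfolding I_def by (intro set_integral_diff)
    also have "(LINT x:I|lebesgue. F c) = (1 / real (Suc k)) *\<^sub>R F c"
      using fin mI by (subst set_lebesgue_integral_def) (simp add: I_def)
    finally have "real (Suc k) *\<^sub>R (LINT x:I|lebesgue. \<Psi> x) - F c = real (Suc k) *\<^sub>R (LINT x:I|lebesgue. \<Psi> x - F c)"
      by (simp add: scaleR_diff_right)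
    then have "norm (real (Suc k) *\<^sub>R (LINT x:I|lebesgue. \<Psi> x) - F c) \<le> real (Suc k) * (e / 2 * (1 / real (Suc k)))"
      using mult_left_mono[OF 1, of "real (Suc k)"] by (simp only: norm_scaleR abs_of_nat)
    also have "\<dots> = e / 2" by (simp del: of_nat_Suc)
    also have "\<dots> < e" using \<open>e > 0\<close> by simp
    finally show ?thesis by (simp add: I_def)
  qed
  then show "\<exists>no. \<forall>k\<ge>no. norm (real (Suc k) *\<^sub>R (LINT x:{c - 1 / real (Suc k)..c}|lebesgue. \<Psi> x) - F c) < e"
    by blast
qed

lemma locally_square_integrable_measurable:
  "locally_square_integrable f \<Longrightarrow> f \<in> borel_measurable lebesgue"
  by (simp add: locally_square_integrable_def)

lemma continuous_set_integrable_locally_finite: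
  fixes g :: "real \<Rightarrow> 'a::euclidean_space"
  assumes "sets M = sets borel" "\<And>K. compact K \<Longrightarrow> emeasure M K < \<infinity>" and g: "continuous_on UNIV g"
  shows "set_integrable M {a..b} g"
proof -
  have "compact (g ` {a..b})"
    using g by (intro compact_continuous_image) (auto intro: continuous_on_subset)
  then obtain B where B: "\<And>x. x \<in> {a..b} \<Longrightarrow> norm (g x) \<le> B"
    using compact_imp_bounded bounded_iff by (metis imageI)
  have "set_integrable M {a..b} (\<lambda>x. B)"
    unfolding set_integrable_def using assms(1) assms(2)[of "{a..b}"] by (intro integrable_indicator) auto
  then show ?thesis
  proof (rule set_integrable_bound)
    have "g \<in> borel_measurable M"
      using borel_measurable_continuous_onI[OF g] measurable_cong_sets[OF assms(1) refl] by blast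
    then show "set_borel_measurable M {a..b} g"
      unfolding set_borel_measurable_def using assms(1)
      by (intro borel_measurable_scaleR borel_measurable_indicator) auto
    show "AE x in M. x \<in> {a..b} \<longrightarrow> norm (g x) \<le> norm B"
      using B by (auto intro!: AE_I2 order_trans[OF B])
  qed
qed

lemma set_integral_Ico_Icc:
  fixes g :: "real \<Rightarrow> 'a::euclidean_space"
  assumes "set_integrable lebesgue {a..b} g"
  shows "(LINT x:{a..<b}|lebesgue. g x) = (LINT x:{a..b}|lebesgue. g x)"
proof (rule set_integral_cong_set)
  show "set_borel_measurable lebesgue {a..b} g"
    using assms by (simp add: set_integrable_def set_borel_measurable_def)
  have "set_integrable lebesgue {a..<b} g"
    using assms by (rule set_integrable_subset) auto
  then show "set_borel_measurable lebesgue {a..<b} g"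
    by (simp add: set_integrable_def set_borel_measurable_def)
  have "AE x in lebesgue. x \<notin> {b}" by (rule AE_completion[OF AE_not_in]) auto
  then show "AE x in lebesgue. (x \<in> {a..b}) = (x \<in> {a..<b})"
    by eventually_elim auto
qed

lemmas H1_loc_mult = H1_loc_bilinear[OF bounded_bilinear_mult]
lemmas H1_loc_scaleR = H1_loc_bilinear[OF bounded_bilinear_scaleR]
lemmas lsi_mult = locally_square_integrable_prod_integrable[OF bounded_bilinear_mult]
lemmas lsi_scaleR = locally_square_integrable_prod_integrable[OF bounded_bilinear_scaleR]

lemma trapezoid_scaleR_H1_c:
  fixes h :: "real \<Rightarrow> complex"
  assumes n: "n \<ge> 1" and cd: "c \<le> d" and h: "h \<in> H1_loc"
  shows "(\<lambda>x. trapezoid n c d x *\<^sub>R h x) \<in> H1_c"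
    and "AE x in lebesgue. Dv (\<lambda>x. trapezoid n c d x *\<^sub>R h x) x =
      trapezoid n c d x *\<^sub>R Dv h x + trapezoid_deriv n c d x *\<^sub>R h x"
proof -
  have n': "n > 0" using n by simp
  have "{x. trapezoid n c d x *\<^sub>R h x \<noteq> 0} \<subseteq> {c - 1..d}"
  proof
    fix x assume "x \<in> {x. trapezoid n c d x *\<^sub>R h x \<noteq> 0}"
    then have "trapezoid n c d x \<noteq> 0" by auto
    then show "x \<in> {c - 1..d}" using trapezoid_support(1)[OF n cd, of x] by blast
  qed
  then have "bounded {x. trapezoid n c d x *\<^sub>R h x \<noteq> 0}"
    by (rule bounded_subset[rotated]) simp
  then show "(\<lambda>x. trapezoid n c d x *\<^sub>R h x) \<in> H1_c"
    unfolding H1_c_def using H1_loc_scaleR(1)[OF trapezoid_H1_loc[OF n'] h] by simp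
  show "AE x in lebesgue. Dv (\<lambda>x. trapezoid n c d x *\<^sub>R h x) x =
      trapezoid n c d x *\<^sub>R Dv h x + trapezoid_deriv n c d x *\<^sub>R h x"
    using H1_loc_scaleR(2)[OF trapezoid_H1_loc[OF n', of c d] h] trapezoid_has_vector_derivative[OF n', of c d]
    by eventually_elim (simp add: vector_derivative_at)
qed

lemma integral_trapezoid_deriv:
  fixes \<Psi> :: "real \<Rightarrow> complex"
  assumes n: "n > 0" and \<Psi>: "\<And>a b. set_integrable lebesgue {a..b} \<Psi>"
  shows "(\<integral>x. trapezoid_deriv n c d x *\<^sub>R \<Psi> x \<partial>lebesgue) =
    n *\<^sub>R (LINT x:{c - 1 / n..c}|lebesgue. \<Psi> x) - n *\<^sub>R (LINT x:{d - 1 / n..d}|lebesgue. \<Psi> x)"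
proof -
  have "(\<integral>x. trapezoid_deriv n c d x *\<^sub>R \<Psi> x \<partial>lebesgue) =
    (\<integral>x. n *\<^sub>R (indicator {c - 1 / n..c} x *\<^sub>R \<Psi> x) - n *\<^sub>R (indicator {d - 1 / n..d} x *\<^sub>R \<Psi> x) \<partial>lebesgue)"
    by (intro Bochner_Integration.integral_cong) (auto simp: trapezoid_deriv_def algebra_simps)
  also have "\<dots> = n *\<^sub>R (LINT x:{c - 1 / n..c}|lebesgue. \<Psi> x) - n *\<^sub>R (LINT x:{d - 1 / n..d}|lebesgue. \<Psi> x)"
    unfolding set_lebesgue_integral_def
    using \<Psi> unfolding set_integrable_def
    by (subst Bochner_Integration.integral_diff) (auto simp del: scaleR_scaleR)
  finally show ?thesis .
qed

section \<open>Green's formula for solutions\<close>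

locale solution =
  fixes u :: "real \<Rightarrow> real" and \<upsilon> :: "real measure" and z :: complex and f f1 :: "real \<Rightarrow> complex"
  assumes u: "u \<in> H1_loc"
    and sets_\<upsilon>: "sets \<upsilon> = sets borel" and fin_\<upsilon>: "\<And>K. compact K \<Longrightarrow> emeasure \<upsilon> K < \<infinity>"
    and sol: "is_solution u \<upsilon> z f" and qd: "is_quasi_derivative u z f f1"
begin

lemma f: "f \<in> H1_loc" using sol by (simp add: is_solution_def)

text \<open>The Lebesgue density of the weak form without its \<upsilon> term, which is kept apart
  because \<upsilon> need not have a density.\<close>

definition \<Phi> :: "(real \<Rightarrow> complex) \<Rightarrow> real \<Rightarrow> complex" where
  "\<Phi> h x = Dv f x * Dv h x + 1 / 4 * (f x * h x)
     - z * (u x *\<^sub>R (f x * h x) + Dv u x *\<^sub>R Dv (\<lambda>x. f x * h x) x)"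

context
  fixes h :: "real \<Rightarrow> complex"
  assumes h: "h \<in> H1_loc"
begin

lemmas fh = H1_loc_mult(1)[OF f h]

lemma summands_integrable:
  "set_integrable lebesgue {a..b} (\<lambda>x. Dv f x * Dv h x)"
  "set_integrable lebesgue {a..b} (\<lambda>x. Dv f x * h x)"
  "set_integrable lebesgue {a..b} (\<lambda>x. f x * h x)"
  "set_integrable lebesgue {a..b} (\<lambda>x. u x *\<^sub>R (f x * h x))"
  "set_integrable lebesgue {a..b} (\<lambda>x. Dv u x *\<^sub>R (f x * h x))"
  "set_integrable lebesgue {a..b} (\<lambda>x. Dv u x *\<^sub>R Dv (\<lambda>x. f x * h x) x)"
  using f h u fh
  by (auto intro!: lsi_mult lsi_scaleR intro: H1_loc_square_integrable H1_loc_derivative_square_integrable)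

lemma \<Phi>_integrable: "set_integrable lebesgue {a..b} (\<Phi> h)"
  unfolding \<Phi>_def
  by (intro set_integral_diff(1) set_integral_add(1) set_integrable_mult_right summands_integrable)

text \<open>Test with the cutoff times \<open>h\<close> and apply the product rule. The derivative
  of the cutoff occurs in the f' term and in the u' term of \<omega>, and its total factor f' h - z
  u' f h is almost everywhere \<open>f1 * h\<close>: this is where the quasi-derivative
  enters.\<close>

lemma weak_form_trapezoid:
  assumes n: "n \<ge> 1" and cd: "c \<le> d"
  shows "(\<integral>x. trapezoid n c d x *\<^sub>R \<Phi> h x \<partial>lebesgue)
      - z\<^sup>2 * (\<integral>x. trapezoid n c d x *\<^sub>R (f x * h x) \<partial>\<upsilon>) =
    - (\<integral>x. trapezoid_deriv n c d x *\<^sub>R (Dv f x * h x - z * (Dv u x *\<^sub>R (f x * h x))) \<partial>lebesgue)"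
proof -
  let ?w = "trapezoid n c d" and ?g = "trapezoid_deriv n c d"
  define H where "H x = ?w x *\<^sub>R h x" for x
  have n': "n > 0" using n by simp
  have H: "H \<in> H1_c" and DH: "AE x in lebesgue. Dv H x = ?w x *\<^sub>R Dv h x + ?g x *\<^sub>R h x"
    unfolding H_def by (rule trapezoid_scaleR_H1_c[OF n cd h])+
  then have H1: "H \<in> H1_loc" by (simp add: H1_c_def)
  have fH: "(\<lambda>x. f x * H x) = (\<lambda>x. ?w x *\<^sub>R (f x * h x))" by (simp add: H_def)
  have DfH: "AE x in lebesgue. Dv (\<lambda>x. f x * H x) x = ?w x *\<^sub>R Dv (\<lambda>x. f x * h x) x + ?g x *\<^sub>R (f x * h x)"
    unfolding fH by (rule trapezoid_scaleR_H1_c[OF n cd fh])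
  have wm: "?w \<in> borel_measurable lebesgue"
    using H1_loc_square_integrable[OF trapezoid_H1_loc[OF n']] by (rule locally_square_integrable_measurable)
  have w: "integrable lebesgue (\<lambda>x. ?w x *\<^sub>R \<phi> x)" if "\<And>a b. set_integrable lebesgue {a..b} \<phi>" for \<phi> :: "real \<Rightarrow> complex"
    by (rule integrable_cutoff[OF that[of "c-1" d] wm, where B=1])
       (use trapezoid_bounds[OF n' cd] trapezoid_support(1)[OF n cd] in auto)
  have g: "integrable lebesgue (\<lambda>x. ?g x *\<^sub>R \<phi> x)" if "\<And>a b. set_integrable lebesgue {a..b} \<phi>" for \<phi> :: "real \<Rightarrow> complex"
  proof (rule integrable_cutoff[OF that[of "c-1" d] trapezoid_deriv_measurable, where B=n])
    show "\<bar>?g x\<bar> \<le> n" for x using n by (auto simp: trapezoid_deriv_def indicator_def)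
  qed (use trapezoid_support(2)[OF n cd] in auto)
  note si = summands_integrable
  have m: "Dv f \<in> borel_measurable lebesgue" "Dv H \<in> borel_measurable lebesgue" "Dv u \<in> borel_measurable lebesgue"
     "Dv (\<lambda>x. f x * H x) \<in> borel_measurable lebesgue"
    using f u H1 H1_loc_mult(1)[OF f H1]
    by (auto intro!: locally_square_integrable_measurable intro: H1_loc_derivative_square_integrable)
  have T1: "(\<integral>x. Dv f x * Dv H x \<partial>lebesgue) =
      (\<integral>x. ?w x *\<^sub>R (Dv f x * Dv h x) \<partial>lebesgue) + (\<integral>x. ?g x *\<^sub>R (Dv f x * h x) \<partial>lebesgue)"
  proof -
    have "(\<integral>x. Dv f x * Dv H x \<partial>lebesgue) =
        (\<integral>x. ?w x *\<^sub>R (Dv f x * Dv h x) + ?g x *\<^sub>R (Dv f x * h x) \<partial>lebesgue)"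
    proof (rule integral_cong_AE)
      show "(\<lambda>x. ?w x *\<^sub>R (Dv f x * Dv h x) + ?g x *\<^sub>R (Dv f x * h x)) \<in> borel_measurable lebesgue"
        using w[OF si(1)] g[OF si(2)] by (intro borel_measurable_add borel_measurable_integrable)
      show "AE x in lebesgue. Dv f x * Dv H x = ?w x *\<^sub>R (Dv f x * Dv h x) + ?g x *\<^sub>R (Dv f x * h x)"
        using DH by eventually_elim (simp add: algebra_simps)
    qed (use m in auto)
    also have "\<dots> = (\<integral>x. ?w x *\<^sub>R (Dv f x * Dv h x) \<partial>lebesgue) + (\<integral>x. ?g x *\<^sub>R (Dv f x * h x) \<partial>lebesgue)"
      using w[OF si(1)] g[OF si(2)] by (rule Bochner_Integration.integral_add)
    finally show ?thesis .
  qed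
  have T4: "(\<integral>x. complex_of_real (Dv u x) * Dv (\<lambda>x. f x * H x) x \<partial>lebesgue) =
      (\<integral>x. ?w x *\<^sub>R (Dv u x *\<^sub>R Dv (\<lambda>x. f x * h x) x) \<partial>lebesgue) + (\<integral>x. ?g x *\<^sub>R (Dv u x *\<^sub>R (f x * h x)) \<partial>lebesgue)"
  proof -
    have "(\<integral>x. complex_of_real (Dv u x) * Dv (\<lambda>x. f x * H x) x \<partial>lebesgue) =
        (\<integral>x. ?w x *\<^sub>R (Dv u x *\<^sub>R Dv (\<lambda>x. f x * h x) x) + ?g x *\<^sub>R (Dv u x *\<^sub>R (f x * h x)) \<partial>lebesgue)"
    proof (rule integral_cong_AE)
      show "(\<lambda>x. ?w x *\<^sub>R (Dv u x *\<^sub>R Dv (\<lambda>x. f x * h x) x) + ?g x *\<^sub>R (Dv u x *\<^sub>R (f x * h x))) \<in> borel_measurable lebesgue"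
        using w[OF si(6)] g[OF si(5)] by (intro borel_measurable_add borel_measurable_integrable)
      show "(\<lambda>x. complex_of_real (Dv u x) * Dv (\<lambda>x. f x * H x) x) \<in> borel_measurable lebesgue"
        using m by measurable
      show "AE x in lebesgue. complex_of_real (Dv u x) * Dv (\<lambda>x. f x * H x) x =
          ?w x *\<^sub>R (Dv u x *\<^sub>R Dv (\<lambda>x. f x * h x) x) + ?g x *\<^sub>R (Dv u x *\<^sub>R (f x * h x))"
        using DfH
      proof eventually_elim
        case (elim x)
        show ?case unfolding elim by (simp add: scaleR_conv_of_real algebra_simps)
      qed
    qed
    also have "\<dots> = (\<integral>x. ?w x *\<^sub>R (Dv u x *\<^sub>R Dv (\<lambda>x. f x * h x) x) \<partial>lebesgue)
        + (\<integral>x. ?g x *\<^sub>R (Dv u x *\<^sub>R (f x * h x)) \<partial>lebesgue)"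
      using w[OF si(6)] g[OF si(5)] by (rule Bochner_Integration.integral_add)
    finally show ?thesis .
  qed
  have T3: "(\<integral>x. complex_of_real (u x) * (f x * H x) \<partial>lebesgue) = (\<integral>x. ?w x *\<^sub>R (u x *\<^sub>R (f x * h x)) \<partial>lebesgue)"
    by (simp add: H_def scaleR_conv_of_real algebra_simps)
  have \<Phi>: "(\<integral>x. ?w x *\<^sub>R \<Phi> h x \<partial>lebesgue) = (\<integral>x. ?w x *\<^sub>R (Dv f x * Dv h x) \<partial>lebesgue)
      + 1 / 4 * (\<integral>x. ?w x *\<^sub>R (f x * h x) \<partial>lebesgue)
      - z * ((\<integral>x. ?w x *\<^sub>R (u x *\<^sub>R (f x * h x)) \<partial>lebesgue)
        + (\<integral>x. ?w x *\<^sub>R (Dv u x *\<^sub>R Dv (\<lambda>x. f x * h x) x) \<partial>lebesgue))"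
  proof -
    have "(\<integral>x. ?w x *\<^sub>R \<Phi> h x \<partial>lebesgue) = (\<integral>x. (?w x *\<^sub>R (Dv f x * Dv h x)
        + 1 / 4 * (?w x *\<^sub>R (f x * h x)))
        - z * (?w x *\<^sub>R (u x *\<^sub>R (f x * h x)) + ?w x *\<^sub>R (Dv u x *\<^sub>R Dv (\<lambda>x. f x * h x) x)) \<partial>lebesgue)"
      by (intro Bochner_Integration.integral_cong refl) (simp add: \<Phi>_def scaleR_conv_of_real algebra_simps)
    also have "\<dots> = (\<integral>x. ?w x *\<^sub>R (Dv f x * Dv h x) + 1 / 4 * (?w x *\<^sub>R (f x * h x)) \<partial>lebesgue)
        - z * (\<integral>x. ?w x *\<^sub>R (u x *\<^sub>R (f x * h x)) + ?w x *\<^sub>R (Dv u x *\<^sub>R Dv (\<lambda>x. f x * h x) x) \<partial>lebesgue)"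
      using w[OF si(1)] w[OF si(3)] w[OF si(4)] w[OF si(6)]
      by (subst Bochner_Integration.integral_diff)
         (auto intro!: Bochner_Integration.integrable_add integrable_mult_right simp del: scaleR_conv_of_real mult_scaleR_right)
    also have "\<dots> = ((\<integral>x. ?w x *\<^sub>R (Dv f x * Dv h x) \<partial>lebesgue) + 1 / 4 * (\<integral>x. ?w x *\<^sub>R (f x * h x) \<partial>lebesgue))
        - z * ((\<integral>x. ?w x *\<^sub>R (u x *\<^sub>R (f x * h x)) \<partial>lebesgue)
          + (\<integral>x. ?w x *\<^sub>R (Dv u x *\<^sub>R Dv (\<lambda>x. f x * h x) x) \<partial>lebesgue))"
      using w[OF si(1)] w[OF si(3)] w[OF si(4)] w[OF si(6)]
      by (subst (1 2) Bochner_Integration.integral_add)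
         (auto intro!: Bochner_Integration.integrable_add integrable_mult_right simp del: scaleR_conv_of_real mult_scaleR_right)
    finally show ?thesis .
  qed
  have \<Psi>: "(\<integral>x. ?g x *\<^sub>R (Dv f x * h x - z * (Dv u x *\<^sub>R (f x * h x))) \<partial>lebesgue) =
     (\<integral>x. ?g x *\<^sub>R (Dv f x * h x) \<partial>lebesgue) - z * (\<integral>x. ?g x *\<^sub>R (Dv u x *\<^sub>R (f x * h x)) \<partial>lebesgue)"
  proof -
    have "(\<integral>x. ?g x *\<^sub>R (Dv f x * h x - z * (Dv u x *\<^sub>R (f x * h x))) \<partial>lebesgue) =
       (\<integral>x. ?g x *\<^sub>R (Dv f x * h x) - z * (?g x *\<^sub>R (Dv u x *\<^sub>R (f x * h x))) \<partial>lebesgue)"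
      by (intro Bochner_Integration.integral_cong refl) (simp add: scaleR_conv_of_real algebra_simps)
    also have "\<dots> = (\<integral>x. ?g x *\<^sub>R (Dv f x * h x) \<partial>lebesgue) - z * (\<integral>x. ?g x *\<^sub>R (Dv u x *\<^sub>R (f x * h x)) \<partial>lebesgue)"
      using g[OF si(2)] g[OF si(5)]
      by (subst Bochner_Integration.integral_diff) (auto intro!: integrable_mult_right simp del: mult_scaleR_right)
    finally show ?thesis .
  qed
  have "(\<integral>x. Dv f x * Dv H x \<partial>lebesgue) + 1/4 * (\<integral>x. f x * H x \<partial>lebesgue)
        = z * omega u (\<lambda>x. f x * H x) + z\<^sup>2 * (\<integral>x. f x * H x \<partial>\<upsilon>)"
    using sol H by (simp add: is_solution_def)
  then have eq: "(\<integral>x. ?w x *\<^sub>R (Dv f x * Dv h x) \<partial>lebesgue) + (\<integral>x. ?g x *\<^sub>R (Dv f x * h x) \<partial>lebesgue)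
      + 1/4 * (\<integral>x. ?w x *\<^sub>R (f x * h x) \<partial>lebesgue)
    = z * ((\<integral>x. ?w x *\<^sub>R (u x *\<^sub>R (f x * h x)) \<partial>lebesgue) + ((\<integral>x. ?w x *\<^sub>R (Dv u x *\<^sub>R Dv (\<lambda>x. f x * h x) x) \<partial>lebesgue)
        + (\<integral>x. ?g x *\<^sub>R (Dv u x *\<^sub>R (f x * h x)) \<partial>lebesgue)))
      + z\<^sup>2 * (\<integral>x. ?w x *\<^sub>R (f x * h x) \<partial>\<upsilon>)"
    unfolding omega_def T1 T3 T4 by (simp only: fH)
  have "A + 1/4 * B - z * (C + D) - Q = - (G - z * E)"
    if "A + G + 1/4 * B = z * (C + (D + E)) + Q" for A B C D E G Q :: complex
    using that by algebra
  then show ?thesis unfolding \<Phi> \<Psi> using eq by blast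
qed

text \<open>Green's formula, the limit of \<open>weak_form_trapezoid\<close> for n to infinity: the
  cutoffs become the indicator of [c, d), and their slopes turn into boundary values. The test
  function is now any element of \<open>H1_loc\<close>, so conjugates of solutions and constants
  become available.\<close>

theorem weak_form:
  assumes cd: "c \<le> d"
  shows "(LINT x:{c..d}|lebesgue. \<Phi> h x) - z\<^sup>2 * (LINT x:{c..<d}|\<upsilon>. f x * h x) = f1 d * h d - f1 c * h c"
proof -
  define \<Psi> where "\<Psi> x = Dv f x * h x - z * (Dv u x *\<^sub>R (f x * h x))" for x
  have \<Psi>: "set_integrable lebesgue {a..b} \<Psi>" for a b
    unfolding \<Psi>_def by (intro set_integral_diff(1) set_integrable_mult_right summands_integrable)
  \<comment> \<open>A slope \<open>n\<close> on an interval of length 1/n integrates to an average,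
    and \<open>\<Psi>\<close> is almost everywhere the left-continuous function
    \<open>f1 * h\<close>.\<close>
  have avg: "(\<lambda>k. real (Suc k) *\<^sub>R (LINT x:{c - 1 / real (Suc k)..c}|lebesgue. \<Psi> x)) \<longlonglongrightarrow> f1 c * h c" for c
  proof (rule left_average_tendsto[OF \<Psi>, where F = "\<lambda>x. f1 x * h x"])
    show "AE x in lebesgue. f1 x * h x = \<Psi> x"
      using conjunct2[OF qd[unfolded is_quasi_derivative_def]]
    proof eventually_elim
      case (elim x)
      show ?case unfolding elim by (simp add: \<Psi>_def scaleR_conv_of_real algebra_simps)
    qed
    have "continuous (at_left c) h"
      using H1_loc_continuous[OF h] by (simp add: continuous_at_imp_continuous_at_within continuous_on_eq_continuous_at)
    then show "continuous (at_left c) (\<lambda>x. f1 x * h x)"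
      using qd unfolding is_quasi_derivative_def by (intro continuous_mult) auto
  qed
  have 1: "(\<lambda>k. \<integral>x. trapezoid (real (Suc k)) c d x *\<^sub>R \<Phi> h x \<partial>lebesgue) \<longlonglongrightarrow> (LINT x:{c..<d}|lebesgue. \<Phi> h x)"
    by (rule integral_trapezoid_tendsto[OF \<Phi>_integrable cd])
       (auto intro!: locally_square_integrable_measurable H1_loc_square_integrable trapezoid_H1_loc simp del: of_nat_Suc)
  have "trapezoid (real (Suc k)) c d \<in> borel_measurable \<upsilon>" for k
    using borel_measurable_continuous_onI[OF H1_loc_continuous[OF trapezoid_H1_loc[of "real (Suc k)" c d]]]
      measurable_cong_sets[OF sets_\<upsilon> refl] by auto
  then have 2: "(\<lambda>k. \<integral>x. trapezoid (real (Suc k)) c d x *\<^sub>R (f x * h x) \<partial>\<upsilon>) \<longlonglongrightarrow> (LINT x:{c..<d}|\<upsilon>. f x * h x)"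
    using continuous_set_integrable_locally_finite[OF sets_\<upsilon> fin_\<upsilon> H1_loc_continuous[OF fh]] sets_\<upsilon>
    by (intro integral_trapezoid_tendsto cd) auto
  have "(\<lambda>k. - (\<integral>x. trapezoid_deriv (real (Suc k)) c d x *\<^sub>R \<Psi> x \<partial>lebesgue)) \<longlonglongrightarrow>
      (LINT x:{c..<d}|lebesgue. \<Phi> h x) - z\<^sup>2 * (LINT x:{c..<d}|\<upsilon>. f x * h x)"
    unfolding \<Psi>_def by (subst weak_form_trapezoid[symmetric]) (auto intro!: cd tendsto_diff tendsto_mult 1 2 simp del: of_nat_Suc)
  moreover have "(\<lambda>k. - (\<integral>x. trapezoid_deriv (real (Suc k)) c d x *\<^sub>R \<Psi> x \<partial>lebesgue)) \<longlonglongrightarrow> - (f1 c * h c - f1 d * h d)"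
    using tendsto_minus[OF tendsto_diff[OF avg[of c] avg[of d]]]
    by (simp only: integral_trapezoid_deriv[OF of_nat_0_less_iff[THEN iffD2, OF zero_less_Suc] \<Psi>])
  ultimately show ?thesis
    using LIMSEQ_unique set_integral_Ico_Icc[OF \<Phi>_integrable, of c d] by fastforce
qed

end

end

section \<open>The kernel estimate\<close>

text \<open>The quadratic polynomial t -> integral of (f + t g)^2 is nonnegative, so its
  discriminant is not positive. The case of a vanishing leading coefficient is separate.\<close>

lemma Cauchy_Schwarz_integral:
  fixes f g :: "'a \<Rightarrow> real"
  assumes [measurable]: "f \<in> borel_measurable M" "g \<in> borel_measurable M"
    and f: "integrable M (\<lambda>x. (f x)\<^sup>2)" and g: "integrable M (\<lambda>x. (g x)\<^sup>2)"
  shows "integrable M (\<lambda>x. f x * g x)"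
    and "(\<integral>x. f x * g x \<partial>M)\<^sup>2 \<le> (\<integral>x. (f x)\<^sup>2 \<partial>M) * (\<integral>x. (g x)\<^sup>2 \<partial>M)"
proof -
  have ab: "\<bar>f x * g x\<bar> \<le> (f x)\<^sup>2 + (g x)\<^sup>2" for x
  proof -
    have "0 \<le> \<bar>f x\<bar> * \<bar>g x\<bar>" by simp
    then show ?thesis
      using sum_squares_bound[of "\<bar>f x\<bar>" "\<bar>g x\<bar>"] unfolding abs_mult power2_abs mult.assoc by linarith
  qed
  show int: "integrable M (\<lambda>x. f x * g x)"
    by (rule Bochner_Integration.integrable_bound[OF Bochner_Integration.integrable_add[OF f g]])
       (use ab in \<open>auto intro!: AE_I2\<close>)
  have quad': "(\<integral>x. (f x)\<^sup>2 \<partial>M) + 2 * t * (\<integral>x. f x * g x \<partial>M) + t\<^sup>2 * (\<integral>x. (g x)\<^sup>2 \<partial>M) \<ge> 0" for t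
  proof -
    have "0 \<le> (\<integral>x. (f x + t * g x)\<^sup>2 \<partial>M)" by (rule integral_nonneg_AE) auto
    also have "\<dots> = (\<integral>x. (f x)\<^sup>2 + 2 * t * (f x * g x) + t\<^sup>2 * (g x)\<^sup>2 \<partial>M)"
      by (intro Bochner_Integration.integral_cong) (auto simp: power2_eq_square algebra_simps)
    also have "\<dots> = (\<integral>x. (f x)\<^sup>2 \<partial>M) + 2 * t * (\<integral>x. f x * g x \<partial>M) + t\<^sup>2 * (\<integral>x. (g x)\<^sup>2 \<partial>M)"
      using f g int by simp
    finally show ?thesis .
  qed
  define A B C where "A = (\<integral>x. (f x)\<^sup>2 \<partial>M)" and "B = (\<integral>x. f x * g x \<partial>M)" and "C = (\<integral>x. (g x)\<^sup>2 \<partial>M)"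
  have quad: "A + 2 * t * B + t\<^sup>2 * C \<ge> 0" for t using quad' by (simp add: A_def B_def C_def)
  have "C \<ge> 0" unfolding C_def by (rule integral_nonneg_AE) auto
  have "B\<^sup>2 \<le> A * C"
  proof (cases "C = 0")
    case True
    have "B = 0"
    proof (rule ccontr)
      assume "B \<noteq> 0"
      \<comment> \<open>This \<open>t\<close> gives \<open>A + 2 * t * B\<close> the value
        -1.\<close>
      then show False using quad[of "- (A + 1) / (2 * B)"] True by (simp add: field_simps)
    qed
    then show ?thesis using True by simp
  next
    case False
    then have "C > 0" using \<open>C \<ge> 0\<close> by simp
    \<comment> \<open>The polynomial is evaluated at its minimiser.\<close>
    have "A + 2 * (- B / C) * B + (- B / C)\<^sup>2 * C = A - B\<^sup>2 / C"
      using \<open>C > 0\<close> by (simp add: field_simps power2_eq_square)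
    then have "B\<^sup>2 / C \<le> A" using quad[of "- B / C"] by linarith
    then show ?thesis using \<open>C > 0\<close> by (simp add: field_simps)
  qed
  then show "(\<integral>x. f x * g x \<partial>M)\<^sup>2 \<le> (\<integral>x. (f x)\<^sup>2 \<partial>M) * (\<integral>x. (g x)\<^sup>2 \<partial>M)"
    by (simp add: A_def B_def C_def)
qed

section \<open>A Hilbert-Schmidt bound on the product space\<close>

lemma (in pair_sigma_finite) integrable_tensor:
  fixes f g :: "_ \<Rightarrow> real"
  assumes f: "integrable M1 f" and g: "integrable M2 g"
  shows "integrable (M1 \<Otimes>\<^sub>M M2) (\<lambda>(x, y). f x * g y)"
    and "(\<integral>(x, y). f x * g y \<partial>(M1 \<Otimes>\<^sub>M M2)) = (\<integral>x. f x \<partial>M1) * (\<integral>y. g y \<partial>M2)"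
proof -
  have [measurable]: "f \<in> borel_measurable M1" "g \<in> borel_measurable M2" using f g by auto
  show int: "integrable (M1 \<Otimes>\<^sub>M M2) (\<lambda>(x, y). f x * g y)"
  proof (rule Fubini_integrable)
    show "integrable M1 (\<lambda>x. \<integral>y. norm (case (x, y) of (x, y) \<Rightarrow> f x * g y) \<partial>M2)"
      using f by (simp add: abs_mult)
  qed (use g in auto)
  show "(\<integral>(x, y). f x * g y \<partial>(M1 \<Otimes>\<^sub>M M2)) = (\<integral>x. f x \<partial>M1) * (\<integral>y. g y \<partial>M2)"
    using integral_fst[OF int] by simp
qed

lemma (in pair_sigma_finite) integrable_square_bound_tensor:
  assumes K: "case_prod K \<in> borel_measurable (M1 \<Otimes>\<^sub>M M2)"
    and f: "integrable M1 f" and g: "integrable M2 g"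
    and bd: "\<And>x y. x \<in> space M1 \<Longrightarrow> y \<in> space M2 \<Longrightarrow> (K x y)\<^sup>2 \<le> f x * (g y :: real)"
  shows "integrable (M1 \<Otimes>\<^sub>M M2) (\<lambda>p. (case_prod K p)\<^sup>2)"
    and "(\<integral>p. (case_prod K p)\<^sup>2 \<partial>(M1 \<Otimes>\<^sub>M M2)) \<le> (\<integral>x. f x \<partial>M1) * (\<integral>y. g y \<partial>M2)"
proof -
  note [measurable] = K
  show int: "integrable (M1 \<Otimes>\<^sub>M M2) (\<lambda>p. (case_prod K p)\<^sup>2)"
  proof (rule Bochner_Integration.integrable_bound[OF integrable_tensor(1)[OF f g]])
    show "AE p in M1 \<Otimes>\<^sub>M M2. norm ((case_prod K p)\<^sup>2) \<le> norm (case p of (x, y) \<Rightarrow> f x * g y)"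
      using bd by (auto intro!: AE_I2 simp: space_pair_measure intro: order_trans[OF _ abs_ge_self])
  qed measurable
  show "(\<integral>p. (case_prod K p)\<^sup>2 \<partial>(M1 \<Otimes>\<^sub>M M2)) \<le> (\<integral>x. f x \<partial>M1) * (\<integral>y. g y \<partial>M2)"
    unfolding integrable_tensor(2)[OF f g, symmetric]
    by (rule integral_mono[OF int integrable_tensor(1)[OF f g]]) (use bd in \<open>auto simp: space_pair_measure\<close>)
qed

text \<open>The symmetrised kernel has to be kept together: bounding the two halves separately
  would lose the cross term.\<close>

lemma (in finite_measure) symmetrised_kernel_bound:
  fixes \<phi> :: "'a \<Rightarrow> 'b::euclidean_space" and v :: "'a \<Rightarrow> real" and E :: "'a \<Rightarrow> 'a \<Rightarrow> real"
  assumes [measurable]: "\<phi> \<in> borel_measurable M" "v \<in> borel_measurable M"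
      "(\<lambda>(x, y). E x y) \<in> borel_measurable (M \<Otimes>\<^sub>M M)"
    and \<phi>: "integrable M (\<lambda>x. (norm (\<phi> x))\<^sup>2)" and v: "integrable M (\<lambda>x. (v x)\<^sup>2)"
    and E: "\<And>x y. x \<in> space M \<Longrightarrow> y \<in> space M \<Longrightarrow> \<bar>E x y\<bar> \<le> B"
    and E2: "\<And>x. x \<in> space M \<Longrightarrow> (\<integral>y. (E x y)\<^sup>2 \<partial>M) = \<gamma>"
    and EE: "\<And>x. x \<in> space M \<Longrightarrow> AE y in M. E x y * E y x = \<sigma>"
  shows "(2 * (\<integral>x. v x * ((\<integral>y. E x y *\<^sub>R \<phi> y \<partial>M) \<bullet> \<phi> x) \<partial>M))\<^sup>2 \<le>
    (\<integral>x. (norm (\<phi> x))\<^sup>2 \<partial>M)\<^sup>2 * (2 * \<gamma> * (\<integral>x. (v x)\<^sup>2 \<partial>M) + 2 * \<sigma> * (\<integral>x. v x \<partial>M)\<^sup>2)"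
proof -
  interpret P: pair_sigma_finite M M ..
  let ?N = "M \<Otimes>\<^sub>M M"
  \<comment> \<open>The quadratic form is the L^2 pairing of \<open>S\<close> with \<open>K\<close>
    on the product space. As \<open>S\<close> is symmetric and \<open>K'\<close> is the transpose of
    \<open>K\<close>, twice that pairing is the pairing of \<open>S\<close> with
    \<open>K + K'\<close>, to which Cauchy-Schwarz is applied only once.\<close>
  define S where "S = (\<lambda>(x, y). \<phi> y \<bullet> \<phi> x)"
  define K where "K = (\<lambda>(x, y). v x * E x y)"
  define K' where "K' = (\<lambda>(x, y). v y * E y x)"
  have E'[measurable]: "(\<lambda>(x, y). E y x) \<in> borel_measurable ?N"
    using measurable_pair_swap[OF assms(3)] by (simp add: case_prod_beta)
  have m[measurable]: "S \<in> borel_measurable ?N" "K \<in> borel_measurable ?N" "K' \<in> borel_measurable ?N"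
  proof -
    show "S \<in> borel_measurable ?N" unfolding S_def by measurable
    have "(\<lambda>p. v (fst p) * (case p of (x, y) \<Rightarrow> E x y)) \<in> borel_measurable ?N" by measurable
    then show "K \<in> borel_measurable ?N" by (simp add: K_def case_prod_beta')
    have "(\<lambda>p. v (snd p) * (case p of (x, y) \<Rightarrow> E y x)) \<in> borel_measurable ?N" by measurable
    then show "K' \<in> borel_measurable ?N" by (simp add: K'_def case_prod_beta')
  qed
  have one: "integrable M (\<lambda>x. B\<^sup>2 :: real)" by simp
  have Eb: "(E x y)\<^sup>2 \<le> B\<^sup>2" if "x \<in> space M" "y \<in> space M" for x y
    using E[OF that] by (metis abs_ge_zero power2_abs power_mono)
  have S2: "integrable ?N (\<lambda>p. (S p)\<^sup>2)" "(\<integral>p. (S p)\<^sup>2 \<partial>?N) \<le> (\<integral>x. (norm (\<phi> x))\<^sup>2 \<partial>M)\<^sup>2"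
  proof -
    have bd: "(\<phi> y \<bullet> \<phi> x)\<^sup>2 \<le> (norm (\<phi> x))\<^sup>2 * (norm (\<phi> y))\<^sup>2" for x y
      using Cauchy_Schwarz_ineq[of "\<phi> y" "\<phi> x"] by (simp add: power2_norm_eq_inner mult.commute)
    show "integrable ?N (\<lambda>p. (S p)\<^sup>2)" "(\<integral>p. (S p)\<^sup>2 \<partial>?N) \<le> (\<integral>x. (norm (\<phi> x))\<^sup>2 \<partial>M)\<^sup>2"
      using P.integrable_square_bound_tensor[OF m(1)[unfolded S_def] \<phi> \<phi> bd]
      by (simp_all add: S_def power2_eq_square)
  qed
  have K2: "integrable ?N (\<lambda>p. (K p)\<^sup>2)"
  proof -
    have "(v x * E x y)\<^sup>2 \<le> (v x)\<^sup>2 * B\<^sup>2" if "x \<in> space M" "y \<in> space M" for x y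
      using Eb[OF that] by (simp add: power_mult_distrib mult_left_mono)
    from P.integrable_square_bound_tensor(1)[OF m(2)[unfolded K_def] v one this] show ?thesis
      by (simp add: K_def)
  qed
  have K'_swap: "K' = (\<lambda>(x, y). K (y, x))" by (simp add: K_def K'_def)
  have K'2: "integrable ?N (\<lambda>p. (K' p)\<^sup>2)"
    using P.integrable_product_swap[OF K2] by (simp add: K'_swap case_prod_beta')
  have SK: "integrable ?N (\<lambda>p. S p * K p)" and KK': "integrable ?N (\<lambda>p. K p * K' p)"
    and SK': "integrable ?N (\<lambda>p. S p * K' p)"
    by (rule Cauchy_Schwarz_integral(1); use S2 K2 K'2 in simp)+
  have sum2: "(\<lambda>p. (K p + K' p)\<^sup>2) = (\<lambda>p. (K p)\<^sup>2 + (K' p)\<^sup>2 + 2 * (K p * K' p))"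
    by (auto simp: power2_sum)
  have KK2: "integrable ?N (\<lambda>p. (K p + K' p)\<^sup>2)"
    unfolding sum2 using K2 K'2 KK' by (intro Bochner_Integration.integrable_add) auto
  have "(\<integral>p. S p * K p \<partial>?N) = (\<integral>x. \<integral>y. S (x, y) * K (x, y) \<partial>M \<partial>M)"
    using P.integral_fst'[OF SK] by simp
  also have "\<dots> = (\<integral>x. v x * ((\<integral>y. E x y *\<^sub>R \<phi> y \<partial>M) \<bullet> \<phi> x) \<partial>M)"
  proof (rule Bochner_Integration.integral_cong[OF refl])
    fix x assume x: "x \<in> space M"
    have "integrable M (\<lambda>y. E x y *\<^sub>R \<phi> y)"
    proof (rule Bochner_Integration.integrable_bound[OF Bochner_Integration.integrable_add[OF one \<phi>]])
      have "E x \<in> borel_measurable M"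
        using measurable_compose[OF measurable_Pair1'[OF x] assms(3)] by simp
      then show "(\<lambda>y. E x y *\<^sub>R \<phi> y) \<in> borel_measurable M" by measurable
      show "AE y in M. norm (E x y *\<^sub>R \<phi> y) \<le> norm (B\<^sup>2 + (norm (\<phi> y))\<^sup>2)"
      proof (rule AE_I2)
        fix y assume y: "y \<in> space M"
        have "\<bar>E x y\<bar> * norm (\<phi> y) \<le> (E x y)\<^sup>2 + (norm (\<phi> y))\<^sup>2"
        proof -
          have "0 \<le> \<bar>E x y\<bar> * norm (\<phi> y)" by simp
          then show ?thesis
            using sum_squares_bound[of "\<bar>E x y\<bar>" "norm (\<phi> y)"] unfolding power2_abs mult.assoc by linarith
        qed
        then show "norm (E x y *\<^sub>R \<phi> y) \<le> norm (B\<^sup>2 + (norm (\<phi> y))\<^sup>2)" using Eb[OF x y] by simp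
      qed
    qed
    then have "(\<integral>y. E x y *\<^sub>R \<phi> y \<partial>M) \<bullet> \<phi> x = (\<integral>y. E x y *\<^sub>R \<phi> y \<bullet> \<phi> x \<partial>M)"
      by (rule integral_inner_left[symmetric])
    then show "(\<integral>y. S (x, y) * K (x, y) \<partial>M) = v x * ((\<integral>y. E x y *\<^sub>R \<phi> y \<partial>M) \<bullet> \<phi> x)"
      unfolding integral_mult_right_zero[symmetric]
      by (simp add: S_def K_def mult_ac)
  qed
  finally have L1: "(\<integral>p. S p * K p \<partial>?N) = (\<integral>x. v x * ((\<integral>y. E x y *\<^sub>R \<phi> y \<partial>M) \<bullet> \<phi> x) \<partial>M)" .
  \<comment> \<open>Exchanging the variables fixes \<open>S\<close> and turns \<open>K\<close> into
    \<open>K'\<close>.\<close>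
  have L2: "(\<integral>p. S p * K' p \<partial>?N) = (\<integral>p. S p * K p \<partial>?N)"
    using P.integral_product_swap[OF borel_measurable_integrable[OF SK]]
    by (simp add: K'_swap S_def case_prod_beta' inner_commute)
  have K2_eq: "(\<integral>p. (K p)\<^sup>2 \<partial>?N) = \<gamma> * (\<integral>x. (v x)\<^sup>2 \<partial>M)"
  proof -
    have "(\<integral>p. (K p)\<^sup>2 \<partial>?N) = (\<integral>x. \<integral>y. (K (x, y))\<^sup>2 \<partial>M \<partial>M)"
      using P.integral_fst'[OF K2] by simp
    also have "\<dots> = (\<integral>x. (v x)\<^sup>2 * \<gamma> \<partial>M)"
      using E2 by (intro Bochner_Integration.integral_cong) (auto simp: K_def power_mult_distrib)
    finally show ?thesis by simp
  qed
  have K'2_eq: "(\<integral>p. (K' p)\<^sup>2 \<partial>?N) = \<gamma> * (\<integral>x. (v x)\<^sup>2 \<partial>M)"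
    using P.integral_product_swap[OF borel_measurable_integrable[OF K2]] K2_eq
    by (simp add: K'_swap case_prod_beta')
  \<comment> \<open>The cross term is explicit because \<open>EE\<close> reduces
    \<open>K * K'\<close> to \<sigma> v(x) v(y) for almost every y, a function in which the
    variables separate.\<close>
  have KK'_eq: "(\<integral>p. K p * K' p \<partial>?N) = \<sigma> * (\<integral>x. v x \<partial>M)\<^sup>2"
  proof -
    have "(\<integral>p. K p * K' p \<partial>?N) = (\<integral>x. \<integral>y. K (x, y) * K' (x, y) \<partial>M \<partial>M)"
      using P.integral_fst'[OF KK'] by simp
    also have "\<dots> = (\<integral>x. \<sigma> * (\<integral>x. v x \<partial>M) * v x \<partial>M)"
    proof (rule Bochner_Integration.integral_cong[OF refl])
      fix x assume x: "x \<in> space M"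
      have "E x \<in> borel_measurable M" "(\<lambda>y. E y x) \<in> borel_measurable M"
        using measurable_compose[OF measurable_Pair1'[OF x] assms(3)]
          measurable_compose[OF measurable_Pair2'[OF x] assms(3)] by simp_all
      then have "(\<integral>y. K (x, y) * K' (x, y) \<partial>M) = (\<integral>y. (\<sigma> * v x) * v y \<partial>M)"
        unfolding K_def K'_def
      proof (intro integral_cong_AE)
        show "AE y in M. (case (x, y) of (x, y) \<Rightarrow> v x * E x y) * (case (x, y) of (x, y) \<Rightarrow> v y * E y x) = \<sigma> * v x * v y"
          using EE[OF x] by eventually_elim (auto simp: mult_ac)
      qed auto
      then show "(\<integral>y. K (x, y) * K' (x, y) \<partial>M) = \<sigma> * (\<integral>x. v x \<partial>M) * v x" by simp
    qed
    finally show ?thesis by (simp add: power2_eq_square)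
  qed
  have "2 * (\<integral>p. S p * K p \<partial>?N) = (\<integral>p. S p * (K p + K' p) \<partial>?N)"
    using SK SK' L2 by (simp add: distrib_left)
  then have "(2 * (\<integral>p. S p * K p \<partial>?N))\<^sup>2 = (\<integral>p. S p * (K p + K' p) \<partial>?N)\<^sup>2" by simp
  also have "\<dots> \<le> (\<integral>p. (S p)\<^sup>2 \<partial>?N) * (\<integral>p. (K p + K' p)\<^sup>2 \<partial>?N)"
    by (rule Cauchy_Schwarz_integral(2)) (use S2 KK2 in auto)
  also have "\<dots> \<le> (\<integral>x. (norm (\<phi> x))\<^sup>2 \<partial>M)\<^sup>2 * (\<integral>p. (K p + K' p)\<^sup>2 \<partial>?N)"
    using S2(2) by (rule mult_right_mono) (rule integral_nonneg_AE, simp)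
  also have "(\<integral>p. (K p + K' p)\<^sup>2 \<partial>?N) = 2 * \<gamma> * (\<integral>x. (v x)\<^sup>2 \<partial>M) + 2 * \<sigma> * (\<integral>x. v x \<partial>M)\<^sup>2"
    unfolding sum2 using K2 K'2 KK' K2_eq K'2_eq KK'_eq by simp
  finally show ?thesis by (simp only: L1)
qed

section \<open>The kernel of the inverse of d/dx + 1/2 on one period\<close>

lemma integral_lebesgue_on_interval:
  fixes g :: "real \<Rightarrow> 'a::euclidean_space"
  shows "(\<integral>x. g x \<partial>lebesgue_on {a..b}) = (LINT x:{a..b}|lebesgue. g x)"
    and "integrable (lebesgue_on {a..b}) g \<longleftrightarrow> set_integrable lebesgue {a..b} g"
  by (simp_all add: integral_restrict_space integrable_restrict_space set_lebesgue_integral_def set_integrable_def)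

lemma set_integral_cong_AE_interval:
  fixes g h :: "real \<Rightarrow> 'a::euclidean_space"
  assumes g: "set_integrable lebesgue {a..b} g" and eq: "AE x in lebesgue. g x = h x"
  shows "(LINT x:{a..b}|lebesgue. h x) = (LINT x:{a..b}|lebesgue. g x)" "set_integrable lebesgue {a..b} h"
proof -
  have m: "(\<lambda>x. indicator {a..b} x *\<^sub>R g x) \<in> borel_measurable lebesgue"
    using g by (auto simp: set_integrable_def)
  have e: "AE x in lebesgue. indicator {a..b} x *\<^sub>R g x = indicator {a..b} x *\<^sub>R h x"
    using eq by eventually_elim simp
  have m': "(\<lambda>x. indicator {a..b} x *\<^sub>R h x) \<in> borel_measurable lebesgue"
    by (rule borel_measurable_lebesgue_cong_AE[OF m e])
  show "(LINT x:{a..b}|lebesgue. h x) = (LINT x:{a..b}|lebesgue. g x)"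
    unfolding set_lebesgue_integral_def using e m m' by (intro integral_cong_AE) (auto elim: eventually_mono)
  show "set_integrable lebesgue {a..b} h"
    using g unfolding set_integrable_def by (rule integrable_cong_AE_imp[OF _ m']) (use e in \<open>auto elim: eventually_mono\<close>)
qed

lemma set_integral_step:
  fixes g :: "real \<Rightarrow> 'a::euclidean_space"
  assumes g: "set_integrable lebesgue {b..e} g" and x: "x \<in> {b..e}"
  shows "(LINT y:{b..e}|lebesgue. (if y < x then \<alpha> else \<beta>) *\<^sub>R g y) =
    \<alpha> *\<^sub>R (LINT y:{b..x}|lebesgue. g y) + \<beta> *\<^sub>R (LINT y:{x..e}|lebesgue. g y)"
proof -
  have s: "set_integrable lebesgue {b..x} g" "set_integrable lebesgue {x..e} g"
    using x by (auto intro: set_integrable_subset[OF g])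
  let ?G = "\<lambda>y. \<alpha> *\<^sub>R (indicator {b..x} y *\<^sub>R g y) + \<beta> *\<^sub>R (indicator {x..e} y *\<^sub>R g y)"
  let ?H = "\<lambda>y. indicator {b..e} y *\<^sub>R (if y < x then \<alpha> else \<beta>) *\<^sub>R g y"
  have int: "integrable lebesgue ?G"
    using s unfolding set_integrable_def by (intro Bochner_Integration.integrable_add integrable_scaleR_right)
  have "AE y in lebesgue. y \<notin> {x}" by (rule AE_completion[OF AE_not_in]) auto
  then have eq: "AE y in lebesgue. ?G y = ?H y"
    by eventually_elim (use x in \<open>auto simp: indicator_def\<close>)
  have "(\<integral>y. ?H y \<partial>lebesgue) = (\<integral>y. ?G y \<partial>lebesgue)"
    using eq borel_measurable_lebesgue_cong_AE[OF borel_measurable_integrable[OF int] eq] int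
    by (intro integral_cong_AE) (auto elim: eventually_mono)
  also have "\<dots> = \<alpha> *\<^sub>R (LINT y:{b..x}|lebesgue. g y) + \<beta> *\<^sub>R (LINT y:{x..e}|lebesgue. g y)"
    using s unfolding set_integrable_def set_lebesgue_integral_def
    by (subst Bochner_Integration.integral_add) (auto simp del: scaleR_scaleR)
  finally show ?thesis unfolding set_lebesgue_integral_def .
qed

lemmas H1_loc_inner = H1_loc_bilinear[OF bounded_bilinear_inner]

lemma exp_H1_loc:
  "(\<lambda>x. exp (r * x)) \<in> H1_loc" "Dv (\<lambda>x. exp (r * x)) x = (r * exp (r * x) :: real)"
proof -
  have d: "((\<lambda>x. exp (r * x)) has_vector_derivative r * exp (r * x)) (at x)" for x
    unfolding has_real_derivative_iff_has_vector_derivative[symmetric]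
    by (auto intro!: derivative_eq_intros)
  then show "Dv (\<lambda>x. exp (r * x)) x = r * exp (r * x)" by (rule vector_derivative_at)
  show "(\<lambda>x. exp (r * x)) \<in> H1_loc" by (rule H1_loc_C1[OF d]) (intro continuous_intros)
qed

text \<open>With \<open>s = \<plusminus>exp (- l / 2)\<close>, this is the inverse of \<open>d/dx + 1/2\<close> on functions on
  \<open>{b..b + l}\<close> satisfying the periodic or antiperiodic boundary condition. The operator factors
  \<open>- d\<^sup>2/dx\<^sup>2 + 1/4\<close>.\<close>

definition kern :: "real \<Rightarrow> real \<Rightarrow> real \<Rightarrow> real" where
  "kern s x y = (if y < x then 1 else s) * exp ((y - x) / 2) / (1 - s)"

text \<open>Collects the consequences of the boundary condition for \<open>f\<close> before the
  differential equation enters; the sign \<open>\<epsilon>\<close> treats both spectra at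
  once.\<close>

locale quasiperiodic =
  fixes b l s \<epsilon> :: real and f :: "real \<Rightarrow> complex"
  assumes l: "l > 0" and eps: "\<epsilon> = 1 \<or> \<epsilon> = -1" and s: "s = \<epsilon> * exp (- l / 2)"
    and f: "f \<in> H1_loc" and per: "f (b + l) = \<epsilon> *\<^sub>R f b"
begin

abbreviation "I \<equiv> {b..b + l}"
abbreviation "\<phi> x \<equiv> Dv f x + (1/2) *\<^sub>R f x"
abbreviation "\<gamma> \<equiv> (1 - s\<^sup>2) / (1 - s)\<^sup>2"
abbreviation "X \<equiv> (LINT x:I|lebesgue. (norm (Dv f x))\<^sup>2 + (norm (f x))\<^sup>2 / 4)"

lemma s_less: "s < 1" "s \<noteq> 0" "s\<^sup>2 = exp (- l)"
proof -
  have "exp (- l / 2) < 1" using l by simp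
  then show "s < 1" "s \<noteq> 0" using eps by (auto simp: s intro: less_trans[of _ 0])
  show "s\<^sup>2 = exp (- l)" using eps by (auto simp: s power2_eq_square simp flip: exp_add)
qed

lemma s_eps: "s * exp (l / 2) * \<epsilon> = 1"
  using eps by (auto simp: s simp flip: exp_add)

lemma phi_lsi: "locally_square_integrable \<phi>"
  by (intro locally_square_integrable_add H1_loc_derivative_square_integrable f
      locally_square_integrable_continuous continuous_intros H1_loc_continuous)

text \<open>The function F(y) = exp(y/2) f(y) has derivative exp(y/2) \<phi>(y), so the two branches
  of the kernel integrate to F(x) - F(b) and s (F(b + l) - F(x)), up to the factor exp(-x/2)/(1 -
  s). The boundary condition and s exp(l/2) \<epsilon> = 1 give s F(b + l) = F(b), leaving (1 - s)
  F(x).\<close>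

lemma phi_representation:
  assumes x: "x \<in> I"
  shows "(\<integral>y. kern s x y *\<^sub>R \<phi> y \<partial>lebesgue_on I) = f x"
proof -
  define F where "F y = exp (1/2 * y) *\<^sub>R f y" for y
  have F: "F \<in> H1_loc" unfolding F_def by (rule H1_loc_scaleR(1)[OF exp_H1_loc(1) f])
  have DF: "AE y in lebesgue. Dv F y = exp (1/2 * y) *\<^sub>R \<phi> y"
    unfolding F_def using H1_loc_scaleR(2)[OF exp_H1_loc(1)[of "1/2"] f]
  proof eventually_elim
    case (elim y)
    show ?case unfolding elim exp_H1_loc(2) by (simp add: algebra_simps)
  qed
  let ?w = "exp (- x / 2) / (1 - s)"
  let ?c = "\<lambda>y. if y < x then ?w else s * ?w"
  have k: "kern s x y *\<^sub>R \<phi> y = ?c y *\<^sub>R (exp (1/2 * y) *\<^sub>R \<phi> y)" for y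
  proof -
    have "exp ((y - x) / 2) = exp (- x / 2) * exp (1/2 * y)"
      by (simp add: diff_divide_distrib flip: exp_add)
    then have "kern s x y = ?c y * exp (1/2 * y)" by (simp add: kern_def)
    then show ?thesis by (simp only: scaleR_scaleR)
  qed
  have int: "set_integrable lebesgue I (\<lambda>y. exp (1/2 * y) *\<^sub>R \<phi> y)"
    by (rule set_integral_cong_AE_interval(2)[OF H1_loc_derivative_integrable[OF F] DF])
  have FTC: "p \<le> q \<Longrightarrow> (LINT y:{p..q}|lebesgue. exp (1/2 * y) *\<^sub>R \<phi> y) = F q - F p" for p q
    using set_integral_cong_AE_interval(1)[OF H1_loc_derivative_integrable[OF F] DF] H1_loc_integral_derivative[OF F]
    by simp
  have "(\<integral>y. kern s x y *\<^sub>R \<phi> y \<partial>lebesgue_on I) = (LINT y:I|lebesgue. ?c y *\<^sub>R (exp (1/2 * y) *\<^sub>R \<phi> y))"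
    by (simp only: integral_lebesgue_on_interval k)
  also have "\<dots> = ?w *\<^sub>R (F x - F b) + (s * ?w) *\<^sub>R (F (b + l) - F x)"
    using x by (subst set_integral_step[OF int x]) (simp only: FTC atLeastAtMost_iff)
  also have "\<dots> = ?w *\<^sub>R (F x - F b + s *\<^sub>R F (b + l) - s *\<^sub>R F x)"
    by (simp add: scaleR_add_right scaleR_diff_right mult.commute)
  also have "s *\<^sub>R F (b + l) = F b"
  proof -
    have "s *\<^sub>R F (b + l) = (s * exp (l / 2) * \<epsilon>) *\<^sub>R F b"
      by (simp add: F_def per exp_add add_divide_distrib mult_ac)
    then show ?thesis by (simp add: s_eps)
  qed
  also have "?w *\<^sub>R (F x - F b + F b - s *\<^sub>R F x) = ?w *\<^sub>R ((1 - s) *\<^sub>R F x)"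
    by (simp add: scaleR_diff_left)
  also have "\<dots> = f x"
    using s_less by (simp add: F_def flip: exp_add)
  finally show ?thesis .
qed

lemma kern_bound:
  assumes "x \<in> I" "y \<in> I"
  shows "\<bar>kern s x y\<bar> \<le> exp (l / 2) / (1 - s)"
proof -
  have "\<bar>s\<bar> \<le> 1" using eps l by (auto simp: s)
  then have "\<bar>if y < x then 1 else s\<bar> * exp ((y - x) / 2) \<le> 1 * exp (l / 2)"
    using assms by (intro mult_mono) auto
  then show ?thesis using s_less by (simp add: kern_def abs_mult divide_right_mono)
qed

text \<open>The value does not depend on \<open>x\<close> because s^2 exp(b + l) = exp(b) cancels
  the contributions of the two ends; what remains is exp(-x) exp(x) times the constant.\<close>

lemma kern_square_integral:
  assumes x: "x \<in> I"
  shows "(\<integral>y. (kern s x y)\<^sup>2 \<partial>lebesgue_on I) = \<gamma>"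
proof -
  let ?w = "exp (- x) / (1 - s)\<^sup>2"
  have k: "(kern s x y)\<^sup>2 = (if y < x then ?w else s\<^sup>2 * ?w) *\<^sub>R exp (1 * y)" for y
  proof -
    have "(exp ((y - x) / 2))\<^sup>2 = exp y * exp (- x)"
      by (simp add: power2_eq_square flip: exp_add)
    then show ?thesis by (simp add: kern_def power_mult_distrib power_divide)
  qed
  note e = exp_H1_loc[of 1]
  have FTC: "p \<le> q \<Longrightarrow> (LINT y:{p..q}|lebesgue. exp (1 * y)) = exp q - (exp p :: real)" for p q
    using H1_loc_integral_derivative[OF e(1), of p q] unfolding e(2) by simp
  have "set_integrable lebesgue I (\<lambda>y. exp (1 * y) :: real)"
    using H1_loc_derivative_integrable[OF e(1), of b "b + l"] unfolding e(2) by simp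
  then have "(LINT y:I|lebesgue. (kern s x y)\<^sup>2) = ?w * (exp x - exp b) + s\<^sup>2 * ?w * (exp (b + l) - exp x)"
    using x unfolding k by (subst set_integral_step[OF _ x]) (auto simp only: FTC real_scaleR_def atLeastAtMost_iff)
  also have "\<dots> = (exp (- x) * exp x) * (1 - s\<^sup>2) / (1 - s)\<^sup>2 + (s\<^sup>2 * exp (b + l) - exp b) * ?w"
    by (simp add: divide_inverse algebra_simps)
  also have "s\<^sup>2 * exp (b + l) = exp b" by (simp add: s_less flip: exp_add)
  finally show ?thesis by (simp add: integral_lebesgue_on_interval flip: exp_add)
qed

text \<open>The exponentials cancel, and off the diagonal exactly one of the two factors lies on the
  branch carrying \<open>s\<close>. On the diagonal both do, but for fixed \<open>x\<close> that is
  a single point \<open>y\<close>.\<close>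

lemma kern_product:
  "x \<noteq> y \<Longrightarrow> kern s x y * kern s y x = s / (1 - s)\<^sup>2"
proof -
  assume "x \<noteq> y"
  have "exp ((y - x) / 2) * exp ((x - y) / 2) = 1" by (simp flip: exp_add add_divide_distrib)
  then show ?thesis using \<open>x \<noteq> y\<close> by (auto simp: kern_def power2_eq_square mult_ac)
qed

lemma kern_measurable:
  "(\<lambda>(x, y). kern s x y) \<in> borel_measurable (lebesgue_on I \<Otimes>\<^sub>M lebesgue_on I)"
proof -
  have "(\<lambda>x. x) \<in> borel_measurable (lebesgue_on I)"
    by (intro measurable_restrict_space1 measurable_completion) auto
  from measurable_compose[OF measurable_fst this] measurable_compose[OF measurable_snd this]
  have [measurable]: "fst \<in> borel_measurable (lebesgue_on I \<Otimes>\<^sub>M lebesgue_on I)"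
      "snd \<in> borel_measurable (lebesgue_on I \<Otimes>\<^sub>M lebesgue_on I)" by auto
  show ?thesis unfolding kern_def case_prod_beta' by measurable
qed

lemma finite_measure_I: "finite_measure (lebesgue_on I)"
  by (rule finite_measure_lebesgue_on) simp

lemma integral_derivative_norm_square: "(LINT x:I|lebesgue. Dv (\<lambda>x. f x \<bullet> f x) x) = 0"
  using H1_loc_integral_derivative[OF H1_loc_inner(1)[OF f f], of b "b + l"] per l eps by auto

text \<open>The cross term of |f' + f/2|^2 is half the derivative of |f|^2, whose integral over the
  period vanishes because \<epsilon> has modulus 1.\<close>

lemma norm_phi_integral: "(LINT x:I|lebesgue. (norm (\<phi> x))\<^sup>2) = X"
proof -
  have 1: "set_integrable lebesgue I (\<lambda>x. (norm (Dv f x))\<^sup>2 + (norm (f x))\<^sup>2 / 4)"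
    using H1_loc_derivative_square_integrable[OF f] H1_loc_square_integrable[OF f]
    by (intro set_integral_add set_integrable_divide) (auto simp: locally_square_integrable_def)
  have 2: "set_integrable lebesgue I (\<lambda>x. 1/2 * Dv (\<lambda>x. f x \<bullet> f x) x)"
    using H1_loc_derivative_integrable[OF H1_loc_inner(1)[OF f f]] by simp
  have "AE x in lebesgue. (norm (Dv f x))\<^sup>2 + (norm (f x))\<^sup>2 / 4 + 1/2 * Dv (\<lambda>x. f x \<bullet> f x) x = (norm (\<phi> x))\<^sup>2"
    using H1_loc_inner(2)[OF f f]
    by eventually_elim (simp add: power2_norm_eq_inner inner_add_left inner_add_right inner_commute algebra_simps)
  from set_integral_cong_AE_interval(1)[OF set_integral_add(1)[OF 1 2] this]
  show ?thesis using set_integral_add(2)[OF 1 2] integral_derivative_norm_square by simp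
qed

text \<open>Cauchy-Schwarz in \<open>phi_representation\<close>. Besides estimating the \<upsilon>
  term, this pointwise bound yields the strict positivity of \<open>X\<close>.\<close>

lemma norm_square_bound:
  assumes x: "x \<in> I"
  shows "(norm (f x))\<^sup>2 \<le> \<gamma> * X"
proof -
  have m: "kern s x \<in> borel_measurable (lebesgue_on I)" "(\<lambda>y. norm (\<phi> y)) \<in> borel_measurable (lebesgue_on I)"
  proof -
    show "kern s x \<in> borel_measurable (lebesgue_on I)"
      using measurable_compose[OF measurable_Pair1' kern_measurable] x by simp
    show "(\<lambda>y. norm (\<phi> y)) \<in> borel_measurable (lebesgue_on I)"
      by (rule measurable_compose[OF measurable_restrict_space1[OF locally_square_integrable_measurable[OF phi_lsi]]
            borel_measurable_norm])
  qed
  interpret finite_measure "lebesgue_on I" by (rule finite_measure_I)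
  have k: "integrable (lebesgue_on I) (\<lambda>y. \<bar>kern s x y\<bar>\<^sup>2)"
  proof (rule integrable_const_bound)
    have "norm (\<bar>kern s x y\<bar>\<^sup>2) \<le> (exp (l / 2) / (1 - s))\<^sup>2" if "y \<in> I" for y
      using power_mono[OF kern_bound[OF x that], of 2] by simp
    then show "AE y in lebesgue_on I. norm (\<bar>kern s x y\<bar>\<^sup>2) \<le> (exp (l / 2) / (1 - s))\<^sup>2"
      by (intro AE_I2) simp
  qed (use m in measurable)
  have p: "integrable (lebesgue_on I) (\<lambda>y. (norm (\<phi> y))\<^sup>2)"
    using phi_lsi by (simp only: integral_lebesgue_on_interval locally_square_integrable_def)
  have "norm (f x) \<le> (\<integral>y. \<bar>kern s x y\<bar> * norm (\<phi> y) \<partial>lebesgue_on I)"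
    unfolding phi_representation[OF x, symmetric] using integral_norm_bound[of "lebesgue_on I" "\<lambda>y. kern s x y *\<^sub>R \<phi> y"]
    by simp
  then have "(norm (f x))\<^sup>2 \<le> (\<integral>y. \<bar>kern s x y\<bar> * norm (\<phi> y) \<partial>lebesgue_on I)\<^sup>2"
    by (intro power_mono) auto
  also have "\<dots> \<le> (\<integral>y. \<bar>kern s x y\<bar>\<^sup>2 \<partial>lebesgue_on I) * (\<integral>y. (norm (\<phi> y))\<^sup>2 \<partial>lebesgue_on I)"
    by (rule Cauchy_Schwarz_integral(2)[OF _ m(2) k p]) (use m in measurable)
  also have "\<dots> = \<gamma> * X"
    by (simp only: power2_abs kern_square_integral[OF x]) (simp only: integral_lebesgue_on_interval norm_phi_integral)
  finally show ?thesis .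
qed

text \<open>With p = |f|^2 and v = u + u', one has u p + u' p' + (u p)' = v (p + p') and p + p' = 2
  f.\<phi>, where the dot is the real inner product of complex numbers. Equal end values of u p, u
  and u^2 remove the exact derivatives, so the \<omega> form is twice the integral of v f.\<phi>, v
  integrates like u, and v^2 like u^2 + u'^2.\<close>

lemma omega_bound:
  fixes u :: "real \<Rightarrow> real"
  assumes u: "u \<in> H1_loc" and uper: "u (b + l) = u b"
  shows "(LINT x:I|lebesgue. u x * (f x \<bullet> f x) + Dv u x * Dv (\<lambda>x. f x \<bullet> f x) x)\<^sup>2 \<le>
    X\<^sup>2 * (2 * \<gamma> * (LINT x:I|lebesgue. (u x)\<^sup>2 + (Dv u x)\<^sup>2) + 2 * (s / (1 - s)\<^sup>2) * (LINT x:I|lebesgue. u x)\<^sup>2)"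
proof -
  let ?v = "\<lambda>x. u x + Dv u x" and ?p = "\<lambda>x. f x \<bullet> f x"
  have v: "locally_square_integrable ?v"
    by (intro locally_square_integrable_add H1_loc_square_integrable H1_loc_derivative_square_integrable u)
  interpret finite_measure "lebesgue_on I" by (rule finite_measure_I)
  have "(2 * (\<integral>x. ?v x * ((\<integral>y. kern s x y *\<^sub>R \<phi> y \<partial>lebesgue_on I) \<bullet> \<phi> x) \<partial>lebesgue_on I))\<^sup>2 \<le>
    (\<integral>x. (norm (\<phi> x))\<^sup>2 \<partial>lebesgue_on I)\<^sup>2 * (2 * \<gamma> * (\<integral>x. (?v x)\<^sup>2 \<partial>lebesgue_on I)
      + 2 * (s / (1 - s)\<^sup>2) * (\<integral>x. ?v x \<partial>lebesgue_on I)\<^sup>2)"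
  proof (rule symmetrised_kernel_bound[OF _ _ kern_measurable _ _ kern_bound kern_square_integral])
    show "\<phi> \<in> borel_measurable (lebesgue_on I)"
      by (rule measurable_restrict_space1[OF locally_square_integrable_measurable[OF phi_lsi]])
    show "?v \<in> borel_measurable (lebesgue_on I)"
      by (rule measurable_restrict_space1[OF locally_square_integrable_measurable[OF v]])
    show "integrable (lebesgue_on I) (\<lambda>x. (norm (\<phi> x))\<^sup>2)"
      using phi_lsi by (simp only: integral_lebesgue_on_interval locally_square_integrable_def)
    show "integrable (lebesgue_on I) (\<lambda>x. (?v x)\<^sup>2)"
      using v by (simp add: integral_lebesgue_on_interval locally_square_integrable_def)
    show "AE y in lebesgue_on I. kern s x y * kern s y x = s / (1 - s)\<^sup>2" for x
    proof -
      have "AE y in lebesgue. y \<notin> {x}" by (rule AE_completion[OF AE_not_in]) auto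
      then show ?thesis by (subst AE_restrict_space_iff) (auto elim!: eventually_mono simp: kern_product)
    qed
  qed auto
  \<comment> \<open>Inserting the representation of \<open>f\<close> turns the kernel form into the
    integral that has to be estimated.\<close>
  moreover have "(\<integral>x. ?v x * ((\<integral>y. kern s x y *\<^sub>R \<phi> y \<partial>lebesgue_on I) \<bullet> \<phi> x) \<partial>lebesgue_on I)
      = (\<integral>x. ?v x * (f x \<bullet> \<phi> x) \<partial>lebesgue_on I)"
    by (intro Bochner_Integration.integral_cong refl) (simp add: phi_representation)
  ultimately have main: "(2 * (LINT x:I|lebesgue. ?v x * (f x \<bullet> \<phi> x)))\<^sup>2 \<le>
    X\<^sup>2 * (2 * \<gamma> * (LINT x:I|lebesgue. (?v x)\<^sup>2) + 2 * (s / (1 - s)\<^sup>2) * (LINT x:I|lebesgue. ?v x)\<^sup>2)"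
    by (simp only: integral_lebesgue_on_interval norm_phi_integral)
  note p = H1_loc_inner(1)[OF f f]
  have up: "(\<lambda>x. u x * ?p x) \<in> H1_loc" by (rule H1_loc_mult(1)[OF u p])
  have uu: "(\<lambda>x. u x * u x) \<in> H1_loc" by (rule H1_loc_mult(1)[OF u u])
  have pper: "?p (b + l) = ?p b" using per eps by auto
  have i1: "set_integrable lebesgue I (\<lambda>x. u x * ?p x + Dv u x * Dv ?p x)"
    by (intro set_integral_add lsi_mult H1_loc_square_integrable H1_loc_derivative_square_integrable u p)
  have i2: "set_integrable lebesgue I (\<lambda>x. Dv (\<lambda>x. u x * ?p x) x)" by (rule H1_loc_derivative_integrable[OF up])
  have "AE x in lebesgue. (u x * ?p x + Dv u x * Dv ?p x) + Dv (\<lambda>x. u x * ?p x) x = 2 * (?v x * (f x \<bullet> \<phi> x))"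
    using H1_loc_inner(2)[OF f f] H1_loc_mult(2)[OF u p]
    by eventually_elim (simp add: inner_add_right inner_commute algebra_simps)
  from set_integral_cong_AE_interval(1)[OF set_integral_add(1)[OF i1 i2] this]
  have om: "2 * (LINT x:I|lebesgue. ?v x * (f x \<bullet> \<phi> x)) = (LINT x:I|lebesgue. u x * ?p x + Dv u x * Dv ?p x)"
    using set_integral_add(2)[OF i1 i2] H1_loc_integral_derivative[OF up, of b "b + l"] l uper pper by simp
  have i3: "set_integrable lebesgue I u"
    using H1_loc_continuous[OF u] lsi_mult[of "\<lambda>_. 1" u b "b+l"] H1_loc_square_integrable[OF u]
      H1_loc_square_integrable[OF H1_loc_const[of "1::real"]] by simp
  have v1: "(LINT x:I|lebesgue. ?v x) = (LINT x:I|lebesgue. u x)"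
    using set_integral_add(2)[OF i3 H1_loc_derivative_integrable[OF u]] H1_loc_integral_derivative[OF u, of b "b + l"] l uper
    by simp
  have i4: "set_integrable lebesgue I (\<lambda>x. (u x)\<^sup>2 + (Dv u x)\<^sup>2)"
    using H1_loc_square_integrable[OF u] H1_loc_derivative_square_integrable[OF u]
    by (intro set_integral_add) (auto simp: locally_square_integrable_def)
  have "AE x in lebesgue. ((u x)\<^sup>2 + (Dv u x)\<^sup>2) + Dv (\<lambda>x. u x * u x) x = (?v x)\<^sup>2"
    using H1_loc_mult(2)[OF u u] by eventually_elim (simp add: power2_eq_square algebra_simps)
  from set_integral_cong_AE_interval(1)[OF set_integral_add(1)[OF i4 H1_loc_derivative_integrable[OF uu]] this]
  have v2: "(LINT x:I|lebesgue. (?v x)\<^sup>2) = (LINT x:I|lebesgue. (u x)\<^sup>2 + (Dv u x)\<^sup>2)"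
    using set_integral_add(2)[OF i4 H1_loc_derivative_integrable[OF uu]] H1_loc_integral_derivative[OF uu, of b "b + l"] l uper
    by simp
  show ?thesis using main unfolding om v1 v2 .
qed

end

section \<open>Uniqueness for the initial value problem\<close>

lemma Cauchy_Schwarz_set_integral:
  fixes f g :: "real \<Rightarrow> real"
  assumes f: "locally_square_integrable f" and g: "locally_square_integrable g"
  shows "(LINT x:{a..b}|lebesgue. f x * g x)\<^sup>2 \<le>
    (LINT x:{a..b}|lebesgue. (f x)\<^sup>2) * (LINT x:{a..b}|lebesgue. (g x)\<^sup>2)"
  unfolding integral_lebesgue_on_interval(1)[symmetric]
proof (rule Cauchy_Schwarz_integral(2))
  show "f \<in> borel_measurable (lebesgue_on {a..b})" "g \<in> borel_measurable (lebesgue_on {a..b})"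
    using f g by (auto intro!: measurable_restrict_space1 locally_square_integrable_measurable)
  show "integrable (lebesgue_on {a..b}) (\<lambda>x. (f x)\<^sup>2)" "integrable (lebesgue_on {a..b}) (\<lambda>x. (g x)\<^sup>2)"
    using f g unfolding integral_lebesgue_on_interval(2) by (simp_all add: locally_square_integrable_def)
qed

lemma locally_square_integrable_norm:
  fixes f :: "real \<Rightarrow> 'a::euclidean_space"
  shows "locally_square_integrable f \<Longrightarrow> locally_square_integrable (\<lambda>x. norm (f x))"
  unfolding locally_square_integrable_def by auto

lemma set_integral_mono_interval:
  fixes g :: "real \<Rightarrow> real"
  assumes "set_integrable M B g" "A \<subseteq> B" "A \<in> sets M" "\<And>x. g x \<ge> 0"
  shows "(LINT x:A|M. g x) \<le> (LINT x:B|M. g x)"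
proof -
  have "set_integrable M A g" using assms(1,3,2) by (rule set_integrable_subset)
  then show ?thesis
    using assms unfolding set_lebesgue_integral_def set_integrable_def
    by (intro integral_mono) (auto simp: indicator_def)
qed

context solution
begin

text \<open>Green's formula with test function 1. Together with f' = f1 + z u' f it is the
  first-order system for (f, f1), in which \<open>f1\<close> may jump at atoms of
  \<upsilon>.\<close>

lemma quasi_derivative_increment:
  assumes "c \<le> d"
  shows "f1 d - f1 c = (LINT x:{c..d}|lebesgue. \<Phi> (\<lambda>x. 1) x) - z\<^sup>2 * (LINT x:{c..<d}|\<upsilon>. f x)"
  using weak_form[OF H1_loc_const[of "1::complex"] assms] by simp

lemma Phi_1: "\<Phi> (\<lambda>x. 1) x = 1 / 4 * f x - z * (u x *\<^sub>R f x + Dv u x *\<^sub>R Dv f x)"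
  by (simp add: \<Phi>_def)

text \<open>A contraction estimate for n, the L^2 norm of f' on a short interval. From f(c) = 0 one
  gets |f| \<le> sqrt(\<delta>) n, the increment formula gives |f1| \<le> C n, and f' = f1 + z u' f
  returns n^2 \<le> n^2 \<delta> (2 C^2 + 2 |z|^2 U2), so n = 0 by \<open>small\<close>. The
  coefficients are measured on the large interval {-L..L}, which makes \<open>\<delta>\<close> the
  same at every restart.\<close>

lemma vanish_local:
  assumes pq: "q - p \<le> \<delta>" "\<delta> \<le> 1" "{p..q} \<subseteq> {-L..L}" and c: "c \<in> {p..q}" "f c = 0" "f1 c = 0"
    and U1: "U1 = (LINT x:{-L..L}|lebesgue. \<bar>u x\<bar>)" and U2: "U2 = (LINT x:{-L..L}|lebesgue. (Dv u x)\<^sup>2)"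
    and V: "V = measure \<upsilon> {-L..L}"
    and C: "C = 1 / 4 + cmod z * U1 + cmod z * sqrt U2 + (cmod z)\<^sup>2 * V"
    and small: "\<delta> * (2 * C\<^sup>2 + 2 * (cmod z)\<^sup>2 * U2) < 1"
    and x: "x \<in> {p..q}"
  shows "f x = 0 \<and> f1 x = 0"
proof -
  let ?J = "{p..q}"
  define N where "N = (LINT x:?J|lebesgue. (norm (Dv f x))\<^sup>2)"
  define n where "n = sqrt N"
  \<comment> \<open>The bound for |f| that Cauchy-Schwarz gives on an interval of length at most
    \<open>\<delta>\<close> containing the zero \<open>c\<close>.\<close>
  define m where "m = sqrt (\<delta> * N)"
  have pq': "p \<le> q" and d0: "\<delta> \<ge> 0" using c pq by auto
  have "N \<ge> 0" unfolding N_def set_lebesgue_integral_def by (rule integral_nonneg_AE) auto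
  then have n0: "n \<ge> 0" and nN: "n\<^sup>2 = N" and m0: "m \<ge> 0" and mN: "m\<^sup>2 = \<delta> * N"
    using d0 by (auto simp: n_def m_def)
  have mn: "m \<le> n" unfolding m_def n_def using \<open>N \<ge> 0\<close> pq d0 by (simp add: mult_left_le_one_le)
  have lu: "locally_square_integrable u" "locally_square_integrable (Dv u)"
    and lf: "locally_square_integrable f" "locally_square_integrable (Dv f)"
    using u f by (auto intro: H1_loc_square_integrable H1_loc_derivative_square_integrable)
  have l1: "locally_square_integrable (\<lambda>x. 1::real)" by (rule locally_square_integrable_continuous) simp
  note nDf = locally_square_integrable_norm[OF lf(2)] and nDu = locally_square_integrable_norm[OF lu(2)]
  have i_Df: "set_integrable lebesgue {r..t} (\<lambda>x. norm (Dv f x))" for r t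
    using lsi_mult[OF nDf l1] by simp
  have i_u: "set_integrable lebesgue {r..t} (\<lambda>x. \<bar>u x\<bar>)" for r t
    using lsi_mult[OF locally_square_integrable_norm[OF lu(1)] l1] by simp
  have i_Du2: "set_integrable lebesgue {r..t} (\<lambda>x. (Dv u x)\<^sup>2)" for r t
    using lu(2) by (simp add: locally_square_integrable_def)
  have i_Df2: "set_integrable lebesgue {r..t} (\<lambda>x. (norm (Dv f x))\<^sup>2)" for r t
    using lf(2) by (simp add: locally_square_integrable_def)
  have i_DuDf: "set_integrable lebesgue {r..t} (\<lambda>x. \<bar>Dv u x\<bar> * norm (Dv f x))" for r t
    using lsi_mult[OF nDu nDf] by simp
  have "U1 \<ge> 0" "U2 \<ge> 0" unfolding U1 U2 set_lebesgue_integral_def by (rule integral_nonneg_AE, auto)+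
  have U1J: "(LINT x:?J|lebesgue. \<bar>u x\<bar>) \<le> U1" unfolding U1
    by (rule set_integral_mono_interval[OF i_u pq(3)]) auto
  have U2J: "(LINT x:?J|lebesgue. (Dv u x)\<^sup>2) \<le> U2" unfolding U2
    by (rule set_integral_mono_interval[OF i_Du2 pq(3)]) auto
  have finV: "emeasure \<upsilon> {-L..L} \<noteq> \<infinity>" using fin_\<upsilon>[of "{-L..L}"] by simp
  have fb: "norm (f y) \<le> m" if y: "y \<in> ?J" for y
  proof -
    define p' q' where "p' = min c y" and "q' = max c y"
    have p'q': "p' \<le> q'" "{p'..q'} \<subseteq> ?J" using y c by (auto simp: p'_def q'_def)
    have "norm (f y) = norm (f q' - f p')"
      using c(2) by (auto simp: p'_def q'_def min_def max_def norm_minus_commute)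
    also have "\<dots> = norm (LINT x:{p'..q'}|lebesgue. Dv f x)"
      using H1_loc_integral_derivative[OF f p'q'(1)] by simp
    also have "\<dots> \<le> (LINT x:{p'..q'}|lebesgue. norm (Dv f x))"
      by (rule set_integral_norm_bound[OF H1_loc_derivative_integrable[OF f]])
    also have "\<dots> \<le> (LINT x:?J|lebesgue. norm (Dv f x))"
      by (rule set_integral_mono_interval[OF i_Df p'q'(2)]) auto
    also have "\<dots> \<le> m"
    proof (rule power2_le_imp_le)
      have "(LINT x:?J|lebesgue. norm (Dv f x))\<^sup>2 \<le> N * (q - p)"
        using Cauchy_Schwarz_set_integral[OF nDf l1, of p q] pq' by (simp add: N_def set_lebesgue_integral_def)
      also have "\<dots> \<le> m\<^sup>2"
        unfolding mN using pq(1) \<open>N \<ge> 0\<close> by (simp add: mult.commute mult_left_mono)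
      finally show "(LINT x:?J|lebesgue. norm (Dv f x))\<^sup>2 \<le> m\<^sup>2" .
    qed (use m0 in auto)
    finally show ?thesis .
  qed
  \<comment> \<open>No smallness is sought here, and \<open>m\<close> is relaxed to
    \<open>n\<close>: the mass of an atom of \<upsilon> does not shrink with the interval. The
    factor \<open>\<delta>\<close> for this term is gained below, when the bound is squared and
    integrated.\<close>
  have f1b: "norm (f1 y) \<le> n * C" if y: "y \<in> ?J" for y
  proof -
    define p' q' where "p' = min c y" and "q' = max c y"
    have p'q': "p' \<le> q'" "{p'..q'} \<subseteq> ?J" using y c by (auto simp: p'_def q'_def)
    have i_bd: "set_integrable lebesgue {r..t} (\<lambda>x. m * (1 / 4) + m * (cmod z * \<bar>u x\<bar>) + cmod z * (\<bar>Dv u x\<bar> * norm (Dv f x)))" for r t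
      using lsi_mult[OF l1 l1, of r t] i_u i_DuDf by (intro set_integral_add(1) set_integrable_mult_right) auto
    have "norm (f1 y) = norm (f1 q' - f1 p')"
      using c(3) by (auto simp: p'_def q'_def min_def max_def norm_minus_commute)
    also have "\<dots> \<le> norm (LINT x:{p'..q'}|lebesgue. \<Phi> (\<lambda>x. 1) x) + (cmod z)\<^sup>2 * norm (LINT x:{p'..<q'}|\<upsilon>. f x)"
      unfolding quasi_derivative_increment[OF p'q'(1)]
      by (rule order_trans[OF norm_triangle_ineq4]) (simp add: norm_mult norm_power)
    also have "\<dots> \<le> n * (1 / 4 + cmod z * U1 + cmod z * sqrt U2) + (cmod z)\<^sup>2 * (n * V)"
    proof (intro add_mono mult_left_mono)
      show "norm (LINT x:{p'..q'}|lebesgue. \<Phi> (\<lambda>x. 1) x) \<le> n * (1 / 4 + cmod z * U1 + cmod z * sqrt U2)"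
      proof -
        have "norm (LINT x:{p'..q'}|lebesgue. \<Phi> (\<lambda>x. 1) x) \<le> (LINT x:{p'..q'}|lebesgue. norm (\<Phi> (\<lambda>x. 1) x))"
          by (rule set_integral_norm_bound[OF \<Phi>_integrable[OF H1_loc_const]])
        also have "\<dots> \<le> (LINT x:{p'..q'}|lebesgue. m * (1 / 4) + m * (cmod z * \<bar>u x\<bar>) + cmod z * (\<bar>Dv u x\<bar> * norm (Dv f x)))"
        proof (rule set_integral_mono[OF set_integrable_norm[OF \<Phi>_integrable[OF H1_loc_const]] i_bd])
          fix y assume "y \<in> {p'..q'}"
          then have fm: "norm (f y) \<le> m" using fb p'q'(2) by blast
          have "norm (\<Phi> (\<lambda>x. 1) y) \<le> norm (1 / 4 * f y) + norm (z * (u y *\<^sub>R f y + Dv u y *\<^sub>R Dv f y))"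
            unfolding Phi_1 by (rule norm_triangle_ineq4)
          also have "\<dots> \<le> 1 / 4 * norm (f y) + cmod z * (\<bar>u y\<bar> * norm (f y) + \<bar>Dv u y\<bar> * norm (Dv f y))"
            by (auto simp: norm_mult intro!: mult_left_mono order_trans[OF norm_triangle_ineq])
          also have "\<dots> \<le> 1 / 4 * m + cmod z * (\<bar>u y\<bar> * m + \<bar>Dv u y\<bar> * norm (Dv f y))"
            using fm by (intro add_mono mult_left_mono) auto
          finally show "norm (\<Phi> (\<lambda>x. 1) y) \<le> m * (1 / 4) + m * (cmod z * \<bar>u y\<bar>) + cmod z * (\<bar>Dv u y\<bar> * norm (Dv f y))"
            by (simp add: algebra_simps)
        qed
        also have "\<dots> \<le> (LINT x:?J|lebesgue. m * (1 / 4) + m * (cmod z * \<bar>u x\<bar>) + cmod z * (\<bar>Dv u x\<bar> * norm (Dv f x)))"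
          using m0 by (intro set_integral_mono_interval[OF i_bd p'q'(2)]) auto
        also have "\<dots> = m * (1 / 4) * (q - p) + m * (cmod z * (LINT x:?J|lebesgue. \<bar>u x\<bar>)) + cmod z * (LINT x:?J|lebesgue. \<bar>Dv u x\<bar> * norm (Dv f x))"
        proof -
          have "set_integrable lebesgue ?J (\<lambda>x. m * (1 / 4))" "(LINT x:?J|lebesgue. m * (1 / 4)) = m * (1 / 4) * (q - p)"
            using lsi_mult[OF l1 l1, of p q] pq' by (auto simp: set_lebesgue_integral_def set_integrable_def)
          then show ?thesis
            using i_u i_DuDf by (simp add: set_integral_add)
        qed
        also have "\<dots> \<le> n * (1 / 4) + n * (cmod z * U1) + cmod z * (sqrt U2 * n)"
        proof (intro add_mono)
          show "m * (1 / 4) * (q - p) \<le> n * (1 / 4)"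
            using mult_mono[of "m * (1/4)" "n * (1/4)" "q - p" 1] mn pq pq' n0 by simp
          have "(LINT x:?J|lebesgue. \<bar>Dv u x\<bar> * norm (Dv f x)) \<le> sqrt U2 * n"
          proof (rule power2_le_imp_le)
            have "(LINT x:?J|lebesgue. \<bar>Dv u x\<bar> * norm (Dv f x))\<^sup>2 \<le> (LINT x:?J|lebesgue. (Dv u x)\<^sup>2) * N"
              using Cauchy_Schwarz_set_integral[OF nDu nDf, of p q] by (simp add: N_def)
            also have "\<dots> \<le> U2 * N" using U2J \<open>N \<ge> 0\<close> by (rule mult_right_mono)
            finally show "(LINT x:?J|lebesgue. \<bar>Dv u x\<bar> * norm (Dv f x))\<^sup>2 \<le> (sqrt U2 * n)\<^sup>2"
              using \<open>U2 \<ge> 0\<close> by (simp add: power_mult_distrib nN)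
          qed (use n0 \<open>U2 \<ge> 0\<close> in auto)
          then show "cmod z * (LINT x:?J|lebesgue. \<bar>Dv u x\<bar> * norm (Dv f x)) \<le> cmod z * (sqrt U2 * n)"
            by (rule mult_left_mono) simp
          have "0 \<le> (LINT x:?J|lebesgue. \<bar>u x\<bar>)"
            unfolding set_lebesgue_integral_def by (intro integral_nonneg_AE) auto
          then show "m * (cmod z * (LINT x:?J|lebesgue. \<bar>u x\<bar>)) \<le> n * (cmod z * U1)"
            using mn n0 U1J by (intro mult_mono mult_left_mono) auto
        qed
        finally show ?thesis by (simp add: algebra_simps)
      qed
      show "norm (LINT x:{p'..<q'}|\<upsilon>. f x) \<le> n * V"
      proof -
        have sub: "{p'..<q'} \<subseteq> {p'..q'}" "{p'..<q'} \<subseteq> {-L..L}" using p'q' pq(3) by auto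
        have fin: "emeasure \<upsilon> {p'..<q'} < \<infinity>"
          using emeasure_mono[OF sub(1), of \<upsilon>] fin_\<upsilon>[of "{p'..q'}"] sets_\<upsilon> by (simp add: le_less_trans)
        have i_f: "set_integrable \<upsilon> {p'..<q'} f"
          by (rule set_integrable_subset[OF continuous_set_integrable_locally_finite[OF sets_\<upsilon> fin_\<upsilon> H1_loc_continuous[OF f]] _ sub(1)])
             (use sets_\<upsilon> in auto)
        have i_c: "set_integrable \<upsilon> {p'..<q'} (\<lambda>x. n)"
          unfolding set_integrable_def using fin sets_\<upsilon> by (intro integrable_indicator) auto
        have "norm (LINT x:{p'..<q'}|\<upsilon>. f x) \<le> (LINT x:{p'..<q'}|\<upsilon>. norm (f x))"
          by (rule set_integral_norm_bound[OF i_f])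
        also have "\<dots> \<le> (LINT x:{p'..<q'}|\<upsilon>. n)"
        proof (rule set_integral_mono[OF set_integrable_norm[OF i_f] i_c])
          fix y assume "y \<in> {p'..<q'}"
          then have "y \<in> ?J" using p'q'(2) sub(1) by blast
          then show "norm (f y) \<le> n" using fb[of y] mn by linarith
        qed
        also have "\<dots> = n * measure \<upsilon> {p'..<q'}"
          unfolding set_lebesgue_integral_def using fin sets_\<upsilon> by simp
        also have "\<dots> \<le> n * V"
          unfolding V using n0 finV sub sets_\<upsilon> by (intro mult_left_mono measure_mono_fmeasurable) (auto simp: fmeasurable_def top.not_eq_extremum)
        finally show ?thesis .
      qed
    qed simp
    finally show ?thesis by (simp add: C algebra_simps)
  qed
  \<comment> \<open>The loop closes through f' = f1 + z u' f almost everywhere: the first summand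
    gains \<open>\<delta>\<close> from the length of the interval, the second from m^2 = \<delta>
    N.\<close>
  have "N \<le> (LINT x:?J|lebesgue. 2 * (n * C)\<^sup>2 + 2 * (cmod z)\<^sup>2 * m\<^sup>2 * (Dv u x)\<^sup>2)"
    unfolding N_def
  proof (rule set_integral_mono_AE[OF i_Df2])
    show "set_integrable lebesgue ?J (\<lambda>x. 2 * (n * C)\<^sup>2 + 2 * (cmod z)\<^sup>2 * m\<^sup>2 * (Dv u x)\<^sup>2)"
      using lsi_mult[OF l1 l1, of p q] i_Du2[of p q] by (intro set_integral_add(1) set_integrable_mult_right) (auto simp: set_integrable_def)
    show "AE y\<in>?J in lebesgue. (norm (Dv f y))\<^sup>2 \<le> 2 * (n * C)\<^sup>2 + 2 * (cmod z)\<^sup>2 * m\<^sup>2 * (Dv u y)\<^sup>2"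
      using conjunct2[OF qd[unfolded is_quasi_derivative_def]]
    proof eventually_elim
      case (elim y)
      show ?case
      proof
        assume y: "y \<in> ?J"
        have "norm (Dv f y) = norm (f1 y + z * complex_of_real (Dv u y) * f y)" using elim by simp
        also have "\<dots> \<le> n * C + cmod z * \<bar>Dv u y\<bar> * m"
          using f1b[OF y] fb[OF y] by (intro norm_triangle_le add_mono) (auto simp: norm_mult intro!: mult_left_mono)
        finally have "(norm (Dv f y))\<^sup>2 \<le> (n * C + cmod z * \<bar>Dv u y\<bar> * m)\<^sup>2" by (intro power_mono) auto
        also have "\<dots> \<le> 2 * (n * C)\<^sup>2 + 2 * (cmod z * \<bar>Dv u y\<bar> * m)\<^sup>2"
          using sum_squares_bound[of "n * C" "cmod z * \<bar>Dv u y\<bar> * m"] by (simp add: power2_sum)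
        finally show "(norm (Dv f y))\<^sup>2 \<le> 2 * (n * C)\<^sup>2 + 2 * (cmod z)\<^sup>2 * m\<^sup>2 * (Dv u y)\<^sup>2"
          by (simp add: power_mult_distrib algebra_simps)
      qed
    qed
  qed
  also have "\<dots> = 2 * (n * C)\<^sup>2 * (q - p) + 2 * (cmod z)\<^sup>2 * m\<^sup>2 * (LINT x:?J|lebesgue. (Dv u x)\<^sup>2)"
  proof -
    have "set_integrable lebesgue ?J (\<lambda>x. 2 * (n * C)\<^sup>2)" "(LINT x:?J|lebesgue. 2 * (n * C)\<^sup>2) = 2 * (n * C)\<^sup>2 * (q - p)"
      using lsi_mult[OF l1 l1, of p q] pq' by (auto simp: set_lebesgue_integral_def set_integrable_def)
    then show ?thesis using i_Du2[of p q] by (simp add: set_integral_add)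
  qed
  also have "\<dots> \<le> 2 * (n * C)\<^sup>2 * \<delta> + 2 * (cmod z)\<^sup>2 * m\<^sup>2 * U2"
    using pq(1) U2J by (intro add_mono mult_left_mono) auto
  also have "\<dots> = N * (\<delta> * (2 * C\<^sup>2 + 2 * (cmod z)\<^sup>2 * U2))"
    by (simp add: power_mult_distrib nN mN algebra_simps)
  finally have "N * (1 - \<delta> * (2 * C\<^sup>2 + 2 * (cmod z)\<^sup>2 * U2)) \<le> 0" by (simp add: algebra_simps)
  then have "N = 0" using small \<open>N \<ge> 0\<close> by (simp add: mult_le_0_iff)
  then have "m = 0" "n = 0" by (simp_all add: m_def n_def)
  then show ?thesis using fb[OF x] f1b[OF x] by simp
qed

text \<open>Vanishing spreads from \<open>c\<close> to both sides in steps of fixed length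
  \<open>\<delta>\<close>. The induction carries \<open>f\<close> and \<open>f1\<close> together,
  since each restart needs both initial values.\<close>

lemma vanish_everywhere:
  assumes c: "f c = 0" "f1 c = 0"
  shows "f x = 0"
proof -
  define L where "L = \<bar>c\<bar> + \<bar>x\<bar>"
  define U1 where "U1 = (LINT x:{-L..L}|lebesgue. \<bar>u x\<bar>)"
  define U2 where "U2 = (LINT x:{-L..L}|lebesgue. (Dv u x)\<^sup>2)"
  define V where "V = measure \<upsilon> {-L..L}"
  define C where "C = 1 / 4 + cmod z * U1 + cmod z * sqrt U2 + (cmod z)\<^sup>2 * V"
  define Q where "Q = 2 * C\<^sup>2 + 2 * (cmod z)\<^sup>2 * U2"
  \<comment> \<open>Chosen so that \<delta> \<le> 1 and \<delta> Q = Q / (Q + 1) < 1.\<close>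
  define \<delta> where "\<delta> = 1 / (Q + 1)"
  have "U2 \<ge> 0" unfolding U2_def set_lebesgue_integral_def by (rule integral_nonneg_AE) auto
  then have "Q \<ge> 0" by (simp add: Q_def)
  then have \<delta>: "0 < \<delta>" "\<delta> \<le> 1" "\<delta> * Q < 1" by (auto simp: \<delta>_def)
  have "\<forall>y. \<bar>y - c\<bar> \<le> real k * \<delta> \<and> \<bar>y\<bar> \<le> L \<longrightarrow> f y = 0 \<and> f1 y = 0" for k
  proof (induction k)
    case 0
    then show ?case using c by auto
  next
    case (Suc k)
    show ?case
    proof (intro allI impI)
      fix y assume y: "\<bar>y - c\<bar> \<le> real (Suc k) * \<delta> \<and> \<bar>y\<bar> \<le> L"
      \<comment> \<open>One step back from \<open>y\<close> towards \<open>c\<close>, stopping at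
        \<open>c\<close>: the induction hypothesis covers \<open>w\<close>, and a single local step
        leads from there to \<open>y\<close>.\<close>
      define w where "w = (if y \<ge> c then max c (y - \<delta>) else min c (y + \<delta>))"
      have yk: "\<bar>y - c\<bar> \<le> real k * \<delta> + \<delta>" using y by (simp add: algebra_simps)
      have "0 \<le> real k * \<delta>" using \<delta> by simp
      have cL: "\<bar>c\<bar> \<le> L" by (simp add: L_def)
      have w: "\<bar>w - c\<bar> \<le> real k * \<delta>" "\<bar>w\<bar> \<le> L" "\<bar>y - w\<bar> \<le> \<delta>"
        using yk y cL \<delta>(1) \<open>0 \<le> real k * \<delta>\<close> by (auto simp: w_def max_def min_def split: if_splits)
      then have "f w = 0" "f1 w = 0" using Suc by auto
      then show "f y = 0 \<and> f1 y = 0"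
        by (intro vanish_local[of "max w y" "min w y" \<delta> L w U1 U2 V C])
           (use w y \<delta> in \<open>auto simp: U1_def U2_def V_def C_def Q_def\<close>)
    qed
  qed
  moreover obtain k :: nat where "\<bar>x - c\<bar> \<le> real k * \<delta>"
    using reals_Archimedean3[OF \<delta>(1)] by (metis less_imp_le)
  ultimately show ?thesis by (auto simp: L_def)
qed

end

section \<open>Eigenvalues\<close>

text \<open>If Im z were non-zero, the imaginary part would force \<omega> = -2 (Re z) W, and the
  real part would become X = -|z|^2 W \<le> 0.\<close>

lemma real_of_quadratic_form:
  fixes z :: complex and X W \<omega> :: real
  assumes eq: "of_real X = z * of_real \<omega> + z\<^sup>2 * of_real W" and X: "X > 0" and W: "W \<ge> 0"
  shows "z \<in> \<real>" "z \<noteq> 0"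
proof -
  show "z \<noteq> 0" using eq X by auto
  have re: "X = Re z * \<omega> + ((Re z)\<^sup>2 - (Im z)\<^sup>2) * W" and im: "0 = Im z * (\<omega> + 2 * Re z * W)"
    using arg_cong[OF eq, of Re] arg_cong[OF eq, of Im] by (simp_all add: power2_eq_square algebra_simps)
  have "Im z = 0"
  proof (rule ccontr)
    assume "Im z \<noteq> 0"
    then have "\<omega> = - 2 * Re z * W" using im by auto
    then have "X = - (((Re z)\<^sup>2 + (Im z)\<^sup>2) * W)" using re by (simp add: power2_eq_square algebra_simps)
    also have "\<dots> \<le> 0" using W by simp
    finally show False using X by simp
  qed
  then show "z \<in> \<real>" by (simp add: complex_is_Real_iff)
qed

text \<open>Square X - t^2 W = t \<omega> and drop the nonnegative term t^4 W^2. What is left is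
  linear in W, and the mixed term of the square is the origin of the factor 2 before
  \<open>Q2\<close>.\<close>

lemma eigenvalue_bound_of_quadratic_form:
  fixes t X W \<omega> P2 Q2 :: real
  assumes eq: "X = t * \<omega> + t\<^sup>2 * W" and X: "X > 0" and t: "t \<noteq> 0"
    and om: "\<omega>\<^sup>2 \<le> X\<^sup>2 * P2" and W: "W \<le> Q2 * X"
  shows "1 / t\<^sup>2 \<le> P2 + 2 * Q2"
proof -
  have "X\<^sup>2 - 2 * X * (t\<^sup>2 * W) \<le> (X - t\<^sup>2 * W)\<^sup>2"
    by (simp add: power2_diff)
  also have "X - t\<^sup>2 * W = t * \<omega>" using eq by simp
  also have "(t * \<omega>)\<^sup>2 \<le> t\<^sup>2 * (X\<^sup>2 * P2)"
    unfolding power_mult_distrib using om by (rule mult_left_mono) simp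
  finally have "X\<^sup>2 \<le> t\<^sup>2 * (X\<^sup>2 * P2) + 2 * X * (t\<^sup>2 * W)" by simp
  also have "2 * X * (t\<^sup>2 * W) \<le> 2 * X * (t\<^sup>2 * (Q2 * X))"
    using W X by (intro mult_left_mono) auto
  finally have "X\<^sup>2 * 1 \<le> X\<^sup>2 * (t\<^sup>2 * (P2 + 2 * Q2))" by (simp add: power2_eq_square algebra_simps)
  then have "1 \<le> t\<^sup>2 * (P2 + 2 * Q2)" using X by (simp only: mult_le_cancel_left_pos zero_less_power)
  then show ?thesis using t by (simp add: field_simps)
qed

text \<open>Split \<open>m a (b + l)\<close> once at \<open>a + l\<close> and once at
  \<open>b\<close>; the pieces \<open>m (a + l) (b + l)\<close> and \<open>m a b\<close> agree by
  periodicity. It serves both the measure \<mu> and the integral of u.\<close>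

lemma additive_periodic_interval_function:
  fixes m :: "real \<Rightarrow> real \<Rightarrow> real"
  assumes add: "\<And>c d e. c \<le> d \<Longrightarrow> d \<le> e \<Longrightarrow> m c e = m c d + m d e"
    and per: "\<And>c d. c \<le> d \<Longrightarrow> m (c + l) (d + l) = m c d" and l: "l \<ge> 0"
  shows "m a (a + l) = m b (b + l)"
proof -
  have "m a (a + l) = m b (b + l)" if "a \<le> b" for a b
    using add[of a "a + l" "b + l"] add[of a b "b + l"] per[OF that] that l by simp
  then show ?thesis by (metis linear)
qed

lemma periodic_measure_interval:
  assumes M: "periodic_borel_measure l M" and l: "l > 0"
  shows "measure M {a..<a + l} = measure M {b..<b + l}"
proof (rule additive_periodic_interval_function[where m = "\<lambda>c d. measure M {c..<d}"])
  have sets: "sets M = sets borel" using M by (simp add: periodic_borel_measure_def)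
  have fin: "{c..<d} \<in> fmeasurable M" for c d
  proof -
    have "emeasure M {c..<d} \<le> emeasure M {c..d}" by (rule emeasure_mono) (auto simp: sets)
    also have "\<dots> < \<infinity>" using M by (simp add: periodic_borel_measure_def)
    finally show ?thesis by (auto simp: fmeasurable_def sets)
  qed
  show "measure M {c..<e} = measure M {c..<d} + measure M {d..<e}" if "c \<le> d" "d \<le> e" for c d e
  proof -
    have "{c..<e} = {c..<d} \<union> {d..<e}" using that by auto
    then show ?thesis
      using fin[of c d] fin[of d e] measure_Union[of M "{c..<d}" "{d..<e}"] by (auto simp: fmeasurable_def)
  qed
  fix c d :: real
  have "(\<lambda>x. x + l) ` {c..<d} = {c + l..<d + l}" by (rule image_add_atLeastLessThan')
  then show "measure M {c + l..<d + l} = measure M {c..<d}"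
    using M unfolding periodic_borel_measure_def measure_def by (metis atLeastLessThan_borel)
qed (use l in simp)

lemma periodic_integral_interval:
  fixes u :: "real \<Rightarrow> real"
  assumes u: "continuous_on UNIV u" "periodic_fun_with l u" and l: "l > 0"
  shows "(LINT x:{a..a + l}|lebesgue. u x) = (LINT x:{b..b + l}|lebesgue. u x)"
proof (rule additive_periodic_interval_function[where m = "\<lambda>c d. LINT x:{c..d}|lebesgue. u x"])
  have ui: "u integrable_on {c..d}" for c d
    using u(1) by (intro integrable_continuous_real) (auto intro: continuous_on_subset)
  have eq: "(LINT x:{c..d}|lebesgue. u x) = integral {c..d} u" for c d
    using lsi_mult[OF locally_square_integrable_continuous[OF continuous_on_const[of _ "1::real"]]
        locally_square_integrable_continuous[OF u(1)], of c d]
    by (intro set_lebesgue_integral_eq_integral(2)) simp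
  show "(LINT x:{c..e}|lebesgue. u x) = (LINT x:{c..d}|lebesgue. u x) + (LINT x:{d..e}|lebesgue. u x)"
    if "c \<le> d" "d \<le> e" for c d e
    unfolding eq using Henstock_Kurzweil_Integration.integral_combine[OF that ui] by simp
  show "(LINT x:{c + l..d + l}|lebesgue. u x) = (LINT x:{c..d}|lebesgue. u x)" for c d
  proof -
    have "u \<circ> (+) l = u" using u(2) by (auto simp: periodic_fun_with_def add.commute)
    then show ?thesis unfolding eq using integral_shift_Icc_real[of c d u l] by simp
  qed
qed (use l in simp)

section \<open>Eigenfunctions on one period\<close>

lemma set_integrable_complex_of_real:
  "set_integrable M A (\<lambda>x. complex_of_real (g x)) \<longleftrightarrow> set_integrable M A g"
  unfolding set_integrable_def scaleR_conv_of_real of_real_mult[symmetric] complex_of_real_integrable_eq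
  by simp

locale eigenfunction = solution u \<upsilon> z f f1 for u \<upsilon> z f f1 +
  fixes b l \<epsilon> :: real
  assumes l: "l > 0" and eps: "\<epsilon> = 1 \<or> \<epsilon> = -1" and u_per: "u (b + l) = u b"
    and f_per: "f (b + l) = \<epsilon> *\<^sub>R f b" and f1_per: "f1 (b + l) = \<epsilon> *\<^sub>R f1 b"
    and nontrivial: "\<exists>x. f x \<noteq> 0"
begin

definition s where "s = \<epsilon> * exp (- l / 2)"

sublocale Q: quasiperiodic b l s \<epsilon> f
  by unfold_locales (use l eps f_per f s_def in auto)

text \<open>The half-open period is the one in Green's formula; the closed one would count an atom
  at \<open>b\<close> and its translate at \<open>b + l\<close>.\<close>

definition W where "W = (LINT x:{b..<b + l}|\<upsilon>. f x \<bullet> f x)"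
definition \<omega> where "\<omega> = (LINT x:Q.I|lebesgue. u x * (f x \<bullet> f x) + Dv u x * Dv (\<lambda>x. f x \<bullet> f x) x)"
abbreviation "X \<equiv> Q.X"

text \<open>Green's formula over one period with the conjugate of \<open>f\<close> as test function.
  The boundary terms at the two ends are equal, since \<epsilon>^2 = 1.\<close>

lemma energy_identity: "complex_of_real X = z * of_real \<omega> + z\<^sup>2 * of_real W"
proof -
  define h where "h x = cnj (f x)" for x
  have h: "h \<in> H1_loc" and Dh: "AE x in lebesgue. Dv h x = cnj (Dv f x)"
    unfolding h_def by (rule H1_loc_bounded_linear[OF bounded_linear_cnj f])+
  let ?p = "\<lambda>x. f x \<bullet> f x"
  note p = H1_loc_inner(1)[OF f f]
  have fh: "(\<lambda>x. f x * h x) = (\<lambda>x. complex_of_real (?p x))"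
    unfolding h_def complex_norm_square[symmetric] by (simp only: power2_norm_eq_inner)
  have Dfh: "AE x in lebesgue. Dv (\<lambda>x. f x * h x) x = complex_of_real (Dv ?p x)"
    unfolding fh by (rule H1_loc_bounded_linear(2)[OF bounded_linear_of_real p])
  have i1: "set_integrable lebesgue Q.I (\<lambda>x. (norm (Dv f x))\<^sup>2 + (norm (f x))\<^sup>2 / 4)"
    using H1_loc_derivative_square_integrable[OF f] H1_loc_square_integrable[OF f]
    by (intro set_integral_add set_integrable_divide) (auto simp: locally_square_integrable_def)
  have i2: "set_integrable lebesgue Q.I (\<lambda>x. u x * ?p x + Dv u x * Dv ?p x)"
    by (intro set_integral_add lsi_mult H1_loc_square_integrable H1_loc_derivative_square_integrable u p)
  have j1: "set_integrable lebesgue Q.I (\<lambda>x. complex_of_real ((norm (Dv f x))\<^sup>2 + (norm (f x))\<^sup>2 / 4))"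
    and j2: "set_integrable lebesgue Q.I (\<lambda>x. z * complex_of_real (u x * ?p x + Dv u x * Dv ?p x))"
    using i1 i2 by (auto intro!: set_integrable_mult_right simp only: set_integrable_complex_of_real)
  have "AE x in lebesgue. complex_of_real ((norm (Dv f x))\<^sup>2 + (norm (f x))\<^sup>2 / 4)
      - z * complex_of_real (u x * ?p x + Dv u x * Dv ?p x) = \<Phi> h x"
    using Dh Dfh
  proof eventually_elim
    case (elim x)
    have "f x * h x = complex_of_real (?p x)" using fun_cong[OF fh] .
    moreover have "Dv f x * Dv h x = complex_of_real ((norm (Dv f x))\<^sup>2)"
      unfolding elim by (rule complex_norm_square[symmetric])
    ultimately show ?case
      unfolding \<Phi>_def elim by (simp add: scaleR_conv_of_real power2_norm_eq_inner)
  qed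
  from set_integral_cong_AE_interval(1)[OF set_integral_diff(1)[OF j1 j2] this]
  have "(LINT x:Q.I|lebesgue. \<Phi> h x) = complex_of_real X - z * complex_of_real \<omega>"
    unfolding set_integral_diff(2)[OF j1 j2] \<omega>_def by (simp only: set_integral_mult_right set_integral_complex_of_real)
  moreover have "(LINT x:{b..<b + l}|\<upsilon>. f x * h x) = complex_of_real W"
    unfolding W_def using fun_cong[OF fh] by (simp add: set_integral_complex_of_real)
  moreover have "f1 (b + l) * h (b + l) = f1 b * h b"
    using eps by (auto simp: f1_per f_per h_def)
  ultimately have "complex_of_real X - z * complex_of_real \<omega> - z\<^sup>2 * complex_of_real W = 0"
    using weak_form[OF h, of b "b + l"] l by simp
  then show ?thesis by algebra
qed

text \<open>A solution vanishing on the whole period has zero derivative inside it, so the averages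
  that define \<open>f1\<close> at the right end vanish, and uniqueness makes \<open>f\<close> zero
  everywhere. The right end is used because averages to the left of \<open>b\<close> would leave the
  period.\<close>

lemma nonvanishing: "\<exists>x\<in>Q.I. f x \<noteq> 0"
proof (rule ccontr)
  assume "\<not> (\<exists>x\<in>Q.I. f x \<noteq> 0)"
  then have f0: "f x = 0" if "x \<in> Q.I" for x using that by blast
  let ?\<Psi> = "\<lambda>x. Dv f x - z * (Dv u x *\<^sub>R f x)"
  have D0: "Dv f x = 0" if "x \<in> {b<..<b + l}" for x
  proof -
    have "(f has_vector_derivative 0) (at x)"
      by (rule has_vector_derivative_transform_within_open[OF has_vector_derivative_const[of 0], where S = "{b<..<b + l}"])
         (use that f0 in auto)
    then show ?thesis by (rule vector_derivative_at)
  qed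
  have "set_integrable lebesgue {p..q} ?\<Psi>" for p q
    by (intro set_integral_diff(1) set_integrable_mult_right lsi_scaleR H1_loc_derivative_integrable
        H1_loc_square_integrable H1_loc_derivative_square_integrable f u)
  then have avg: "(\<lambda>k. real (Suc k) *\<^sub>R (LINT x:{b + l - 1 / real (Suc k)..b + l}|lebesgue. ?\<Psi> x)) \<longlonglongrightarrow> f1 (b + l)"
  proof (rule left_average_tendsto)
    show "AE x in lebesgue. f1 x = ?\<Psi> x"
      using conjunct2[OF qd[unfolded is_quasi_derivative_def]]
      by eventually_elim (simp add: scaleR_conv_of_real)
    show "continuous (at_left (b + l)) f1" using qd by (simp add: is_quasi_derivative_def)
  qed
  have "\<forall>\<^sub>F k in sequentially. real (Suc k) *\<^sub>R (LINT x:{b + l - 1 / real (Suc k)..b + l}|lebesgue. ?\<Psi> x) = 0"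
  proof -
    obtain K :: nat where K: "1 / real (Suc K) < l" using l nat_approx_posE by auto
    have "(LINT x:{b + l - 1 / real (Suc k)..b + l}|lebesgue. ?\<Psi> x) = 0" if "k \<ge> K" for k
    proof -
      have "1 / real (Suc k) < l" using K frac_le[of 1 1 "real (Suc K)" "real (Suc k)"] that by simp
      then have sub: "{b + l - 1 / real (Suc k)..b + l} - {b + l} \<subseteq> {b<..<b + l}" by auto
      have "AE x in lebesgue. x \<notin> {b + l}" by (rule AE_completion[OF AE_not_in]) auto
      then have "AE x in lebesgue. indicator {b + l - 1 / real (Suc k)..b + l} x *\<^sub>R ?\<Psi> x = 0"
      proof eventually_elim
        case (elim x)
        then show ?case using sub D0[of x] f0[of x] by (cases "x \<in> {b + l - 1 / real (Suc k)..b + l}") auto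
      qed
      then show ?thesis unfolding set_lebesgue_integral_def by (rule integral_eq_zero_AE)
    qed
    then show ?thesis by (auto simp: eventually_sequentially)
  qed
  from LIMSEQ_unique[OF avg tendsto_eventually[OF this]] have "f1 (b + l) = 0" .
  moreover have "f (b + l) = 0" using f0 l by simp
  ultimately show False using vanish_everywhere nontrivial by blast
qed

lemma s_less: "s < 1" "s\<^sup>2 < 1"
  using Q.s_less l by auto

lemma gamma_pos: "Q.\<gamma> > 0"
  using s_less by simp

text \<open>The pointwise bound by \<gamma> X, read at a point where \<open>f\<close> is non-zero,
  forces positivity.\<close>

lemma X_pos: "X > 0"
proof -
  obtain x where x: "x \<in> Q.I" "f x \<noteq> 0" using nonvanishing by blast
  have "0 < (norm (f x))\<^sup>2" using x by simp
  also have "\<dots> \<le> Q.\<gamma> * X" by (rule Q.norm_square_bound[OF x(1)])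
  finally show ?thesis using gamma_pos zero_less_mult_pos by blast
qed

lemma W_bounds: "0 \<le> W" "W \<le> (Q.\<gamma> * measure \<upsilon> {b..<b + l}) * X"
proof -
  show "0 \<le> W" unfolding W_def set_lebesgue_integral_def by (rule integral_nonneg_AE) auto
  have sub: "{b..<b + l} \<subseteq> Q.I" by auto
  have fin: "emeasure \<upsilon> {b..<b + l} < \<infinity>"
    using emeasure_mono[OF sub, of \<upsilon>] fin_\<upsilon>[of Q.I] sets_\<upsilon> by (simp add: le_less_trans)
  have i_f: "set_integrable \<upsilon> {b..<b + l} (\<lambda>x. f x \<bullet> f x)"
    by (rule set_integrable_subset[OF continuous_set_integrable_locally_finite[OF sets_\<upsilon> fin_\<upsilon>
          H1_loc_continuous[OF H1_loc_inner(1)[OF f f]]] _ sub]) (use sets_\<upsilon> in auto)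
  have i_c: "set_integrable \<upsilon> {b..<b + l} (\<lambda>x. Q.\<gamma> * X)"
    unfolding set_integrable_def using fin sets_\<upsilon> by (intro integrable_indicator) auto
  have "W \<le> (LINT x:{b..<b + l}|\<upsilon>. Q.\<gamma> * X)"
    unfolding W_def
  proof (rule set_integral_mono[OF i_f i_c])
    fix x assume "x \<in> {b..<b + l}"
    then show "f x \<bullet> f x \<le> Q.\<gamma> * X" using Q.norm_square_bound[of x] by (simp add: power2_norm_eq_inner)
  qed
  also have "\<dots> = (Q.\<gamma> * X) * measure \<upsilon> {b..<b + l}"
    unfolding set_lebesgue_integral_def using fin sets_\<upsilon> by simp
  finally show "W \<le> (Q.\<gamma> * measure \<upsilon> {b..<b + l}) * X" by (simp only: mult_ac)
qed

theorem eigenvalue_bound: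
  "z \<in> \<real>" "z \<noteq> 0"
  "1 / (Re z)\<^sup>2 \<le> 2 * s / (1 - s)\<^sup>2 * (LINT x:Q.I|lebesgue. u x)\<^sup>2
    + 2 * Q.\<gamma> * ((LINT x:Q.I|lebesgue. (u x)\<^sup>2 + (Dv u x)\<^sup>2) + measure \<upsilon> {b..<b + l})"
proof -
  show z: "z \<in> \<real>" "z \<noteq> 0"
    using real_of_quadratic_form[OF energy_identity X_pos W_bounds(1)] by auto
  then have zR: "z = complex_of_real (Re z)" and R0: "Re z \<noteq> 0" by (auto elim!: Reals_cases)
  have "complex_of_real X = complex_of_real (Re z * \<omega> + (Re z)\<^sup>2 * W)"
    using energy_identity by (subst (asm) (1 2) zR) simp
  then have "X = Re z * \<omega> + (Re z)\<^sup>2 * W" by (simp only: of_real_eq_iff)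
  from eigenvalue_bound_of_quadratic_form[OF this X_pos R0 Q.omega_bound[OF u u_per, folded \<omega>_def] W_bounds(2)]
  show "1 / (Re z)\<^sup>2 \<le> 2 * s / (1 - s)\<^sup>2 * (LINT x:Q.I|lebesgue. u x)\<^sup>2
    + 2 * Q.\<gamma> * ((LINT x:Q.I|lebesgue. (u x)\<^sup>2 + (Dv u x)\<^sup>2) + measure \<upsilon> {b..<b + l})"
    by (simp add: algebra_simps)
qed

end

section \<open>From one period to the spectral bound\<close>

lemma measure_mu:
  assumes u: "u \<in> H1_loc" and ups: "is_upsilon l u \<mu> \<upsilon>"
  shows "measure \<mu> {b..<b + l} = (LINT x:{b..b + l}|lebesgue. (u x)\<^sup>2 + (Dv u x)\<^sup>2) + measure \<upsilon> {b..<b + l}"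
proof -
  let ?g = "\<lambda>x. (u x)\<^sup>2 + (Dv u x)\<^sup>2" and ?B = "{b..<b + l}"
  have i: "set_integrable lebesgue {b..b + l} ?g"
    using H1_loc_square_integrable[OF u] H1_loc_derivative_square_integrable[OF u]
    by (intro set_integral_add) (auto simp: locally_square_integrable_def)
  then have i': "set_integrable lebesgue ?B ?g" by (rule set_integrable_subset) auto
  have "(\<integral>\<^sup>+x\<in>?B. ennreal (?g x) \<partial>lebesgue) = (\<integral>\<^sup>+x. ennreal (indicator ?B x *\<^sub>R ?g x) \<partial>lebesgue)"
    by (intro nn_integral_cong) (auto simp: indicator_def)
  also have "\<dots> = ennreal (LINT x:?B|lebesgue. ?g x)"
    unfolding set_lebesgue_integral_def using i' unfolding set_integrable_def
    by (intro nn_integral_eq_integral) auto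
  also have "(LINT x:?B|lebesgue. ?g x) = (LINT x:{b..b + l}|lebesgue. ?g x)"
    by (rule set_integral_Ico_Icc[OF i])
  finally have n: "(\<integral>\<^sup>+x\<in>?B. ennreal (?g x) \<partial>lebesgue) = ennreal (LINT x:{b..b + l}|lebesgue. ?g x)" .
  have sets: "sets \<upsilon> = sets borel" and fin: "emeasure \<upsilon> {b..b + l} < \<infinity>"
    using ups by (auto simp: is_upsilon_def periodic_borel_measure_def)
  have "emeasure \<upsilon> ?B \<le> emeasure \<upsilon> {b..b + l}" by (rule emeasure_mono) (auto simp: sets)
  then have "emeasure \<upsilon> ?B \<noteq> \<infinity>" using fin by auto
  then have "emeasure \<upsilon> ?B = ennreal (measure \<upsilon> ?B)" by (simp add: emeasure_eq_ennreal_measure)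
  moreover have nn: "0 \<le> (LINT x:{b..b + l}|lebesgue. ?g x)"
    unfolding set_lebesgue_integral_def by (rule integral_nonneg_AE) auto
  ultimately have "emeasure \<mu> ?B = ennreal ((LINT x:{b..b + l}|lebesgue. ?g x) + measure \<upsilon> ?B)"
    using ups n by (simp add: is_upsilon_def)
  then show ?thesis using nn by (intro measure_eq_emeasure_eq_ennreal) auto
qed

text \<open>The estimate is obtained over the period that starts at the base point \<open>b\<close>
  of the boundary condition and is moved to \<open>a\<close> by periodicity; the constants in
  \<open>s\<close> are rewritten by hyperbolic functions.\<close>

theorem spectral_bound:
  fixes l a b \<epsilon> :: real and u :: "real \<Rightarrow> real" and \<mu> \<upsilon> :: "real measure" and z :: complex
  assumes l: "l > 0" and D: "(u, \<mu>) \<in> D_per l" and ups: "is_upsilon l u \<mu> \<upsilon>"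
    and eps: "\<epsilon> = 1 \<or> \<epsilon> = -1"
    and sol: "is_solution u \<upsilon> z f" "is_quasi_derivative u z f f1" "\<exists>x. f x \<noteq> 0"
    and per: "f (b + l) = \<epsilon> *\<^sub>R f b" "f1 (b + l) = \<epsilon> *\<^sub>R f1 b"
  shows "z \<in> \<real> \<and> z \<noteq> 0 \<and> 1 / (Re z)\<^sup>2 \<le>
      \<epsilon> / (cosh (l / 2) - \<epsilon>) * (LINT x:{a..a + l}|lebesgue. u x)\<^sup>2
      + 2 * sinh (l / 2) / (cosh (l / 2) - \<epsilon>) * measure \<mu> {a..<a + l}"
proof -
  have hu: "u \<in> H1_loc" "periodic_fun_with l u" "periodic_borel_measure l \<mu>"
    using D by (auto simp: D_per_def)
  have \<upsilon>: "sets \<upsilon> = sets borel" "\<And>K. compact K \<Longrightarrow> emeasure \<upsilon> K < \<infinity>"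
    using ups by (auto simp: is_upsilon_def periodic_borel_measure_def)
  interpret eigenfunction u \<upsilon> z f f1 b l \<epsilon>
    by unfold_locales (use hu \<upsilon> sol l eps per in \<open>auto simp: periodic_fun_with_def\<close>)
  define t where "t = exp (- l / 2)"
  have t: "0 < t" "t < 1" "exp (l / 2) = 1 / t" "s = \<epsilon> * t" "exp (- (l / 2)) = t"
    using l by (auto simp: t_def s_def exp_minus field_simps)
  have ch: "cosh (l / 2) = (1 / t + t) / 2" and sh: "sinh (l / 2) = (1 / t - t) / 2"
    by (simp_all add: cosh_def sinh_def t)
  \<comment> \<open>Since \<epsilon>^2 = 1, (1 - \<epsilon> t)^2 = 1 - 2 \<epsilon> t + t^2, and
    division by 2t gives cosh(l/2) - \<epsilon>.\<close>
  have c: "cosh (l / 2) - \<epsilon> = (1 - s)\<^sup>2 / (2 * t)"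
    using t(1) eps by (auto simp: ch t(4) field_simps power2_eq_square)
  have 1: "2 * s / (1 - s)\<^sup>2 = \<epsilon> / (cosh (l / 2) - \<epsilon>)"
    unfolding c using t(1) by (simp add: t(4))
  \<comment> \<open>Here s^2 = t^2, so 1 - s^2 = 2 t sinh(l/2), and the factor 2t is the one in the
    denominator of \<open>c\<close>.\<close>
  have 2: "2 * Q.\<gamma> = 2 * sinh (l / 2) / (cosh (l / 2) - \<epsilon>)"
  proof -
    have "s\<^sup>2 = t\<^sup>2" using eps by (auto simp: t(4))
    moreover have "1 / t - t = (1 - t\<^sup>2) / t" using t(1) by (simp add: field_simps power2_eq_square)
    ultimately show ?thesis unfolding c sh using t(1) by simp
  qed
  show ?thesis
    using eigenvalue_bound
    unfolding measure_mu[OF hu(1) ups, of b, symmetric] 1 2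
      periodic_measure_interval[OF hu(3) l, of a b]
      periodic_integral_interval[OF H1_loc_continuous[OF hu(1)] hu(2) l, of a b] by blast
qed

text \<open>The two signs of \<open>spectral_bound\<close>. Because \<open>z\<close> is shown to be
  real, \<open>Re z\<close> is the eigenvalue itself, and \<open>a\<close> and \<open>b\<close> may
  be chosen independently.\<close>

theorem corollary4p2:
  fixes l a b :: real and u :: "real \<Rightarrow> real" and \<mu> \<upsilon> :: "real measure" and z :: complex
  assumes "l > 0"
    and "(u, \<mu>) \<in> D_per l"
    and "is_upsilon l u \<mu> \<upsilon>"
  shows "(z \<in> periodic_spectrum l u \<upsilon> b \<longrightarrow>
            z \<in> \<real> \<and> z \<noteq> 0 \<and>
            1 / (Re z)\<^sup>2 \<le>
              1 / (cosh (l / 2) - 1) * (LINT x:{a..a + l}|lebesgue. u x)\<^sup>2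
              + 2 * sinh (l / 2) / (cosh (l / 2) - 1) * measure \<mu> {a..<a + l}) \<and>
         (z \<in> antiperiodic_spectrum l u \<upsilon> b \<longrightarrow>
            z \<in> \<real> \<and> z \<noteq> 0 \<and>
            1 / (Re z)\<^sup>2 \<le>
              (- 1) / (cosh (l / 2) + 1) * (LINT x:{a..a + l}|lebesgue. u x)\<^sup>2
              + 2 * sinh (l / 2) / (cosh (l / 2) + 1) * measure \<mu> {a..<a + l})"
proof (intro conjI[of "_ \<longrightarrow> _"] impI)
  assume "z \<in> periodic_spectrum l u \<upsilon> b"
  then obtain f f1 where f: "is_solution u \<upsilon> z f" "is_quasi_derivative u z f f1" "\<exists>x. f x \<noteq> 0"
    and per: "f b = f (b + l)" "f1 b = f1 (b + l)"
    unfolding periodic_spectrum_def by blast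
  show "z \<in> \<real> \<and> z \<noteq> 0 \<and> 1 / (Re z)\<^sup>2 \<le>
      1 / (cosh (l / 2) - 1) * (LINT x:{a..a + l}|lebesgue. u x)\<^sup>2
      + 2 * sinh (l / 2) / (cosh (l / 2) - 1) * measure \<mu> {a..<a + l}"
    using spectral_bound[OF assms _ f, of 1 b a] per by simp
next
  assume "z \<in> antiperiodic_spectrum l u \<upsilon> b"
  then obtain f f1 where f: "is_solution u \<upsilon> z f" "is_quasi_derivative u z f f1" "\<exists>x. f x \<noteq> 0"
    and per: "f b = - f (b + l)" "f1 b = - f1 (b + l)"
    unfolding antiperiodic_spectrum_def by blast
  show "z \<in> \<real> \<and> z \<noteq> 0 \<and> 1 / (Re z)\<^sup>2 \<le>
      (- 1) / (cosh (l / 2) + 1) * (LINT x:{a..a + l}|lebesgue. u x)\<^sup>2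
      + 2 * sinh (l / 2) / (cosh (l / 2) + 1) * measure \<mu> {a..<a + l}"
    using spectral_bound[OF assms _ f, of "-1" b a] per by simp
qed

end
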